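(* For $r\in\{0,1,2\}$, \begin{align*} (q)_\infty^3\mathcal C_{1,2r+1}^{(3,8)}(q)&=\Psi_{1,2r+1}^{(3,8)}(q)-q^{1-2r}\frac{j(q^{6-2r};q^{16})j(q^{28-4r};q^{32})}{J_{32}}\cdot\frac14f_3(q)\\ &\quad+q^{-r}\frac{j(q^{2+2r};q^{16})j(q^{20+4r};q^{32})}{J_{32}}\Big(1-\frac14f_3(q)\Big), \end{align*} where $\Psi_{1,1}^{(3,8)}(q)=\frac14\frac{J_1^2J_2}{J_4}$, $\Psi_{1,3}^{(3,8)}(q)=-\frac{1}{2q}\frac{J_1^3J_4}{J_2^2}$, and $\Psi_{1,5}^{(3,8)}(q)=\frac{1}{4q^3}\frac{J_1^2J_2}{J_4}$.
   Context: $q=e^{2\pi i\tau}$, $\mathrm{Im}\,\tau>0$; $(x;q)_n=\prod_{i=0}^{n-1}(1-q^ix)$, $(x)_\infty=\prod_{i\ge0}(1-q^ix)$; $j(x;q)=(x)_\infty(q/x)_\infty(q)_\infty$; $J_a=\prod_{i\ge1}(1-q^{ai})$. Third-order mock theta function $f_3(q)=\sum_{n\ge0}\frac{q^{n^2}}{(-q;q)_n^2}$. For coprime $p'\ge2,p\ge1$, $0\le\ell\le p'-2$, level $N=p'/p-2$, the admissible character is $\chi_\ell^{(p,p')}(z;q)=z^{-\frac{\ell+1}{2}}q^{\frac{p(\ell+1)^2}{4p'}}\frac{j(-q^{p(\ell+1)+pp'}z^{-p'};q^{2pp'})-z^{\ell+1}j(-q^{-p(\ell+1)+pp'}z^{-p'};q^{2pp'})}{z^{-1/2}q^{1/8}j(z;q)}$;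 string functions $C_{m,\ell}^{(p,p')}(q)$ ($m\in2\mathbb Z+\ell$) are defined by $\chi_\ell^{(p,p')}(z;q)=\sum_{m\in2\mathbb Z+\ell}C_{m,\ell}^{(p,p')}(q)q^{m^2/(4N)}z^{-m/2}$ (expansion in $|q|<|z|<1$), and $\mathcal C_{m,\ell}^{(p,p')}(q)=q^{-s}C_{m,\ell}^{(p,p')}(q)$ with $s=-\frac18+\frac{p(\ell+1)^2}{4p'}-\frac{m^2}{4N}$. *)

theory Defs
  imports "HOL-Analysis.Analysis"
begin

text \<open>
  Fractional powers of \<open>q = e\<^sup>2\<^sup>\<pi>\<^sup>i\<^sup>\<tau>\<close> are read as \<open>q\<^sup>a = e\<^sup>2\<^sup>\<pi>\<^sup>i\<^sup>\<tau>\<^sup>a\<close>, so that quantities involving them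
  are functions of \<open>\<tau>\<close> rather than of \<open>q\<close>.
\<close>

definition nome_pow :: "complex \<Rightarrow> real \<Rightarrow> complex" where
  "nome_pow \<tau> a = exp (2 * complex_of_real pi * \<i> * \<tau> * complex_of_real a)"

abbreviation nome :: "complex \<Rightarrow> complex" where
  "nome \<tau> \<equiv> exp (2 * complex_of_real pi * \<i> * \<tau>)"

definition qpoch :: "complex \<Rightarrow> complex \<Rightarrow> nat \<Rightarrow> complex" where
  "qpoch x q n = (\<Prod>i<n. 1 - q ^ i * x)"

definition qpoch_inf :: "complex \<Rightarrow> complex \<Rightarrow> complex" where
  "qpoch_inf x q = prodinf (\<lambda>i. 1 - q ^ i * x)"

definition theta_j :: "complex \<Rightarrow> complex \<Rightarrow> complex" where
  "theta_j x q = qpoch_inf x q * qpoch_inf (q / x) q * qpoch_inf q q"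

definition J :: "nat \<Rightarrow> complex \<Rightarrow> complex" where
  "J a q = prodinf (\<lambda>i. 1 - q ^ (a * Suc i))"

definition mock_f3 :: "complex \<Rightarrow> complex" where
  "mock_f3 q = (\<Sum>n. q ^ (n\<^sup>2) / (qpoch (- q) q n)\<^sup>2)"

definition adm_level :: "nat \<Rightarrow> nat \<Rightarrow> real" where
  "adm_level p p' = real p' / real p - 2"

text \<open>
  The half-integral powers of \<open>z\<close> below use the principal branch of the logarithm. Another choice of
  \<open>z\<^sup>1\<^sup>/\<^sup>2\<close> multiplies the character and every term of its expansion by the same sign, as all
  summation indices \<open>m\<close> have the parity of \<open>\<ell>\<close>.
\<close>

definition adm_char :: "nat \<Rightarrow> nat \<Rightarrow> nat \<Rightarrow> complex \<Rightarrow> complex \<Rightarrow> complex" where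
  "adm_char p p' l z \<tau> =
     (let q = nome \<tau>; a = int p * (int l + 1); b = int p * int p' in
      z powr (- ((of_nat l + 1) / 2)) * nome_pow \<tau> (real p * (real l + 1)\<^sup>2 / (4 * real p'))
      * (theta_j (- (q powi (a + b) * z powi (- int p'))) (q ^ (2 * p * p'))
         - z ^ (l + 1) * theta_j (- (q powi (- a + b) * z powi (- int p'))) (q ^ (2 * p * p')))
      / (z powr (- (1 / 2)) * nome_pow \<tau> (1 / 8) * theta_j z q))"

text \<open>
  The expansion determines the coefficients only for \<open>m \<in> 2\<int> + \<ell>\<close>; the first conjunct fixes the
  irrelevant remaining values, so that the family is unique.
\<close>

definition is_string_family :: "nat \<Rightarrow> nat \<Rightarrow> nat \<Rightarrow> complex \<Rightarrow> (int \<Rightarrow> complex) \<Rightarrow> bool" where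
  "is_string_family p p' l \<tau> C \<longleftrightarrow>
     (\<forall>m. odd (m - int l) \<longrightarrow> C m = 0) \<and>
     (\<forall>z. norm (nome \<tau>) < norm z \<and> norm z < 1 \<longrightarrow>
        ((\<lambda>m. C m * nome_pow \<tau> ((real_of_int m)\<^sup>2 / (4 * adm_level p p')) * z powr (- (of_int m / 2)))
           has_sum adm_char p p' l z \<tau>) {m. even (m - int l)})"

definition string_fun :: "nat \<Rightarrow> nat \<Rightarrow> int \<Rightarrow> nat \<Rightarrow> complex \<Rightarrow> complex" where
  "string_fun p p' m l \<tau> = (THE C. is_string_family p p' l \<tau> C) m"

definition string_exponent :: "nat \<Rightarrow> nat \<Rightarrow> int \<Rightarrow> nat \<Rightarrow> real" where
  "string_exponent p p' m l =
     - (1 / 8) + real p * (real l + 1)\<^sup>2 / (4 * real p') - (real_of_int m)\<^sup>2 / (4 * adm_level p p')"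

definition string_fun_norm :: "nat \<Rightarrow> nat \<Rightarrow> int \<Rightarrow> nat \<Rightarrow> complex \<Rightarrow> complex" where
  "string_fun_norm p p' m l \<tau> = nome_pow \<tau> (- string_exponent p p' m l) * string_fun p p' m l \<tau>"

text \<open>
  \<open>\<Psi>\<^sub>1\<^sub>,\<^sub>\<ell>\<close> for \<open>(p, p') = (3, 8)\<close>; meaningful only for \<open>\<ell> \<in> {1, 3, 5}\<close>.
\<close>

definition Psi38 :: "nat \<Rightarrow> complex \<Rightarrow> complex" where
  "Psi38 l q =
     (if l = 1 then 1 / 4 * ((J 1 q)\<^sup>2 * J 2 q / J 4 q)
      else if l = 3 then - (1 / (2 * q)) * ((J 1 q) ^ 3 * J 4 q / (J 2 q)\<^sup>2)
      else if l = 5 then 1 / (4 * q ^ 3) * ((J 1 q)\<^sup>2 * J 2 q / J 4 q)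
      else 0)"

end

theory Submission
  imports Defs "HOL-Library.Nat_Bijection"
begin

text \<open>
  The normalised string function is the coefficient of \<open>z\<^sup>r\<close> in the Laurent expansion on
      \<open>|q| < |z| < 1\<close> of
  \<open>N\<^sub>r(z) / j(z; q)\<close>, where \<open>N\<^sub>r\<close> is the numerator of the character. Put
      \<open>Q = q\<^sup>3\<close>. Theta identities express
  \<open>N\<^sub>1\<close> and \<open>N\<^sub>0 + q\<^sup>3 z\<^sup>-\<^sup>2 N\<^sub>2\<close> as multiples of
      the difference and of the sum of \<open>j(z; Q) j(-z; q)\<close> and
  \<open>j(-z; Q) j(z; q)\<close>. After division by \<open>j(z; q)\<close> one term is a theta function, and
      the other is expanded by means of
  \<open>j(-z; q) / j(z; q) = const \<sqdot> \<Sum>\<^sub>k z\<^sup>k / (1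
      + q\<^sup>k)\<close>; its relevant coefficient is Watson's Appell sum for
  \<open>f\<^sub>3\<close>. The remaining combination \<open>N\<^sub>0
      - q\<^sup>3 z\<^sup>-\<^sup>2 N\<^sub>2 = j(z\<^sup>2; Q)\<close> contributes no mock part: a symmetry of
      its
  expansion turns the coefficient into a theta function. The theta products of the statement are, up to sign,
      the even
  and the odd part of \<open>(q)\<^sub>\<infinity>\<close>.
\<close>

subsection \<open>Infinite products and theta functions\<close>

text \<open>The symmetry \<open>l -> p' - 2 - l\<close> exchanges \<open>r = 0\<close> and
  \<open>r = 2\<close> and fixes \<open>r = 1\<close>. Accordingly \<open>N_1\<close> is a single
  theta function, \<open>j(z^4; q^12)\<close>, whereas \<open>N_0\<close> and \<open>N_2\<close>
  become tractable only when mixed. The factors \<open>z\<close> and \<open>z^2\<close> shift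
  indices, so that every case asks for coefficients at \<open>z^0\<close>.

  Let \<open>Y\<close> and \<open>-X\<close> be the even and the odd part of \<open>(q)_inf\<close>.
  Besides a theta quotient, the sum of the mixed numerators contributes
  \<open>(Y + X)(1 - f_3/2)\<close>, where \<open>Y + X\<close> is \<open>(q)_inf\<close> taken at
  \<open>-q\<close>; the difference contributes \<open>Y - X\<close>. Half the sum of both is
  \<open>Y - (X + Y) f_3/4\<close>: hence the quarter, and the fact that only one of the two
  products carries a summand 1. Half their difference has \<open>X\<close> and \<open>Y\<close>
  exchanged, which is the case \<open>r = 2\<close>.

  One finite identity, a Bailey pair with \<open>beta_n = 1/(-q; q)_n^2\<close>, serves twice:
  summed against \<open>q^(n^2)\<close> it gives \<open>f_3\<close>, and for \<open>n\<close>
  tending to infinity it gives the constant in the expansion of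
  \<open>j(-z; q) / j(z; q)\<close>.\<close>

lemma convergent_qpoch:
  assumes "norm q < 1"
  shows "convergent_prod (\<lambda>i. 1 - q ^ i * (x::complex))"
proof (rule abs_convergent_prod_imp_convergent_prod)
  show "abs_convergent_prod (\<lambda>i. 1 - q ^ i * x)"
    unfolding abs_convergent_prod_conv_summable
    using assms by (auto simp: norm_mult norm_power intro!: summable_mult2 summable_geometric)
qed

lemma qpoch_LIMSEQ:
  assumes "norm q < 1"
  shows "(\<lambda>n. qpoch x q n) \<longlonglongrightarrow> qpoch_inf x q"
  unfolding qpoch_def qpoch_inf_def
  using convergent_prod_LIMSEQ[OF convergent_qpoch[OF assms]] LIMSEQ_lessThan_iff_atMost by blast

lemma qpoch_Suc: "qpoch x q (Suc n) = (1 - x) * qpoch (q * x) q n"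
  unfolding qpoch_def by (simp add: prod.lessThan_Suc_shift mult_ac del: prod.lessThan_Suc)

lemma qpoch_inf_unfold:
  assumes "norm q < 1"
  shows "qpoch_inf x q = (1 - x) * qpoch_inf (q * x) q"
proof -
  have "(\<lambda>n. qpoch x q (Suc n)) \<longlonglongrightarrow> qpoch_inf x q"
    using qpoch_LIMSEQ[OF assms] by (rule LIMSEQ_Suc)
  moreover have "(\<lambda>n. qpoch x q (Suc n)) \<longlonglongrightarrow> (1 - x) * qpoch_inf (q * x) q"
    unfolding qpoch_Suc by (intro tendsto_intros qpoch_LIMSEQ assms)
  ultimately show ?thesis
    by (rule LIMSEQ_unique)
qed

lemma qpoch_inf_nonzero:
  assumes "norm q < 1" "\<And>i. q ^ i * x \<noteq> 1"
  shows "qpoch_inf x q \<noteq> 0"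
  unfolding qpoch_inf_def
  by (rule prodinf_nonzero[OF convergent_qpoch[OF assms(1)]]) (use assms(2) in \<open>metis
      eq_iff_diff_eq_0\<close>)

lemma qpoch_inf_nonzero':
  assumes "norm q < 1" "norm x < 1"
  shows "qpoch_inf x q \<noteq> 0"
proof (rule qpoch_inf_nonzero[OF assms(1)])
  fix i
  have "norm (q ^ i * x) \<le> 1 * norm x"
    unfolding norm_mult norm_power using assms by (intro mult_right_mono power_le_one) auto
  then show "q ^ i * x \<noteq> 1"
    using assms(2) by auto
qed

text \<open>The first \<open>n * m\<close> factors are grouped by the residue of the exponent mod
  \<open>m\<close>; then \<open>n\<close> tends to infinity along this subsequence.\<close>

lemma qpoch_inf_dissect:
  assumes "norm q < 1" "m > 0"
  shows "qpoch_inf x q = (\<Prod>j<m. qpoch_inf (q ^ j * x) (q ^ m))"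
proof -
  have qm: "norm (q ^ m) < 1"
    using assms by (auto simp: norm_power power_less_one_iff)
  have eq: "qpoch x q (n * m) = (\<Prod>j<m. qpoch (q ^ j * x) (q ^ m) n)" for n
  proof -
    have "qpoch x q (n * m) = (\<Prod>i<n. \<Prod>k\<in>{i * m..<i * m + m}. 1 - q ^ k * x)"
      unfolding qpoch_def by (rule prod.nat_group[symmetric])
    also have "\<dots> = (\<Prod>i<n. \<Prod>j<m. 1 - q ^ (i * m + j) * x)"
    proof (rule prod.cong[OF refl])
      fix i
      show "(\<Prod>k\<in>{i * m..<i * m + m}. 1 - q ^ k * x) = (\<Prod>j<m. 1 - q ^ (i * m + j) * x)"
        by (rule prod.reindex_bij_witness[of _ "\<lambda>j. i * m + j" "\<lambda>k. k - i * m"]) auto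
    qed
    also have "\<dots> = (\<Prod>j<m. \<Prod>i<n. 1 - q ^ (i * m + j) * x)"
      by (rule prod.swap)
    finally show ?thesis
      unfolding qpoch_def by (simp add: power_add power_mult[symmetric] mult_ac)
  qed
  have "(\<lambda>n. qpoch x q (n * m)) \<longlonglongrightarrow> qpoch_inf x q"
    using LIMSEQ_subseq_LIMSEQ[OF qpoch_LIMSEQ[OF assms(1)], of "\<lambda>n. n * m"] assms(2)
    by (auto simp: o_def strict_mono_def)
  moreover have "(\<lambda>n. qpoch x q (n * m)) \<longlonglongrightarrow> (\<Prod>j<m. qpoch_inf (q ^ j
      * x) (q ^ m))"
    unfolding eq by (intro tendsto_prod qpoch_LIMSEQ qm)
  ultimately show ?thesis
    by (rule LIMSEQ_unique)
qed

lemma qpoch_inf_mult_minus: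
  assumes "norm q < 1"
  shows "qpoch_inf x q * qpoch_inf (- x) q = qpoch_inf (x\<^sup>2) (q\<^sup>2)"
proof -
  have q2: "norm (q\<^sup>2) < 1"
    using assms by (auto simp: norm_power power_less_one_iff)
  have eq: "qpoch x q n * qpoch (- x) q n = qpoch (x\<^sup>2) (q\<^sup>2) n" for n
    unfolding qpoch_def prod.distrib[symmetric]
    by (intro prod.cong refl) (simp add: algebra_simps power2_eq_square power_mult_distrib)
  have "(\<lambda>n. qpoch x q n * qpoch (- x) q n) \<longlonglongrightarrow> qpoch_inf x q * qpoch_inf (- x) q"
    by (intro tendsto_intros qpoch_LIMSEQ assms)
  moreover have "(\<lambda>n. qpoch x q n * qpoch (- x) q n) \<longlonglongrightarrow> qpoch_inf (x\<^sup>2)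
      (q\<^sup>2)"
    unfolding eq by (rule qpoch_LIMSEQ[OF q2])
  ultimately show ?thesis
    by (rule LIMSEQ_unique)
qed

lemma J_eq: "J a q = qpoch_inf (q ^ a) (q ^ a)"
  unfolding J_def qpoch_inf_def by (simp add: power_add power_mult[symmetric] mult_ac)

lemma J_power: "J a (q ^ b) = J (a * b) q"
  unfolding J_eq by (simp add: power_mult[symmetric] mult.commute)

lemma J_nonzero:
  assumes "norm q < 1" "a > 0"
  shows "J a q \<noteq> 0"
  unfolding J_eq using assms
  by (intro qpoch_inf_nonzero') (auto simp: norm_power power_less_one_iff)

section \<open>Functional equations and product dissections of theta functions\<close>

lemma theta_j_inverse:
  assumes "q \<noteq> 0" "x \<noteq> 0"
  shows "theta_j (q / x) q = theta_j x q"
  unfolding theta_j_def using assms by simp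

lemma theta_j_shift:
  assumes "norm q < 1" "x \<noteq> 0" "q \<noteq> 0"
  shows "theta_j (q * x) q = - theta_j x q / x"
proof -
  have "qpoch_inf (1 / x) q = (1 - 1 / x) * qpoch_inf (q / x) q"
    using qpoch_inf_unfold[OF assms(1), of "1 / x"] by simp
  then have "theta_j (q * x) q = qpoch_inf (q * x) q * ((1 - 1 / x) * qpoch_inf (q / x) q) * qpoch_inf q q"
    unfolding theta_j_def using assms by simp
  also have "\<dots> = - ((1 - x) * qpoch_inf (q * x) q) * qpoch_inf (q / x) q * qpoch_inf q q / x"
    using assms by (simp add: field_simps)
  finally show ?thesis
    unfolding theta_j_def qpoch_inf_unfold[OF assms(1), of x] by simp
qed

lemma theta_j_mult_minus:
  assumes "norm q < 1"
  shows "theta_j x q * theta_j (- x) q * J 2 q = theta_j (x\<^sup>2) (q\<^sup>2) * (J 1 q)\<^sup>2"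
proof -
  have "theta_j x q * theta_j (- x) q * J 2 q
      = (qpoch_inf x q * qpoch_inf (- x) q) * (qpoch_inf (q / x) q * qpoch_inf (- (q / x)) q)
          * (J 1 q)\<^sup>2 * J 2 q"
    unfolding theta_j_def J_eq by (simp add: power2_eq_square mult_ac)
  also have "\<dots> = theta_j (x\<^sup>2) (q\<^sup>2) * (J 1 q)\<^sup>2"
    unfolding qpoch_inf_mult_minus[OF assms] theta_j_def J_eq by (simp add: power_divide mult_ac)
  finally show ?thesis .
qed

lemma theta_j_dissect_product_2:
  assumes "norm q < 1" "q \<noteq> 0"
  shows "theta_j x q * (J 2 q)\<^sup>2 = theta_j x (q\<^sup>2) * theta_j (q * x) (q\<^sup>2) * J 1 q"
proof -
  have *: "qpoch_inf y q = qpoch_inf y (q\<^sup>2) * qpoch_inf (q * y) (q\<^sup>2)" for y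
    using qpoch_inf_dissect[OF assms(1), of 2 y] by (simp add: numeral_2_eq_2)
  show ?thesis
    unfolding theta_j_def *[of x] *[of "q / x"] J_eq using assms
    by (simp add: power2_eq_square)
qed

lemma theta_j_dissect_product_3:
  assumes "norm q < 1" "q \<noteq> 0"
  shows "theta_j x q * (J 3 q) ^ 3
    = theta_j x (q ^ 3) * theta_j (q * x) (q ^ 3) * theta_j (q\<^sup>2 * x) (q ^ 3) * J 1 q"
proof -
  have *: "qpoch_inf y q = qpoch_inf y (q ^ 3) * qpoch_inf (q * y) (q ^ 3) * qpoch_inf (q\<^sup>2
      * y) (q ^ 3)" for y
    using qpoch_inf_dissect[OF assms(1), of 3 y] by (simp add: numeral_3_eq_3 numeral_2_eq_2)
  show ?thesis
    unfolding theta_j_def *[of x] *[of "q / x"] J_eq using assms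
    by (simp add: power2_eq_square power3_eq_cube)
qed

lemma theta_j_nonzero:
  assumes "norm q < norm z" "norm z < 1"
  shows "theta_j z q \<noteq> 0"
proof -
  have "norm q < 1" "norm (q / z) < 1"
    using assms norm_ge_zero[of q] by (auto simp: norm_divide divide_simps simp del: norm_ge_zero)
  then show ?thesis
    unfolding theta_j_def using assms(2) by (simp add: qpoch_inf_nonzero')
qed

lemma theta_j_1_eq_0: "norm q < 1 \<Longrightarrow> theta_j 1 q = 0"
  unfolding theta_j_def by (subst qpoch_inf_unfold) auto

subsection \<open>Two-sided Laurent series\<close>

text \<open>\<open>has_sum\<close> is unconditional, hence absolute for complex terms. This is what
  licenses every rearrangement of products of such series.\<close>

definition has_laurent :: "(int \<Rightarrow> complex) \<Rightarrow> complex \<Rightarrow> complex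
    \<Rightarrow> bool" where
  "has_laurent a z s \<longleftrightarrow> ((\<lambda>k. a k * z powi k) has_sum s) UNIV"

text \<open>\<open>infsum\<close> is 0 for a sum that does not converge; \<open>conv_has_sum\<close>
  supplies the convergence where it is used.\<close>

definition conv :: "(int \<Rightarrow> complex) \<Rightarrow> (int \<Rightarrow> complex) \<Rightarrow> int
    \<Rightarrow> complex" where
  "conv a b n = (\<Sum>\<^sub>\<infinity>k. a k * b (n - k))"

lemma has_sum_abs_summable:
  fixes f :: "'a \<Rightarrow> complex"
  assumes "(f has_sum s) A"
  shows "(\<lambda>x. norm (f x)) summable_on A"
  using assms has_sum_imp_summable summable_on_iff_abs_summable_on_complex by blast

lemma has_sum_sum:
  fixes f :: "'i \<Rightarrow> 'a \<Rightarrow> 'b::topological_comm_monoid_add"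
  assumes "finite I" "\<And>i. i \<in> I \<Longrightarrow> (f i has_sum s i) A"
  shows "((\<lambda>x. \<Sum>i\<in>I. f i x) has_sum (\<Sum>i\<in>I. s i)) A"
  using assms by (induction rule: finite_induct) (auto intro: has_sum_add)

lemma has_sum_diff:
  fixes f g :: "'a \<Rightarrow> complex"
  assumes "(f has_sum s) A" "(g has_sum t) A"
  shows "((\<lambda>x. f x - g x) has_sum (s - t)) A"
  using has_sum_add[OF assms(1) has_sum_uminusI[OF assms(2)]] by simp

lemma has_sum_product:
  fixes f :: "'a \<Rightarrow> complex" and g :: "'b \<Rightarrow> complex"
  assumes "(f has_sum s) A" "(g has_sum t) B"
  shows "((\<lambda>(x, y). f x * g y) has_sum (s * t)) (A \<times> B)"
proof (rule has_sum_SigmaI)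
  show "((\<lambda>y. case (x, y) of (x, y) \<Rightarrow> f x * g y) has_sum f x * t) B" for x
    using has_sum_cmult_right[OF assms(2), of "f x"] by simp
  show "((\<lambda>x. f x * t) has_sum s * t) A"
    using has_sum_cmult_left[OF assms(1), of t] .
  have "(\<lambda>(x, y). norm (f x) * norm (g y)) summable_on A \<times> B"
  proof (rule summable_on_SigmaI)
    show "((\<lambda>y. case (x, y) of (x, y) \<Rightarrow> norm (f x) * norm (g y))
        has_sum norm (f x) * (\<Sum>\<^sub>\<infinity>y\<in>B. norm (g y))) B" for x
      using has_sum_abs_summable[OF assms(2)]
      by (auto intro!: has_sum_cmult_right)
    show "(\<lambda>x. norm (f x) * (\<Sum>\<^sub>\<infinity>y\<in>B. norm (g y))) summable_on A"
      using has_sum_abs_summable[OF assms(1)] by (rule summable_on_cmult_left)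
  qed auto
  then have "(\<lambda>x. norm (case x of (x, y) \<Rightarrow> f x * g y)) summable_on A \<times> B"
    by (simp add: case_prod_unfold norm_mult)
  then show "(\<lambda>(x, y). f x * g y) summable_on A \<times> B"
    by (rule abs_summable_summable)
qed

text \<open>The product over pairs \<open>(k, l)\<close> is regrouped by \<open>n = k + l\<close>.
  Summability at a single nonzero \<open>z\<close> makes every convolution sum converge, as
  \<open>z powi n\<close> is a nonzero constant on each fibre.\<close>

lemma
  assumes "has_laurent a z s" "has_laurent b z t" "z \<noteq> 0"
  shows has_laurent_mult: "has_laurent (conv a b) z (s * t)"
    and conv_has_sum: "((\<lambda>k. a k * b (n - k)) has_sum conv a b n) UNIV"
proof -
  let ?h = "\<lambda>(n, k). a k * b (n - k) * z powi n"
  have "((\<lambda>(k, l). (a k * z powi k) * (b l * z powi l)) has_sum (s * t)) (UNIV \<times> UNIV)"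
    using assms(1,2) unfolding has_laurent_def by (rule has_sum_product)
  also have "?this \<longleftrightarrow> (?h has_sum (s * t)) (UNIV \<times> UNIV)"
    by (rule has_sum_reindex_bij_witness[of _ "\<lambda>(n, k). (k, n - k)" "\<lambda>(k, l). (k + l, k)"])
       (use assms(3) in \<open>auto simp: power_int_add\<close>)
  finally have h: "(?h has_sum (s * t)) (UNIV \<times> UNIV)" .
  have s: "((\<lambda>k. a k * b (n - k)) has_sum conv a b n) UNIV" for n
  proof -
    have "(\<lambda>k. a k * b (n - k) * z powi n) summable_on UNIV"
      using has_sum_imp_summable[OF h] summable_on_SigmaD1[of "\<lambda>n k. a k * b (n
          - k) * z powi n" UNIV "\<lambda>_. UNIV" n]
      by simp
    then have "(\<lambda>k. a k * b (n - k) * z powi n * z powi (- n)) summable_on UNIV"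
      by (rule summable_on_cmult_left)
    then have "(\<lambda>k. a k * b (n - k)) summable_on UNIV"
      using assms(3) by (simp add: power_int_minus mult.assoc)
    then show ?thesis
      unfolding conv_def by simp
  qed
  then show "((\<lambda>k. a k * b (n - k)) has_sum conv a b n) UNIV" .
  show "has_laurent (conv a b) z (s * t)"
    unfolding has_laurent_def
    by (rule has_sum_SigmaD[OF h]) (use s in \<open>auto intro: has_sum_cmult_left\<close>)
qed

lemma has_laurent_unique: "has_laurent a z s \<Longrightarrow> has_laurent a z t \<Longrightarrow> s = t"
  unfolding has_laurent_def by (rule has_sum_unique)

lemma has_laurent_add:
  "has_laurent a z s \<Longrightarrow> has_laurent b z t
      \<Longrightarrow> has_laurent (\<lambda>k. a k + b k) z (s + t)"
  unfolding has_laurent_def by (drule (1) has_sum_add) (simp add: algebra_simps)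

lemma has_laurent_cmult:
  "has_laurent a z s \<Longrightarrow> has_laurent (\<lambda>k. c * a k) z (c * s)"
  unfolding has_laurent_def by (drule has_sum_cmult_right[of _ _ _ c]) (simp add: algebra_simps)

lemma has_laurent_diff:
  "has_laurent a z s \<Longrightarrow> has_laurent b z t
      \<Longrightarrow> has_laurent (\<lambda>k. a k - b k) z (s - t)"
  using has_laurent_add[of a z s "\<lambda>k. - 1 * b k" "- 1 * t"] has_laurent_cmult[of b z t "-1"] by simp

lemma has_laurent_shift:
  assumes "has_laurent a z s" "z \<noteq> 0"
  shows "has_laurent (\<lambda>k. a (k - m)) z (z powi m * s)"
proof -
  have "((\<lambda>k. z powi m * (a k * z powi k)) has_sum (z powi m * s)) UNIV"
    using assms(1) unfolding has_laurent_def by (rule has_sum_cmult_right)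
  also have "?this \<longleftrightarrow> ((\<lambda>k. a (k - m) * z powi k) has_sum (z powi m * s)) UNIV"
    by (rule has_sum_reindex_bij_witness[of _ "\<lambda>k. k - m" "\<lambda>k. k + m"])
       (use assms(2) in \<open>auto simp: power_int_add\<close>)
  finally show ?thesis
    unfolding has_laurent_def .
qed

lemma has_laurent_inverse:
  assumes "has_laurent a (1 / z) s"
  shows "has_laurent (\<lambda>k. a (- k)) z s"
proof -
  have "((\<lambda>k. a k * (1 / z) powi k) has_sum s) UNIV
      \<longleftrightarrow> ((\<lambda>k. a (- k) * z powi k) has_sum s) UNIV"
    by (rule has_sum_reindex_bij_witness[of _ uminus uminus])
       (auto simp: power_int_minus power_int_divide_distrib field_simps)
  with assms show ?thesis
    unfolding has_laurent_def by simp
qed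

lemma has_laurent_scale:
  assumes "has_laurent a (c * z) s"
  shows "has_laurent (\<lambda>k. a k * c powi k) z s"
  using assms unfolding has_laurent_def by (simp add: power_int_mult_distrib mult_ac)

text \<open>Averaging over the \<open>N\<close>-th roots of unity isolates the coefficients in one residue
    class mod \<open>N\<close>;
  for large \<open>N\<close> only one of them is not in the tail.\<close>

lemma has_laurent_zero_imp_coeff_zero:
  assumes "\<rho> > 0" and zero: "\<And>z. norm z = \<rho> \<Longrightarrow> has_laurent a z 0"
  shows "a k = 0"
proof -
  \<comment> \<open>Recentred at \<open>k\<close> and rescaled to the unit circle; the goal becomes
    \<open>b 0 = 0\<close>.\<close>
  define b where "b j = a (k + j) * of_real \<rho> powi j" for j
  have b: "((\<lambda>j. b j * w powi j) has_sum 0) UNIV" if "norm w = 1" for w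
  proof -
    have w: "w \<noteq> 0" "norm (of_real \<rho> * w) = \<rho>"
      using that assms(1) by (auto simp: norm_mult)
    have "has_laurent (\<lambda>j. a (j - (- k))) (of_real \<rho> * w) ((of_real \<rho> * w) powi (- k) * 0)"
      by (rule has_laurent_shift[OF zero]) (use w assms(1) in auto)
    then show ?thesis
      unfolding has_laurent_def b_def by (simp add: power_int_mult_distrib add.commute mult_ac)
  qed
  have abs: "(\<lambda>j. norm (b j)) summable_on UNIV"
    using has_sum_abs_summable[OF b[of 1]] by simp
  have "norm (b 0) < e" if e: "e > 0" for e
  proof -
    obtain F where F: "finite F" "norm (sum (\<lambda>j. norm (b j)) F
        - (\<Sum>\<^sub>\<infinity>j. norm (b j))) \<le> e / 2"
      using infsum_finite_approximation[OF abs, of "e / 2"] e by (auto simp: dist_norm)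
    \<comment> \<open>Larger than every \<open>abs j\<close> with \<open>j\<close> in
      \<open>F\<close>, so that the nonzero multiples of \<open>N\<close> all lie in the tail, whose
      absolute sum is at most \<open>e / 2\<close>.\<close>
    define N where "N = Suc (nat (Max (insert 0 (abs ` F))))"
    have N: "\<bar>j\<bar> < int N" if "j \<in> F" for j
    proof -
      have "\<bar>j\<bar> \<le> Max (insert 0 (abs ` F))"
        using F(1) that by auto
      then show ?thesis
        unfolding N_def by linarith
    qed
    have N0: "N > 0"
      by (simp add: N_def)
    define u where "u = cis (2 * pi / N)"
    have uN: "u ^ N = 1"
      unfolding u_def Complex.DeMoivre using N0 by simp
    have u: "norm u = 1" "u \<noteq> 0"
      unfolding u_def by (auto simp: cis_neq_zero)
    define c where "c j = (\<Sum>i<N. (u powi j) ^ i)" for j :: int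
    have c_dvd: "c j = of_nat N" if "int N dvd j" for j
    proof -
      from that obtain l where "j = int N * l" by auto
      then have "u powi j = 1"
        using uN by (simp add: power_int_mult)
      then show ?thesis
        by (simp add: c_def)
    qed
    have c_ndvd: "c j = 0" if "\<not> int N dvd j" for j
    proof -
      have "u powi j \<noteq> 1"
      proof
        assume "u powi j = 1"
        then have "cis (real_of_int j * (2 * pi / N)) = 1"
          unfolding u_def by (simp add: cis_power_int)
        then have "cos (real_of_int j * (2 * pi / N)) = 1"
          by (metis cis.sel(1) one_complex.sel(1))
        then obtain l :: int where "real_of_int j * (2 * pi / N) = of_int l * 2 * pi"
          by (auto simp: cos_one_2pi_int)
        then have "real_of_int j = of_int l * real N"
          using N0 by (simp add: field_simps)
        then have "j = l * int N"
          by (metis of_int_eq_iff of_int_mult of_int_of_nat_eq)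
        with that show False by simp
      qed
      moreover have "(u powi j) ^ N = 1"
      proof -
        have "(u powi j) ^ N = (u ^ N) powi j"
          by (metis mult.commute power_int_mult power_int_of_nat)
        then show ?thesis
          using uN by simp
      qed
      ultimately show ?thesis
        unfolding c_def by (simp add: geometric_sum)
    qed
    have "((\<lambda>j. \<Sum>i<N. b j * (u ^ i) powi j) has_sum (\<Sum>i<N. 0)) UNIV"
      using u by (intro has_sum_sum b) (simp_all add: norm_power)
    moreover have "(\<Sum>i<N. b j * (u ^ i) powi j) = b j * c j" for j
    proof -
      have "(u ^ i) powi j = (u powi j) ^ i" for i
        by (metis mult.commute power_int_mult power_int_of_nat)
      then show ?thesis
        unfolding c_def by (simp add: sum_distrib_left)
    qed
    ultimately have "((\<lambda>j. b j * c j) has_sum 0) UNIV"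
      by simp
    then have sum0: "((\<lambda>j. b j * c j / of_nat N) has_sum 0) UNIV"
      using has_sum_divide_const by fastforce
    have "((\<lambda>j. b j * c j / of_nat N) has_sum (- b 0)) (UNIV - {0})"
    proof -
      have "((\<lambda>j. b j * c j / of_nat N) has_sum (b 0)) {0}"
        using N0 c_dvd[of 0] by (intro has_sum_finiteI) auto
      from has_sum_Diff[OF sum0 this] show ?thesis by simp
    qed
    then have *: "((\<lambda>j. b j * c j / of_nat N) has_sum (- b 0)) (UNIV - insert 0 F)"
    proof (rule iffD1[OF has_sum_cong_neutral, rotated -1])
      fix j assume "j \<in> UNIV - {0} - (UNIV - insert 0 F)"
      then have "j \<in> F" "j \<noteq> 0" by auto
      then have "\<not> int N dvd j"
        using N[of j] zdvd_imp_le[of "int N" "\<bar>j\<bar>"] by auto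
      then show "b j * c j / of_nat N = 0"
        using c_ndvd by simp
    qed auto
    have "norm (- b 0) \<le> (\<Sum>\<^sub>\<infinity>j\<in>UNIV - F. norm (b j))"
    proof -
      have le: "norm (b j * c j / of_nat N) \<le> norm (b j)" for j
        using N0 c_dvd[of j] c_ndvd[of j] by (cases "int N dvd j") (auto simp: norm_mult norm_divide)
      have sm: "(\<lambda>j. norm (b j)) summable_on A" for A
        using abs by (rule summable_on_subset) auto
      have "norm (- b 0) \<le> (\<Sum>\<^sub>\<infinity>j\<in>UNIV - insert 0 F. norm (b j))"
        by (rule norm_infsum_le[OF * has_sum_infsum[OF sm]]) (rule le)
      also have "\<dots> \<le> (\<Sum>\<^sub>\<infinity>j\<in>UNIV - F. norm (b j))"
        by (rule infsum_mono2) (use sm in auto)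
      finally show ?thesis .
    qed
    also have "\<dots> = (\<Sum>\<^sub>\<infinity>j. norm (b j)) - (\<Sum>j\<in>F. norm (b j))"
      using F(1) abs by (subst infsum_Diff) auto
    also have "\<dots> \<le> e / 2"
      using F(2) unfolding real_norm_def by linarith
    also have "\<dots> < e"
      using e by simp
    finally show ?thesis by simp
  qed
  then have "b 0 = 0"
    by (meson less_irrefl zero_less_norm_iff)
  then show ?thesis
    by (simp add: b_def)
qed

subsection \<open>The Jacobi triple product\<close>

definition tri :: "int \<Rightarrow> int" where
  "tri n = n * (n - 1) div 2"

lemma double_tri: "2 * tri n = n * (n - 1)"
proof -
  have "even (n * (n - 1))" by auto
  then show ?thesis unfolding tri_def by simp
qed

lemma tri_add: "tri (m + n) = tri m + tri n + m * n"
proof -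
  have "2 * tri (m + n) = 2 * (tri m + tri n + m * n)"
    unfolding distrib_left double_tri by (simp add: algebra_simps)
  then show ?thesis by simp
qed

lemma tri_0 [simp]: "tri 0 = 0" and tri_1 [simp]: "tri 1 = 0"
  by (simp_all add: tri_def)

lemma tri_uminus: "tri (- n) = tri n + n"
  using double_tri[of "- n"] double_tri[of n] by (simp add: algebra_simps)

lemma tri_nonneg: "tri n \<ge> 0"
proof -
  have "n * (n - 1) \<ge> 0"
    by (cases "n \<ge> 1") (auto intro: mult_nonneg_nonneg mult_nonpos_nonpos)
  then show ?thesis using double_tri[of n] by linarith
qed

text \<open>The usual convention \<open>1/(q)_k = 0\<close> for negative \<open>k\<close>. It lets
  the recurrence hold for all integers and lets terminating sums run over all of them.\<close>

definition inv_qpoch :: "complex \<Rightarrow> int \<Rightarrow> complex" where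
  "inv_qpoch q k = (if k < 0 then 0 else 1 / qpoch q q (nat k))"

definition theta_coeff :: "complex \<Rightarrow> int \<Rightarrow> complex" where
  "theta_coeff q n = (- 1) powi n * q powi tri n"

definition euler_coeff :: "complex \<Rightarrow> int \<Rightarrow> complex" where
  "euler_coeff q m = theta_coeff q m * inv_qpoch q m"

text \<open>The Durfee rectangle sum. By Cauchy's identity its value is \<open>1/(q)_inf\<close>,
  whatever \<open>n\<close> is.\<close>

definition cauchy_sum :: "complex \<Rightarrow> int \<Rightarrow> complex" where
  "cauchy_sum q n = (\<Sum>\<^sub>\<infinity>m. q powi (m * (m + n)) * inv_qpoch q m * inv_qpoch q (m + n))"

lemma inv_qpoch_0 [simp]: "inv_qpoch q 0 = 1"
  by (simp add: inv_qpoch_def qpoch_def)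

lemma inv_qpoch_neg: "k < 0 \<Longrightarrow> inv_qpoch q k = 0"
  by (simp add: inv_qpoch_def)

section \<open>Euler's expansion of \<open>(x; q)_inf\<close>\<close>

context
  fixes q :: complex
  assumes q0: "q \<noteq> 0" and q1: "norm q < 1"
begin

lemma power_ne_1: "k > 0 \<Longrightarrow> q ^ k \<noteq> 1"
  using q1 power_less_one_iff[of "norm q" k] by (metis norm_ge_zero norm_one norm_power less_irrefl)

lemma power_ne_minus_1: "k > 0 \<Longrightarrow> q ^ k \<noteq> -1"
  using q1 power_less_one_iff[of "norm q" k] by (metis norm_ge_zero norm_one norm_minus_cancel norm_power
      less_irrefl)

lemma powi_ne_minus_1: "q powi k \<noteq> -1"
proof (cases k rule: int_cases2)
  case (nonneg n)
  then show ?thesis using power_ne_minus_1[of n] by (cases "n = 0") auto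
next
  case (nonpos n)
  show ?thesis
  proof
    assume "q powi k = -1"
    then have "inverse (inverse (q ^ n)) = inverse (-1)"
      using nonpos by (simp add: power_int_minus)
    then show False
      using power_ne_minus_1[of n] by (cases "n = 0") auto
  qed
qed

lemma qpoch_q_nonzero: "qpoch q q n \<noteq> 0"
  unfolding qpoch_def using power_ne_1 by (auto simp: power_Suc2[symmetric] simp del: power_Suc power_Suc2)

text \<open>This includes \<open>k = 0\<close>, where the left side is 0 by convention and the
  factor \<open>1 - q powi 0\<close> vanishes on the right.\<close>

lemma inv_qpoch_pred: "inv_qpoch q (k - 1) = (1 - q powi k) * inv_qpoch q k"
proof (cases "k \<le> 0")
  case True
  then show ?thesis by (cases "k = 0") (auto simp: inv_qpoch_def)
next
  case False
  define n where "n = nat (k - 1)"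
  have k: "k = int (Suc n)" using False by (simp add: n_def)
  have "qpoch q q (Suc n) = qpoch q q n * (1 - q ^ Suc n)"
    unfolding qpoch_def by (simp add: mult.commute)
  then show ?thesis
    using qpoch_q_nonzero[of n] qpoch_q_nonzero[of "Suc n"] unfolding k inv_qpoch_def power_int_of_nat
    by (simp add: nat_add_distrib field_simps)
qed

lemma inv_qpoch_LIMSEQ: "(\<lambda>n. inv_qpoch q (int n)) \<longlonglongrightarrow> 1 / qpoch_inf q q"
  unfolding inv_qpoch_def using qpoch_inf_nonzero'[OF q1 q1]
  by (auto intro!: tendsto_intros qpoch_LIMSEQ q1)

lemma inv_qpoch_bounded: "\<exists>B>0. \<forall>k. norm (inv_qpoch q k) \<le> B"
proof -
  have "Bseq (\<lambda>n. inv_qpoch q (int n))"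
    using inv_qpoch_LIMSEQ convergent_imp_Bseq convergentI by blast
  then obtain B where B: "B > 0" "\<And>n. norm (inv_qpoch q (int n)) \<le> B"
    by (auto simp: Bseq_def)
  have "norm (inv_qpoch q k) \<le> B" for k
    using B(1) B(2)[of "nat k"] by (cases "k < 0") (auto simp: inv_qpoch_neg)
  with B(1) show ?thesis by blast
qed

lemma euler_coeff_rec: "euler_coeff q (m + 1) * (1 - q powi (m + 1)) = - (q powi m) * euler_coeff q m"
  unfolding euler_coeff_def theta_coeff_def tri_add
  using inv_qpoch_pred[of "m + 1"] q0 by (simp add: power_int_add mult_ac)

lemma euler_coeff_Suc:
  "euler_coeff q (int (Suc m)) * (1 - q ^ Suc m) = - (q ^ m) * euler_coeff q (int m)"
  using euler_coeff_rec[of "int m"] power_int_of_nat[of q "Suc m"]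
  by (simp add: add.commute del: power_Suc)

text \<open>By \<open>euler_coeff_Suc\<close> the ratio of consecutive terms is
  \<open>- q^m x / (1 - q^(m+1))\<close>, which tends to 0; the series converges for every
  \<open>x\<close>.\<close>

lemma summable_euler: "summable (\<lambda>m. norm (euler_coeff q (int m) * x ^ m))"
proof -
  have "(\<lambda>m. norm q ^ m * (norm x / (1 - norm q))) \<longlonglongrightarrow> 0 * (norm x / (1
      - norm q))"
    using q1 by (intro tendsto_intros LIMSEQ_power_zero) auto
  then have "eventually (\<lambda>m. norm q ^ m * (norm x / (1 - norm q)) < 1 / 2) sequentially"
    by (rule order_tendstoD(2)) simp
  then obtain N where N: "\<And>m. m \<ge> N \<Longrightarrow> norm q ^ m * (norm x / (1 - norm q)) < 1 / 2"
    by (auto simp: eventually_sequentially)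
  show ?thesis
  proof (rule summable_ratio_test[of "1 / 2" N])
    fix m assume m: "N \<le> m"
    let ?e = "\<lambda>m. euler_coeff q (int m)"
    have "1 - norm q \<le> norm (1 - q ^ Suc m)"
    proof -
      have "norm (q ^ Suc m) \<le> norm q * 1"
        unfolding power_Suc norm_mult norm_power using q1 by (intro mult_left_mono power_le_one) auto
      then show ?thesis
        using norm_triangle_ineq2[of 1 "q ^ Suc m"] by simp
    qed
    then have "norm (?e (Suc m)) * (1 - norm q) \<le> norm (?e (Suc m) * (1 - q ^ Suc m))"
      unfolding norm_mult by (intro mult_left_mono) auto
    also have "?e (Suc m) * (1 - q ^ Suc m) = - (q ^ m) * ?e m"
      by (rule euler_coeff_Suc)
    finally have e: "norm (?e (Suc m)) \<le> norm q ^ m / (1 - norm q) * norm (?e m)"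
      using q1 by (simp add: norm_mult norm_power field_simps)
    have "norm (?e (Suc m) * x ^ Suc m) = norm (?e (Suc m)) * (norm x * norm (x ^ m))"
      by (simp add: norm_mult)
    also have "\<dots> \<le> (norm q ^ m / (1 - norm q) * norm (?e m)) * (norm x * norm (x ^ m))"
      by (intro mult_right_mono e) auto
    also have "\<dots> = (norm q ^ m * (norm x / (1 - norm q))) * norm (?e m * x ^ m)"
      by (simp add: norm_mult)
    also have "\<dots> \<le> 1 / 2 * norm (?e m * x ^ m)"
      using N[OF m] by (intro mult_right_mono) auto
    finally show "norm (norm (?e (Suc m) * x ^ Suc m)) \<le> 1 / 2 * norm (norm (?e m * x ^ m))"
      by simp
  qed simp
qed

text \<open>The series satisfies \<open>F x = (1 - x) * F (q * x)\<close>. Iterating produces the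
  finite products, and the remaining factor tends to \<open>F 0 = 1\<close> by continuity.\<close>

lemma euler_sum: "(\<Sum>m. euler_coeff q (int m) * x ^ m) = qpoch_inf x q"
proof -
  let ?e = "\<lambda>m. euler_coeff q (int m)"
  define F where "F x = (\<Sum>m. ?e m * x ^ m)" for x
  have sm: "summable (\<lambda>m. ?e m * x ^ m)" for x
    using summable_euler by (rule summable_norm_cancel)
  have F_rec: "F x = (1 - x) * F (q * x)" for x
  proof -
    have "F x - F (q * x) = (\<Sum>m. ?e m * x ^ m - ?e m * (q * x) ^ m)"
      unfolding F_def by (rule suminf_diff[OF sm sm])
    also have "\<dots> = (\<Sum>m. ?e (Suc m) * x ^ Suc m - ?e (Suc m) * (q * x) ^ Suc m)"
      using suminf_split_head[OF summable_diff[OF sm[of x] sm[of "q * x"]]] by simp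
    also have "\<dots> = (\<Sum>m. - x * (?e m * (q * x) ^ m))"
    proof (rule suminf_cong)
      fix m
      have "?e (Suc m) * (1 - q ^ Suc m) * x ^ Suc m = - (q ^ m) * ?e m * x ^ Suc m"
        unfolding euler_coeff_Suc ..
      then show "?e (Suc m) * x ^ Suc m - ?e (Suc m) * (q * x) ^ Suc m = - x * (?e m * (q * x) ^ m)"
        by (simp add: algebra_simps power_mult_distrib)
    qed
    also have "\<dots> = - x * F (q * x)"
      unfolding F_def by (rule suminf_mult[OF sm])
    finally show ?thesis by (simp add: algebra_simps)
  qed
  have F_iter: "F x = qpoch x q n * F (q ^ n * x)" for n
  proof (induction n)
    case 0
    then show ?case by (simp add: qpoch_def)
  next
    case (Suc n)
    then show ?case
      using F_rec[of "q ^ n * x"] by (simp add: qpoch_def mult_ac)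
  qed
  have "(\<lambda>n. F (q ^ n * x)) \<longlonglongrightarrow> F 0"
  proof -
    have "isCont F 0"
      unfolding F_def using isCont_powser_converges_everywhere[of ?e 0] sm by (simp add: mult_ac)
    moreover have "(\<lambda>n. q ^ n * x) \<longlonglongrightarrow> 0"
      using q1 by (intro tendsto_mult_left_zero LIMSEQ_power_zero)
    ultimately show ?thesis
      by (rule isCont_tendsto_compose)
  qed
  moreover have "F 0 = 1"
    unfolding F_def by (simp add: powser_zero euler_coeff_def theta_coeff_def)
  ultimately have "(\<lambda>n. qpoch x q n * F (q ^ n * x)) \<longlonglongrightarrow> qpoch_inf x q * 1"
    by (intro tendsto_mult qpoch_LIMSEQ q1) simp
  then show ?thesis
    unfolding F_iter[symmetric] by (simp add: F_def LIMSEQ_const_iff)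
qed

lemma euler_has_laurent: "has_laurent (euler_coeff q) x (qpoch_inf x q)"
proof -
  have "((\<lambda>m. euler_coeff q (int m) * x ^ m) has_sum qpoch_inf x q) UNIV"
    using norm_summable_imp_has_sum[OF summable_euler] summable_sums[OF summable_norm_cancel[OF summable_euler]]
    by (simp add: euler_sum)
  also have "?this \<longleftrightarrow> ((\<lambda>k. euler_coeff q k * x powi k) has_sum qpoch_inf x q) {0..}"
    by (rule has_sum_reindex_bij_witness[of _ nat int]) auto
  also have "\<dots> \<longleftrightarrow> ((\<lambda>k. euler_coeff q k * x powi k)
      has_sum qpoch_inf x q) UNIV"
    by (rule has_sum_cong_neutral) (auto simp: euler_coeff_def inv_qpoch_neg)
  finally show ?thesis
    unfolding has_laurent_def .
qed

text \<open>The expansions of \<open>(x)_inf\<close> and \<open>(q/x)_inf\<close> are multiplied.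
  With \<open>k = m + n\<close> the exponent of \<open>q\<close> splits into
  \<open>tri n + m (m + n)\<close> and the sign into \<open>(-1)^n\<close>, so the theta coefficient
  leaves the convolution and a Cauchy sum remains.\<close>

lemma
  shows conv_euler: "conv (euler_coeff q) (\<lambda>k. euler_coeff q (- k) * q powi (- k)) n
      = theta_coeff q n * cauchy_sum q n"
    and cauchy_has_sum: "((\<lambda>m. q powi (m * (m + n)) * inv_qpoch q m * inv_qpoch q (m
        + n)) has_sum cauchy_sum q n) UNIV"
    and laurent_conv_euler: "x \<noteq> 0 \<Longrightarrow> has_laurent (conv (euler_coeff q) (\<lambda>k.
        euler_coeff q (- k) * q powi (- k))) x
          (qpoch_inf x q * qpoch_inf (q / x) q)"
proof -
  have laurent: "has_laurent (\<lambda>k. euler_coeff q (- k) * q powi (- k)) x (qpoch_inf (q / x) q)" for x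
    using has_laurent_inverse[OF has_laurent_scale, of "euler_coeff q" q x] euler_has_laurent[of "q / x"] by
        simp
  show "has_laurent (conv (euler_coeff q) (\<lambda>k. euler_coeff q (- k) * q powi (- k))) x
          (qpoch_inf x q * qpoch_inf (q / x) q)" if "x \<noteq> 0"
    by (rule has_laurent_mult[OF euler_has_laurent laurent that])
  have eq: "euler_coeff q (m + n) * (euler_coeff q m * q powi m)
      = theta_coeff q n * (q powi (m * (m + n)) * inv_qpoch q m * inv_qpoch q (m + n))" for m
  proof -
    have e: "tri m + tri n + m * n + (tri m + m) = tri n + m * (m + n)"
      using double_tri[of m] by (simp add: algebra_simps)
    have "q powi tri (m + n) * (q powi tri m * q powi m) = q powi tri n * q powi (m * (m + n))"
      using q0 unfolding tri_add power_int_add[symmetric, OF disjI1, OF q0] e by simp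
    moreover have "(-1 :: complex) powi (m + n) * (-1) powi m = (-1) powi n"
      by (simp add: power_int_add power_int_minus_one_mult_self')
    ultimately show ?thesis
      unfolding euler_coeff_def theta_coeff_def by (simp add: mult_ac)
  qed
  \<comment> \<open>Euler's series converge everywhere, so the point 1 serves to obtain convergence
    of the convolution.\<close>
  have "((\<lambda>k. euler_coeff q k * (euler_coeff q (- (n - k)) * q powi (- (n - k)))) has_sum
      conv (euler_coeff q) (\<lambda>k. euler_coeff q (- k) * q powi (- k)) n) UNIV"
    by (rule conv_has_sum[OF euler_has_laurent laurent, of 1]) simp
  also have "?this \<longleftrightarrow> ((\<lambda>m. euler_coeff q (m
      + n) * (euler_coeff q m * q powi m)) has_sum
      conv (euler_coeff q) (\<lambda>k. euler_coeff q (- k) * q powi (- k)) n) UNIV"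
    by (rule has_sum_reindex_bij_witness[of _ "\<lambda>m. m + n" "\<lambda>k. k - n"]) auto
  finally have s: "((\<lambda>m. theta_coeff q n * (q powi (m * (m + n)) * inv_qpoch q m * inv_qpoch q (m
      + n))) has_sum
      conv (euler_coeff q) (\<lambda>k. euler_coeff q (- k) * q powi (- k)) n) UNIV"
    unfolding eq .
  have t: "theta_coeff q n \<noteq> 0"
    using q0 by (simp add: theta_coeff_def)
  from has_sum_cmult_right[OF s, of "1 / theta_coeff q n"]
  show c: "((\<lambda>m. q powi (m * (m + n)) * inv_qpoch q m * inv_qpoch q (m + n))
      has_sum cauchy_sum q n) UNIV"
    unfolding cauchy_sum_def using t by (auto simp: field_simps intro!: has_sum_infsum has_sum_imp_summable)
  show "conv (euler_coeff q) (\<lambda>k. euler_coeff q (- k) * q powi (- k)) n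
      = theta_coeff q n * cauchy_sum q n"
    using has_sum_unique[OF s has_sum_cmult_right[OF c]] .
qed

end

section \<open>Dominated convergence and telescoping for sums over the integers\<close>

lemma summable_on_int_geometric:
  assumes "0 \<le> (c::real)" "c < 1"
  shows "(\<lambda>k::int. c ^ nat \<bar>k\<bar>) summable_on UNIV"
proof -
  have s: "(\<lambda>n::nat. c ^ n) summable_on UNIV"
    using assms by (intro summable_nonneg_imp_summable_on summable_geometric) auto
  have "(\<lambda>k::int. c ^ nat \<bar>k\<bar>) summable_on {0..}"
    using s by (rule iffD1[OF summable_on_reindex_bij_witness[of _ nat int], rotated -1]) auto
  moreover have "(\<lambda>k::int. c ^ nat \<bar>k\<bar>) summable_on {..0}"
    using s by (rule iffD1[OF summable_on_reindex_bij_witness[of _ "\<lambda>k. nat (- k)" "\<lambda>n.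
        - int n"], rotated -1]) auto
  moreover have "(UNIV :: int set) = {0..} \<union> {..0}" by auto
  ultimately show ?thesis
    by (metis summable_on_union)
qed

text \<open>A bijective enumeration of the integers turns the unordered sums into series, to which
  Tannery's theorem applies.\<close>

lemma tannery_int:
  fixes a :: "int \<Rightarrow> nat \<Rightarrow> complex"
  assumes lim: "\<And>k. (\<lambda>n. a k n) \<longlonglongrightarrow> b k"
    and bound: "\<And>k n. norm (a k n) \<le> M k"
    and M: "M summable_on UNIV"
  shows "(\<lambda>n. \<Sum>\<^sub>\<infinity>k. a k n) \<longlonglongrightarrow> (\<Sum>\<^sub>\<infinity>k. b
      k)"
proof -
  have bij: "bij_betw int_decode UNIV UNIV"
    by (rule bij_int_decode)
  have sm: "summable (\<lambda>i. M (int_decode i))"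
    using summable_on_reindex_bij_betw[OF bij, of M] M by (simp add: summable_on_imp_summable)
  have conv: "(\<Sum>\<^sub>\<infinity>k. f k) = (\<Sum>i. f (int_decode i))" if "\<And>k. norm (f k) \<le> M
      k" for f :: "int \<Rightarrow> complex"
  proof -
    have "(\<lambda>k. norm (f k)) summable_on UNIV"
      by (rule Infinite_Sum.abs_summable_on_comparison_test'[OF M]) (rule that)
    then have "(f has_sum (\<Sum>\<^sub>\<infinity>k. f k)) UNIV"
      by (simp add: abs_summable_summable)
    then have "((\<lambda>i. f (int_decode i)) has_sum (\<Sum>\<^sub>\<infinity>k. f k)) UNIV"
      using has_sum_reindex_bij_betw[OF bij] by blast
    then show ?thesis
      using has_sum_imp_sums sums_unique by blast
  qed
  have b: "norm (b k) \<le> M k" for k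
    by (rule Lim_bounded[OF tendsto_norm[OF lim]]) (use bound in auto)
  have "(\<lambda>n. \<Sum>i. a (int_decode i) n) \<longlonglongrightarrow> (\<Sum>i. b (int_decode i))"
    using tannerys_theorem[of "\<lambda>i. a (int_decode i)" "\<lambda>i. b (int_decode i)" sequentially
        "\<lambda>i. M (int_decode i)"]
      lim bound sm by (simp add: case_prod_unfold)
  then show ?thesis
    by (simp add: conv[OF bound] conv[OF b])
qed

lemma sum_int_telescope:
  fixes H :: "int \<Rightarrow> 'a::ab_group_add"
  assumes "a \<le> b + 1"
  shows "(\<Sum>r\<in>{a..b}. H r - H (r + 1)) = H a - H (b + 1)"
proof -
  have "a - 1 \<le> b" using assms by simp
  then show ?thesis
  proof (induction b rule: int_ge_induct)
    case base
    then show ?case by simp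
  next
    case (step b)
    have "{a..b + 1} = insert (b + 1) {a..b}" using step.hyps by auto
    then show ?case using step.IH by simp
  qed
qed

section \<open>Cauchy's identity and the triple product\<close>

context
  fixes q :: complex
  assumes q0: "q \<noteq> 0" and q1: "norm q < 1"
begin

text \<open>The relation holds termwise once the summand for \<open>n + 2\<close> is taken at
  \<open>m - 1\<close>. Since \<open>m\<close> runs over all integers, this shift leaves the sum
  unchanged.\<close>

lemma cauchy_sum_rec:
  "cauchy_sum q n - cauchy_sum q (n + 1) = q powi (n + 1) * (cauchy_sum q (n + 2) - cauchy_sum q (n + 1))"
proof -
  let ?t = "\<lambda>n m. q powi (m * (m + n)) * inv_qpoch q m * inv_qpoch q (m + n)"
  have t: "?t n m - ?t (n + 1) m = q powi (n + 1) * (?t (n + 2) (m - 1) - ?t (n + 1) m)" for m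
  proof -
    have 1: "inv_qpoch q (m + n) = (1 - q powi (m + n + 1)) * inv_qpoch q (m + n + 1)"
      using inv_qpoch_pred[OF q0 q1, of "m + n + 1"] by simp
    have 2: "inv_qpoch q (m - 1) = (1 - q powi m) * inv_qpoch q m"
      by (rule inv_qpoch_pred[OF q0 q1])
    have e1: "q powi (m * (m + n + 1)) = q powi (m * (m + n)) * q powi m"
      unfolding power_int_add[symmetric, OF disjI1, OF q0] by (rule arg_cong[where f
          = "power_int q"]) (simp add: algebra_simps)
    have e4: "q powi (m + n + 1) = q powi (n + 1) * q powi m"
      unfolding power_int_add[symmetric, OF disjI1, OF q0] by (rule arg_cong[where f = "power_int q"]) simp
    have e2: "q powi (n + 1) * q powi ((m - 1) * (m - 1 + (n + 2))) = q powi (m * (m + n))"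
      unfolding power_int_add[symmetric, OF disjI1, OF q0] by (rule arg_cong[where f
          = "power_int q"]) (simp add: algebra_simps)
    have e3: "m - 1 + (n + 2) = m + n + 1" "m + (n + 1) = m + n + 1" by simp_all
    have "q powi (n + 1) * (?t (n + 2) (m - 1) - ?t (n + 1) m)
      = (q powi (n + 1) * q powi ((m - 1) * (m - 1 + (n + 2)))) * inv_qpoch q (m - 1) * inv_qpoch q (m - 1
          + (n + 2))
        - q powi (n + 1) * ?t (n + 1) m"
      by (simp add: algebra_simps)
    also have "\<dots> = q powi (m * (m + n)) * ((1 - q powi m) * inv_qpoch q m) * inv_qpoch q (m + n + 1)
        - q powi (n + 1) * (q powi (m * (m + n)) * q powi m * inv_qpoch q m * inv_qpoch q (m + n + 1))"
      unfolding e2 unfolding e3 2 e1 ..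
    also have "\<dots> = ?t n m - ?t (n + 1) m"
      unfolding 1 e3 e1 e4 by (simp add: algebra_simps)
    finally show ?thesis ..
  qed
  have "((\<lambda>m. ?t (n + 2) (m - 1)) has_sum cauchy_sum q (n + 2)) UNIV"
    using cauchy_has_sum[OF q0 q1, of "n + 2"]
    by (rule iffD1[OF has_sum_reindex_bij_witness[of _ "\<lambda>m. m - 1" "\<lambda>m. m
        + 1"], rotated -1]) auto
  from has_sum_cmult_right[OF has_sum_diff[OF this cauchy_has_sum[OF q0 q1, of "n + 1"]], of "q powi (n + 1)"]
  have "((\<lambda>m. ?t n m - ?t (n + 1) m) has_sum q powi (n + 1) * (cauchy_sum q (n
      + 2) - cauchy_sum q (n + 1))) UNIV"
    unfolding t .
  from has_sum_unique[OF has_sum_diff[OF cauchy_has_sum[OF q0 q1] cauchy_has_sum[OF q0 q1]] this]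
  show ?thesis .
qed

text \<open>For \<open>m > 0\<close> the factor \<open>q powi (m * (m + n))\<close> kills the term
  as \<open>n\<close> grows, and for \<open>m < 0\<close> it is 0 anyway; only \<open>m = 0\<close>
  survives.\<close>

lemma cauchy_sum_LIMSEQ: "(\<lambda>n. cauchy_sum q (int n)) \<longlonglongrightarrow> 1 / qpoch_inf q q"
proof -
  obtain B where B: "B > 0" "\<And>k. norm (inv_qpoch q k) \<le> B"
    using inv_qpoch_bounded[OF q0 q1] by blast
  \<comment> \<open>The free exponent \<open>j\<close> is used twice: as \<open>n\<close> for the
    decay of a single term, and as \<open>nat \<bar>k\<bar>\<close> for the majorant.\<close>
  have bound: "norm (q powi (k * (k + int n)) * inv_qpoch q k * inv_qpoch q (k + int n))
      \<le> B * B * norm q ^ j"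
    if "k \<ge> 0" "j \<le> nat k * (nat k + n)" for k n j
  proof -
    have "nat (k * (k + int n)) = nat k * (nat k + n)"
      using that by (simp add: nat_mult_distrib nat_add_distrib)
    then have "q powi (k * (k + int n)) = q ^ (nat k * (nat k + n))"
      using that by (simp add: power_int_def)
    then have "norm (q powi (k * (k + int n))) \<le> norm q ^ j"
      using q1 that(2) by (simp add: norm_power power_decreasing)
    then have "norm (q powi (k * (k + int n))) * norm (inv_qpoch q k) * norm (inv_qpoch q (k
        + int n)) \<le> norm q ^ j * B * B"
      using B by (intro mult_mono) auto
    then show ?thesis by (simp add: norm_mult mult_ac)
  qed
  have "(\<lambda>n. \<Sum>\<^sub>\<infinity>k. q powi (k * (k + int n)) * inv_qpoch q k * inv_qpoch q (k
      + int n))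
      \<longlonglongrightarrow> (\<Sum>\<^sub>\<infinity>k::int. if k = 0 then 1 / qpoch_inf q q else 0)"
  proof (rule tannery_int[where a = "\<lambda>k n. q powi (k * (k
      + int n)) * inv_qpoch q k * inv_qpoch q (k + int n)"
        and M = "\<lambda>k. B * B * norm q ^ nat \<bar>k\<bar>"])
    fix k :: int
    show "(\<lambda>n. q powi (k * (k + int n)) * inv_qpoch q k * inv_qpoch q (k
        + int n)) \<longlonglongrightarrow> (if k = 0 then 1 / qpoch_inf q q else 0)"
    proof (cases k "0::int" rule: linorder_cases)
      case less
      then show ?thesis by (simp add: inv_qpoch_neg)
    next
      case equal
      then show ?thesis using inv_qpoch_LIMSEQ[OF q0 q1] by (simp add: inv_qpoch_0)
    next
      case greater
      have le: "n \<le> nat k * (nat k + n)" for n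
        using greater by (cases "nat k") auto
      have "(\<lambda>n. B * B * norm q ^ n) \<longlonglongrightarrow> 0"
        using q1 by (intro tendsto_mult_right_zero LIMSEQ_power_zero) auto
      then have "(\<lambda>n. q powi (k * (k + int n)) * inv_qpoch q k * inv_qpoch q (k
          + int n)) \<longlonglongrightarrow> 0"
        by (rule Lim_null_comparison[rotated]) (use greater le in \<open>auto intro!: always_eventually
            bound\<close>)
      then show ?thesis using greater by simp
    qed
  next
    fix k :: int and n
    show "norm (q powi (k * (k + int n)) * inv_qpoch q k * inv_qpoch q (k + int n))
        \<le> B * B * norm q ^ nat \<bar>k\<bar>"
    proof (cases "k < 0")
      case True
      then show ?thesis using B(1) by (simp add: inv_qpoch_neg)
    next
      case False
      have "nat \<bar>k\<bar> \<le> nat k * (nat k + n)"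
        using False by (cases "nat k") auto
      with False show ?thesis by (intro bound) auto
    qed
  next
    show "(\<lambda>k. B * B * norm q ^ nat \<bar>k\<bar>) summable_on UNIV"
      using q1 by (intro summable_on_cmult_right summable_on_int_geometric) auto
  qed
  moreover have "(\<Sum>\<^sub>\<infinity>k::int. if k = 0 then 1 / qpoch_inf q q else 0) = 1 / qpoch_inf q q"
  proof (rule infsumI)
    show "((\<lambda>k::int. if k = 0 then 1 / qpoch_inf q q else 0) has_sum 1 / qpoch_inf q q) UNIV"
      by (rule has_sum_finite_neutralI[of "{0}"]) auto
  qed
  ultimately show ?thesis
    unfolding cauchy_sum_def by (simp only:)
qed

text \<open>By the recurrence, the consecutive differences do not decrease in absolute value, but they tend to
    \<open>0\<close>.\<close>

lemma cauchy_sum_eq: "cauchy_sum q n = 1 / qpoch_inf q q"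
proof -
  define d where "d n = cauchy_sum q n - cauchy_sum q (n + 1)" for n
  have d_rec: "d n = - (q powi (n + 1)) * d (n + 1)" for n
    using cauchy_sum_rec[of n] unfolding d_def by (simp add: algebra_simps)
  have d_nat: "d (int n) = 0" for n
  proof -
    have mono: "norm (d (int n)) \<le> norm (d (int (n + k)))" for k
    proof (induction k)
      case (Suc k)
      have "norm (d (int (n + k))) = norm (q ^ (n + k + 1)) * norm (d (int (n + Suc k)))"
        using arg_cong[OF d_rec[of "int (n + k)"], of norm] power_int_of_nat[of q "n + k + 1"]
        by (simp add: norm_mult algebra_simps)
      also have "\<dots> \<le> 1 * norm (d (int (n + Suc k)))"
        using q1 unfolding norm_power by (intro mult_right_mono power_le_one) auto
      finally show ?case using Suc by simp
    qed simp
    have "(\<lambda>m. d (int m)) \<longlonglongrightarrow> 1 / qpoch_inf q q - 1 / qpoch_inf q q"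
      unfolding d_def using LIMSEQ_Suc[OF cauchy_sum_LIMSEQ]
      by (intro tendsto_diff cauchy_sum_LIMSEQ) (simp add: add.commute)
    then have "(\<lambda>m. norm (d (int m))) \<longlonglongrightarrow> 0"
      by (simp add: tendsto_norm_zero)
    then have "(\<lambda>k. norm (d (int (n + k)))) \<longlonglongrightarrow> 0"
      using LIMSEQ_ignore_initial_segment[of "\<lambda>m. norm (d (int m))" 0 n] by (simp add: add.commute)
    then have "norm (d (int n)) \<le> 0"
      by (rule LIMSEQ_le_const) (use mono in auto)
    then show ?thesis by simp
  qed
  \<comment> \<open>For negative \<open>n\<close> the same recurrence carries the zero downwards
    from 0.\<close>
  have d0: "d n = 0" for n
  proof (cases "n \<ge> 0")
    case True
    then show ?thesis using d_nat[of "nat n"] by simp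
  next
    case False
    then have "n \<le> 0" by simp
    then show ?thesis
    proof (induction n rule: int_le_induct)
      case base
      then show ?case using d_nat[of 0] by simp
    next
      case (step i)
      then show ?case using d_rec[of "i - 1"] by simp
    qed
  qed
  have const: "cauchy_sum q n = cauchy_sum q 0" for n
  proof (induction n rule: int_induct[of _ 0])
    case (step1 i)
    then show ?case using d0[of i] by (simp add: d_def)
  next
    case (step2 i)
    then show ?case using d0[of "i - 1"] by (simp add: d_def)
  qed simp
  have "(\<lambda>n. cauchy_sum q (int n)) = (\<lambda>_. cauchy_sum q 0)"
    by (rule ext) (rule const)
  then have "cauchy_sum q 0 = 1 / qpoch_inf q q"
    using cauchy_sum_LIMSEQ LIMSEQ_const_iff by metis
  then show ?thesis
    using const[of n] by simp
qed

text \<open>As the Cauchy sums do not depend on \<open>n\<close>, the product of the two Euler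
  expansions is the theta series divided by \<open>(q)_inf\<close>.\<close>

theorem jacobi_triple_product:
  assumes "x \<noteq> 0"
  shows "has_laurent (theta_coeff q) x (theta_j x q)"
proof -
  have "conv (euler_coeff q) (\<lambda>k. euler_coeff q (- k) * q powi (- k))
      = (\<lambda>n. 1 / qpoch_inf q q * theta_coeff q n)"
    by (rule ext) (simp add: conv_euler[OF q0 q1] cauchy_sum_eq)
  then have "has_laurent (\<lambda>n. 1 / qpoch_inf q q * theta_coeff q n) x (qpoch_inf x q
      * qpoch_inf (q / x) q)"
    using laurent_conv_euler[OF q0 q1 assms] by simp
  from has_laurent_cmult[OF this, of "qpoch_inf q q"] show ?thesis
    using qpoch_inf_nonzero'[OF q1 q1] by (simp add: theta_j_def mult_ac)
qed

end

subsection \<open>The Appell sum of the mock theta function\<close>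

text \<open>The \<open>alpha\<close> side of a Bailey pair relative to 1, spread evenly over
  \<open>r\<close> and \<open>-r\<close>. It equals
  \<open>(-1)^r q^(r(r+1)/2) * 2/(1 + q^r)\<close>, and 1 at \<open>r = 0\<close>.\<close>

definition watson_coeff :: "complex \<Rightarrow> int \<Rightarrow> complex" where
  "watson_coeff q r = theta_coeff q r * q powi r * 2 / (1 + q powi r)"

context
  fixes q :: complex
  assumes q0: "q \<noteq> 0" and q1: "norm q < 1"
begin

lemma one_plus_powi_nonzero: "1 + q powi k \<noteq> 0"
  using powi_ne_minus_1[OF q0 q1, of k] by (metis add_eq_0_iff)

lemma theta_coeff_Suc: "theta_coeff q (r + 1) = - (q powi r) * theta_coeff q r"
  unfolding theta_coeff_def tri_add using q0 by (simp add: power_int_add)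

lemma norm_one_plus_power_ge: "1 - norm q \<le> norm (1 + q ^ n)"
proof (cases n)
  case 0
  have "-1 \<le> norm q"
    by (rule order_trans[of _ 0]) auto
  then show ?thesis using 0 by simp
next
  case (Suc m)
  have "norm (q ^ Suc m) \<le> norm q * 1"
    unfolding power_Suc norm_mult norm_power using q1 by (intro mult_left_mono power_le_one) auto
  then show ?thesis
    using norm_diff_ineq[of 1 "q ^ Suc m"] Suc by simp
qed

lemma theta_coeff_uminus: "theta_coeff q (- r) = theta_coeff q r * q powi r"
proof -
  have "(-1 :: complex) powi (- r) = (-1) powi r"
    by (simp add: power_int_minus_left)
  then show ?thesis
    unfolding theta_coeff_def tri_uminus using q0 by (simp add: power_int_add)
qed

lemma watson_coeff_uminus: "watson_coeff q (- r) = watson_coeff q r"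
proof -
  have "q powi (- r) / (1 + q powi (- r)) = 1 / (1 + q powi r)"
    using q0 one_plus_powi_nonzero[of r] one_plus_powi_nonzero[of "- r"]
    by (simp add: power_int_minus field_simps)
  then show ?thesis
    unfolding watson_coeff_def theta_coeff_uminus by (metis (no_types, lifting) mult.assoc mult.commute mult_1
        times_divide_eq_left times_divide_eq_right)
qed

text \<open>For \<open>r >= 0\<close> the theta coefficient has norm at most 1. For negative
  \<open>r\<close> the factor \<open>q powi r\<close> grows, and evenness transfers the
  bound.\<close>

lemma watson_coeff_bound: "norm (watson_coeff q r) \<le> 2 / (1 - norm q) * norm q ^ nat \<bar>r\<bar>"
proof -
  have *: "norm (watson_coeff q (int n)) \<le> 2 / (1 - norm q) * norm q ^ n" for n
  proof -
    note norm_one_plus_power_ge[of n]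
    moreover have "norm (theta_coeff q (int n)) \<le> 1"
    proof -
      have "q powi tri (int n) = q ^ nat (tri (int n))"
        using tri_nonneg[of "int n"] by (simp add: power_int_def)
      then show ?thesis
        unfolding theta_coeff_def using q1 by (simp add: norm_mult norm_power power_le_one)
    qed
    ultimately have "norm (theta_coeff q (int n)) * norm q ^ n * 2 / norm (1 + q ^ n)
        \<le> 1 * norm q ^ n * 2 / (1 - norm q)"
      using q1 by (intro frac_le mult_right_mono) auto
    then show ?thesis
      by (simp add: watson_coeff_def norm_mult norm_divide norm_power mult_ac)
  qed
  show ?thesis
    using *[of "nat r"] *[of "nat (- r)"] watson_coeff_uminus[of r] by (cases "r \<ge> 0") auto
qed

text \<open>Induction on \<open>n\<close>: up to the factor \<open>2 q\<^sup>n / (1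
    - q\<^sup>n)\<close>, the summand for \<open>n\<close> times \<open>(1
    + q\<^sup>n)\<^sup>2\<close> differs from the
  summand for \<open>n - 1\<close> by \<open>H r - H (r
      + 1)\<close>, where \<open>H\<close> vanishes at both ends of the range.\<close>

lemma watson_finite:
  "(\<Sum>r\<in>{- int n..int n}. watson_coeff q r * inv_qpoch q (int n - r) * inv_qpoch q (int n + r))
    = 1 / (qpoch (- q) q n)\<^sup>2"
proof (induction n)
  case 0
  then show ?case by (simp add: watson_coeff_def theta_coeff_def qpoch_def)
next
  case (Suc n)
  define N where "N = int (Suc n)"
  define f where "f m r = watson_coeff q r * inv_qpoch q (m - r) * inv_qpoch q (m + r)" for m r
  define H where "H r = theta_coeff q r * inv_qpoch q (N - r) * inv_qpoch q (N + r - 1)" for r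
  let ?t = "q powi N"
  have pw: "q powi (N - r) = ?t / q powi r" "q powi (N + r) = ?t * q powi r" for r
    using q0 by (simp_all add: power_int_add power_int_diff)
  have r0: "q powi r \<noteq> 0" for r using q0 by simp
  have H_diff: "H r - H (r + 1) = theta_coeff q r * inv_qpoch q (N - r) * inv_qpoch q (N + r) * ((1
      + q powi r) * (1 - ?t))" for r
  proof -
    have 1: "inv_qpoch q (N + r - 1) = (1 - ?t * q powi r) * inv_qpoch q (N + r)"
      using inv_qpoch_pred[OF q0 q1, of "N + r"] by (simp add: pw)
    have 2: "inv_qpoch q (N - (r + 1)) = (1 - ?t / q powi r) * inv_qpoch q (N - r)"
      using inv_qpoch_pred[OF q0 q1, of "N - r"] by (simp add: pw algebra_simps)
    have 3: "N + (r + 1) - 1 = N + r" by simp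
    have "c * b * ((1 - t * x) * a) - - x * c * ((1 - t / x) * b) * a = c * b * a * ((1 + x) * (1 - t))"
      if "x \<noteq> 0" for a b c t x :: complex
      using that by (simp add: field_simps)
    from this[OF r0] show ?thesis
      unfolding H_def 1 2 3 theta_coeff_Suc .
  qed
  have alg: "c * x * 2 / (1 + x) * a * b * (t * (1 + x)\<^sup>2 / x) = 2 * t * (c * a * b * (1 + x))"
    if "x \<noteq> 0" "1 + x \<noteq> 0" for a b c t x :: complex
    using that by (simp add: divide_simps power2_eq_square)
  have f_diff: "(1 - ?t) * ((1 + ?t)\<^sup>2 * f N r - f (N - 1) r) = 2 * ?t * (H r - H (r + 1))" for r
  proof -
    have 1: "inv_qpoch q (N - 1 + r) = (1 - ?t * q powi r) * inv_qpoch q (N + r)"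
      using inv_qpoch_pred[OF q0 q1, of "N + r"] by (simp add: pw algebra_simps)
    have 2: "inv_qpoch q (N - 1 - r) = (1 - ?t / q powi r) * inv_qpoch q (N - r)"
      using inv_qpoch_pred[OF q0 q1, of "N - r"] by (simp add: pw algebra_simps)
    have "(1 + ?t)\<^sup>2 * f N r - f (N - 1) r
      = watson_coeff q r * inv_qpoch q (N - r) * inv_qpoch q (N + r) * ((1
          + ?t)\<^sup>2 - (1 - ?t / q powi r) * (1 - ?t * q powi r))"
      unfolding f_def 1 2 by (simp add: algebra_simps)
    \<comment> \<open>The square \<open>(1 + q powi r)^2\<close> cancels the denominator of the
      Watson coefficient. This is why the factor attached to \<open>n\<close> is
      \<open>(1 + q^n)^2\<close>, that is, why \<open>(-q; q)_n\<close> occurs squared.\<close>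
    also have "(1 + ?t)\<^sup>2 - (1 - ?t / q powi r) * (1 - ?t * q powi r)
        = ?t * (1 + q powi r)\<^sup>2 / q powi r"
      using r0[of r] by (simp add: field_simps power2_eq_square)
    also have "watson_coeff q r * inv_qpoch q (N - r) * inv_qpoch q (N + r) * (?t * (1
        + q powi r)\<^sup>2 / q powi r)
      = 2 * ?t * (theta_coeff q r * inv_qpoch q (N - r) * inv_qpoch q (N + r) * (1 + q powi r))"
      unfolding watson_coeff_def by (rule alg[OF r0 one_plus_powi_nonzero])
    finally show ?thesis
      unfolding H_diff by (simp add: algebra_simps)
  qed
  have "(\<Sum>r\<in>{- N..N}. H r - H (r + 1)) = H (- N) - H (N + 1)"
    by (rule sum_int_telescope) (simp add: N_def)
  \<comment> \<open>At \<open>- N\<close> the last factor of \<open>H\<close> has index -1, at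
    \<open>N + 1\<close> the middle one has.\<close>
  also have "\<dots> = 0"
    by (simp add: H_def inv_qpoch_neg)
  finally have H_sum: "(\<Sum>r\<in>{- N..N}. H r - H (r + 1)) = 0" .
  have "(1 - ?t) * (\<Sum>r\<in>{- N..N}. (1 + ?t)\<^sup>2 * f N r - f (N - 1) r)
      = (\<Sum>r\<in>{- N..N}. 2 * ?t * (H r - H (r + 1)))"
    unfolding sum_distrib_left f_diff ..
  also have "\<dots> = 2 * ?t * (\<Sum>r\<in>{- N..N}. H r - H (r + 1))"
    by (rule sum_distrib_left[symmetric])
  finally have "(1 - ?t) * (\<Sum>r\<in>{- N..N}. (1 + ?t)\<^sup>2 * f N r - f (N - 1) r) = 0"
    unfolding H_sum by simp
  moreover have "?t \<noteq> 1"
    unfolding N_def power_int_of_nat using power_ne_1[OF q0 q1, of "Suc n"] by blast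
  ultimately have "(1 + ?t)\<^sup>2 * (\<Sum>r\<in>{- N..N}. f N r) = (\<Sum>r\<in>{- N..N}. f (N - 1) r)"
    by (simp add: sum_subtractf sum_distrib_left)
  also have "\<dots> = (\<Sum>r\<in>{- int n..int n}. f (int n) r)"
  proof (rule sum.mono_neutral_cong_right)
    show "\<forall>r\<in>{- N..N} - {- int n..int n}. f (N - 1) r = 0"
    proof
      fix r assume "r \<in> {- N..N} - {- int n..int n}"
      then have "N - 1 - r < 0 \<or> N - 1 + r < 0"
        by (auto simp: N_def)
      then show "f (N - 1) r = 0"
        by (auto simp: f_def inv_qpoch_neg)
    qed
  qed (auto simp: N_def)
  also have "\<dots> = 1 / (qpoch (- q) q n)\<^sup>2"
    unfolding f_def by (rule Suc.IH)
  finally have "(\<Sum>r\<in>{- N..N}. f N r) = 1 / (qpoch (- q) q n)\<^sup>2 / (1 + ?t)\<^sup>2"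
    using one_plus_powi_nonzero[of N] by (subst eq_divide_eq) (simp add: mult.commute)
  moreover have "qpoch (- q) q (Suc n) = qpoch (- q) q n * (1 + ?t)"
    unfolding N_def power_int_of_nat by (simp add: qpoch_def mult.commute)
  ultimately show ?case
    unfolding f_def N_def by (simp add: power_mult_distrib)
qed

lemma watson_finite_has_sum:
  "((\<lambda>r. watson_coeff q r * inv_qpoch q (int n - r) * inv_qpoch q (int n + r))
      has_sum 1 / (qpoch (- q) q n)\<^sup>2) UNIV"
proof -
  have "((\<lambda>r. watson_coeff q r * inv_qpoch q (int n - r) * inv_qpoch q (int n + r)) has_sum
      (\<Sum>r\<in>{- int n..int n}. watson_coeff q r * inv_qpoch q (int n - r) * inv_qpoch q (int n
          + r))) UNIV"
  proof (rule has_sum_finite_neutralI)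
    show "watson_coeff q r * inv_qpoch q (int n - r) * inv_qpoch q (int n + r) = 0"
      if "r \<in> UNIV - {- int n..int n}" for r
    proof -
      have "int n - r < 0 \<or> int n + r < 0" using that by auto
      then show ?thesis by (auto simp: inv_qpoch_neg)
    qed
  qed auto
  then show ?thesis unfolding watson_finite .
qed

text \<open>The limiting case of Bailey's lemma: the finite identity is summed against
  \<open>q^(n^2)\<close> and the sums are exchanged. For fixed \<open>r\<close>, putting
  \<open>n = m + r\<close> leaves \<open>q^(r^2)\<close> times the Cauchy sum at
  \<open>2 * r\<close>, which is \<open>1/(q)_inf\<close>.\<close>

lemma watson_has_sum:
  "((\<lambda>r. watson_coeff q r * q powi (r\<^sup>2)) has_sum mock_f3 q * qpoch_inf q q) UNIV"
proof -
  obtain B where B: "B > 0" "\<And>k. norm (inv_qpoch q k) \<le> B"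
    using inv_qpoch_bounded[OF q0 q1] by blast
  define h where "h = (\<lambda>(n, r). q powi (n\<^sup>2) * (watson_coeff q r * inv_qpoch q (n
      - r) * inv_qpoch q (n + r)))"
  \<comment> \<open>A product of geometric series in \<open>\<bar>n\<bar>\<close> and
    \<open>\<bar>r\<bar>\<close> is a majorant, as \<open>inv_qpoch\<close> is bounded. This permits
    the exchange of the sums.\<close>
  have sm: "h summable_on UNIV \<times> UNIV"
  proof -
    let ?C = "2 / (1 - norm q)"
    have geo: "(\<lambda>k::int. norm q ^ nat \<bar>k\<bar>) summable_on UNIV"
      using q1 by (intro summable_on_int_geometric) auto
    have "(\<lambda>(n, r). norm q ^ nat \<bar>n\<bar> * (?C * B * B
        * norm q ^ nat \<bar>r\<bar>)) summable_on (UNIV :: int set) \<times> (UNIV :: int set)"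
    proof (rule summable_on_SigmaI)
      show "((\<lambda>r. case (n, r) of (n, r) \<Rightarrow> norm q ^ nat \<bar>n\<bar> * (?C * B * B
          * norm q ^ nat \<bar>r\<bar>)) has_sum
          norm q ^ nat \<bar>n\<bar> * (?C * B * B * (\<Sum>\<^sub>\<infinity>r::int. norm q ^ nat
              \<bar>r\<bar>))) UNIV" for n :: int
        unfolding prod.case by (intro has_sum_cmult_right has_sum_infsum geo)
      show "(\<lambda>n::int. norm q ^ nat \<bar>n\<bar> * (?C * B * B
          * (\<Sum>\<^sub>\<infinity>r::int. norm q ^ nat \<bar>r\<bar>))) summable_on UNIV"
        using geo by (rule summable_on_cmult_left)
    qed (use B q1 in auto)
    then have "(\<lambda>x. norm (h x)) summable_on UNIV \<times> UNIV"
    proof (rule Infinite_Sum.abs_summable_on_comparison_test')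
      fix x :: "int \<times> int"
      obtain n r where x: "x = (n, r)" by force
      have "norm (q powi (n\<^sup>2)) \<le> norm q ^ nat \<bar>n\<bar>"
      proof -
        have "nat (n\<^sup>2) = nat \<bar>n\<bar> * nat \<bar>n\<bar>"
          by (simp add: nat_mult_distrib[symmetric] power2_eq_square)
        then have "nat \<bar>n\<bar> \<le> nat (n\<^sup>2)"
          by (cases "nat \<bar>n\<bar>") auto
        moreover have "q powi (n\<^sup>2) = q ^ nat (n\<^sup>2)"
          by (simp add: power_int_def)
        ultimately show ?thesis
          using q1 by (simp add: norm_power power_decreasing)
      qed
      then have "norm (q powi (n\<^sup>2)) * (norm (watson_coeff q r) * norm (inv_qpoch q (n
          - r)) * norm (inv_qpoch q (n + r)))
          \<le> norm q ^ nat \<bar>n\<bar> * ((?C * norm q ^ nat \<bar>r\<bar>) * B * B)"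
        using B q1 by (intro mult_mono watson_coeff_bound) auto
      then show "norm (h x) \<le> (case x of (n, r) \<Rightarrow> norm q ^ nat \<bar>n\<bar> * (?C * B * B
          * norm q ^ nat \<bar>r\<bar>))"
        unfolding x h_def by (simp add: norm_mult mult_ac)
    qed
    then show ?thesis by (rule abs_summable_summable)
  qed
  then obtain S where S: "(h has_sum S) (UNIV \<times> UNIV)"
    by (auto simp: summable_on_def)
  have "((\<lambda>n. if n < 0 then 0 else q powi (n\<^sup>2)
      * (1 / (qpoch (- q) q (nat n))\<^sup>2)) has_sum S) UNIV"
  proof (rule has_sum_SigmaD[OF S])
    fix n :: int
    show "((\<lambda>r. h (n, r)) has_sum (if n < 0 then 0 else q powi (n\<^sup>2)
        * (1 / (qpoch (- q) q (nat n))\<^sup>2))) UNIV"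
    proof (cases "n < 0")
      case True
      have "h (n, r) = 0" for r
      proof -
        have "n - r < 0 \<or> n + r < 0" using True by auto
        then show ?thesis by (auto simp: h_def inv_qpoch_neg)
      qed
      then show ?thesis using True by simp
    next
      case False
      then show ?thesis
        using has_sum_cmult_right[OF watson_finite_has_sum[of "nat n"], of "q powi (n\<^sup>2)"]
            by (simp add: h_def)
    qed
  qed
  also have "?this \<longleftrightarrow> ((\<lambda>n. q powi (n\<^sup>2)
      * (1 / (qpoch (- q) q (nat n))\<^sup>2)) has_sum S) {0..}"
    by (rule has_sum_cong_neutral) auto
  also have "\<dots> \<longleftrightarrow> ((\<lambda>n. q ^ (n\<^sup>2) / (qpoch (- q) q n)\<^sup>2) has_sum
      S) UNIV"
    by (rule has_sum_reindex_bij_witness[of _ int nat])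
       (auto simp: power_int_def nat_power_eq)
  finally have "S = mock_f3 q"
    unfolding mock_f3_def using has_sum_imp_sums sums_unique by blast
  have "((\<lambda>(r, n). h (n, r)) has_sum S) (UNIV \<times> UNIV)"
    using S has_sum_swap by blast
  then have "((\<lambda>r. watson_coeff q r * q powi (r\<^sup>2) * (1 / qpoch_inf q q)) has_sum S) UNIV"
  proof (rule has_sum_SigmaD)
    fix r :: int
    let ?t = "\<lambda>m. q powi (m * (m + 2 * r)) * inv_qpoch q m * inv_qpoch q (m + 2 * r)"
    have "(?t has_sum 1 / qpoch_inf q q) UNIV"
      using cauchy_has_sum[OF q0 q1, of "2 * r"] unfolding cauchy_sum_eq[OF q0 q1] .
    then have "((\<lambda>m. watson_coeff q r * q powi (r\<^sup>2) * ?t m)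
        has_sum watson_coeff q r * q powi (r\<^sup>2) * (1 / qpoch_inf q q)) UNIV"
      by (rule has_sum_cmult_right)
    also have "?this \<longleftrightarrow> ((\<lambda>n. case (r, n) of (r, n) \<Rightarrow> h (n, r)) has_sum
        watson_coeff q r * q powi (r\<^sup>2) * (1 / qpoch_inf q q)) UNIV"
    proof (rule has_sum_reindex_bij_witness[of _ "\<lambda>n. n - r" "\<lambda>m. m + r"])
      fix m
      have "q powi (r\<^sup>2) * q powi (m * (m + 2 * r)) = q powi ((m + r)\<^sup>2)"
        using q0 unfolding power_int_add[symmetric, OF disjI1, OF q0]
            by (simp add: power2_eq_square algebra_simps)
      then show "(case (r, m + r) of (r, n) \<Rightarrow> h (n, r))
          = watson_coeff q r * q powi (r\<^sup>2) * ?t m"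
        unfolding h_def by (simp add: algebra_simps)
    qed auto
    finally show "((\<lambda>n. case (r, n) of (r, n) \<Rightarrow> h (n, r))
        has_sum watson_coeff q r * q powi (r\<^sup>2) * (1 / qpoch_inf q q)) UNIV" .
  qed
  from has_sum_cmult_left[OF this, of "qpoch_inf q q"] show ?thesis
    using qpoch_inf_nonzero'[OF q1 q1] \<open>S = mock_f3 q\<close> by simp
qed

text \<open>In the finite identity let \<open>n\<close> tend to infinity: both factors
  \<open>inv_qpoch\<close> tend to \<open>1/(q)_inf\<close>, and Tannery's theorem applies. The
  value becomes the normalising constant of the quotient of theta functions.\<close>

lemma watson_coeff_has_sum: "(watson_coeff q has_sum (qpoch_inf q q / qpoch_inf (- q) q)\<^sup>2) UNIV"
proof -
  obtain B where B: "B > 0" "\<And>k. norm (inv_qpoch q k) \<le> B"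
    using inv_qpoch_bounded[OF q0 q1] by blast
  let ?L = "1 / qpoch_inf q q"
  have geo: "(\<lambda>k::int. norm q ^ nat \<bar>k\<bar>) summable_on UNIV"
    using q1 by (intro summable_on_int_geometric) auto
  have lim: "(\<lambda>n. inv_qpoch q (int n + r)) \<longlonglongrightarrow> ?L" for r
  proof -
    have "filterlim (\<lambda>n. nat (int n + r)) at_top sequentially"
      unfolding filterlim_at_top
    proof
      fix Z show "eventually (\<lambda>n. Z \<le> nat (int n + r)) sequentially"
        using eventually_ge_at_top[of "Z + nat \<bar>r\<bar>"] by eventually_elim linarith
    qed
    then have "(\<lambda>n. inv_qpoch q (int (nat (int n + r)))) \<longlonglongrightarrow> ?L"
      by (rule filterlim_compose[OF inv_qpoch_LIMSEQ[OF q0 q1]])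
    moreover have "eventually (\<lambda>n. inv_qpoch q (int (nat (int n + r)))
        = inv_qpoch q (int n + r)) sequentially"
      using eventually_ge_at_top[of "nat \<bar>r\<bar>"] by eventually_elim (rule arg_cong[where f
          = "inv_qpoch q"], linarith)
    ultimately show ?thesis
      by (rule Lim_transform_eventually)
  qed
  have "(\<lambda>n. \<Sum>\<^sub>\<infinity>r. watson_coeff q r * inv_qpoch q (int n
      - r) * inv_qpoch q (int n + r))
      \<longlonglongrightarrow> (\<Sum>\<^sub>\<infinity>r. watson_coeff q r * ?L * ?L)"
  proof (rule tannery_int[where a = "\<lambda>r n. watson_coeff q r * inv_qpoch q (int n
      - r) * inv_qpoch q (int n + r)"
        and M = "\<lambda>r. (2 / (1 - norm q) * B * B) * norm q ^ nat \<bar>r\<bar>"])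
    show "(\<lambda>n. watson_coeff q r * inv_qpoch q (int n - r) * inv_qpoch q (int n
        + r)) \<longlonglongrightarrow> watson_coeff q r * ?L * ?L" for r
      using lim[of "- r"] lim[of r] by (intro tendsto_intros) auto
    fix r :: int and n :: nat
    have "norm (watson_coeff q r) * norm (inv_qpoch q (int n - r)) * norm (inv_qpoch q (int n + r))
        \<le> (2 / (1 - norm q) * norm q ^ nat \<bar>r\<bar>) * B * B"
      using B q1 by (intro mult_mono watson_coeff_bound) auto
    then show "norm (watson_coeff q r * inv_qpoch q (int n - r) * inv_qpoch q (int n + r))
        \<le> (2 / (1 - norm q) * B * B) * norm q ^ nat \<bar>r\<bar>"
      by (simp add: norm_mult mult_ac)
  next
    show "(\<lambda>r. (2 / (1 - norm q) * B * B) * norm q ^ nat \<bar>r\<bar>) summable_on UNIV"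
      using geo by (rule summable_on_cmult_right)
  qed
  also have "(\<lambda>n. \<Sum>\<^sub>\<infinity>r. watson_coeff q r * inv_qpoch q (int n
      - r) * inv_qpoch q (int n + r)) = (\<lambda>n. 1 / (qpoch (- q) q n)\<^sup>2)"
    by (rule ext) (rule infsumI[OF watson_finite_has_sum])
  finally have "(\<lambda>n. 1 / (qpoch (- q) q n)\<^sup>2) \<longlonglongrightarrow>
      (\<Sum>\<^sub>\<infinity>r. watson_coeff q r * ?L * ?L)" .
  moreover have "(\<lambda>n. 1 / (qpoch (- q) q n)\<^sup>2) \<longlonglongrightarrow> 1 / (qpoch_inf (- q)
      q)\<^sup>2"
    using qpoch_inf_nonzero'[of q "- q"] q1 by (intro tendsto_intros qpoch_LIMSEQ q1) auto
  ultimately have e: "(\<Sum>\<^sub>\<infinity>r. watson_coeff q r * ?L * ?L) = 1 / (qpoch_inf (- q) q)\<^sup>2"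
    by (rule LIMSEQ_unique)
  have "(\<lambda>r. norm (watson_coeff q r)) summable_on UNIV"
    by (rule Infinite_Sum.abs_summable_on_comparison_test'[OF summable_on_cmult_right[OF geo]]) (rule
        watson_coeff_bound)
  then have a: "(watson_coeff q has_sum (\<Sum>\<^sub>\<infinity>r. watson_coeff q r)) UNIV"
    by (simp add: abs_summable_summable)
  have "((\<lambda>r. watson_coeff q r * ?L * ?L) has_sum (\<Sum>\<^sub>\<infinity>r. watson_coeff q r)
      * ?L * ?L) UNIV"
    by (intro has_sum_cmult_left a)
  then have "(\<Sum>\<^sub>\<infinity>r. watson_coeff q r) * ?L * ?L = 1 / (qpoch_inf (- q) q)\<^sup>2"
    using e infsumI by fastforce
  then have "(\<Sum>\<^sub>\<infinity>r. watson_coeff q r) = (qpoch_inf q q / qpoch_inf (- q) q)\<^sup>2"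
    using qpoch_inf_nonzero'[OF q1 q1] by (simp add: field_simps power2_eq_square)
  with a show ?thesis by simp
qed

end

subsection \<open>The quotient of two theta functions\<close>

text \<open>The case \<open>a = -1\<close> of Kronecker's series with coefficients
  \<open>1/(1 - a q^k)\<close>, which is summed by Ramanujan's 1psi1 formula.\<close>

definition kronecker_coeff :: "complex \<Rightarrow> int \<Rightarrow> complex" where
  "kronecker_coeff q k = 1 / (1 + q powi k)"

context
  fixes q :: complex
  assumes q0: "q \<noteq> 0" and q1: "norm q < 1"
begin

lemma theta_j_minus_has_sum:
  assumes "x \<noteq> 0"
  shows "((\<lambda>n. q powi tri n * x powi n) has_sum theta_j (- x) q) UNIV"
proof -
  have eq: "(-1 :: complex) powi n * q powi tri n * (- x) powi n = q powi tri n * x powi n" for n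
  proof -
    have "(-1 :: complex) powi n * (- x) powi n = x powi n"
      by (simp add: power_int_mult_distrib[symmetric])
    then show ?thesis by (metis mult.assoc mult.commute)
  qed
  show ?thesis
    using jacobi_triple_product[OF q0 q1, of "- x"] assms
    unfolding has_laurent_def theta_coeff_def eq by simp
qed

lemma theta_j_has_sum:
  assumes "x \<noteq> 0"
  shows "((\<lambda>n. (-1) powi n * q powi tri n * x powi n) has_sum theta_j x q) UNIV"
  using jacobi_triple_product[OF q0 q1, of x] assms
  by (simp add: has_laurent_def theta_coeff_def)

lemma norm_kronecker_coeff: "norm (kronecker_coeff q k)
    \<le> (if k \<ge> 0 then 1 else norm q ^ nat (- k)) / (1 - norm q)"
proof -
  note * = norm_one_plus_power_ge[OF q0 q1]
  show ?thesis
  proof (cases "k \<ge> 0")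
    case True
    then have "kronecker_coeff q k = 1 / (1 + q ^ nat k)"
      by (simp add: kronecker_coeff_def power_int_def)
    then show ?thesis
      using True q1 *[of "nat k"] by (simp add: norm_divide frac_le)
  next
    case False
    define n where "n = nat (- k)"
    have "k = - int n" using False by (simp add: n_def)
    then have "kronecker_coeff q k = q ^ n / (1 + q ^ n)"
      using q0 one_plus_powi_nonzero[OF q0 q1, of "int n"] one_plus_powi_nonzero[OF q0 q1, of "- int n"]
      by (simp add: kronecker_coeff_def power_int_minus field_simps)
    then show ?thesis
      using False q1 *[of n] by (simp add: norm_divide norm_power frac_le n_def)
  qed
qed

text \<open>The coefficients stay bounded for \<open>k >= 0\<close> and decay like
  \<open>norm q ^ \<bar>k\<bar>\<close> for \<open>k < 0\<close>; the two halves converge for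
  \<open>norm z < 1\<close> and for \<open>norm q < norm z\<close>.\<close>

lemma kronecker_summable:
  assumes "norm q < norm z" "norm z < 1"
  shows "(\<lambda>k. kronecker_coeff q k * z powi k) summable_on UNIV"
proof -
  define c where "c = max (norm z) (norm q / norm z)"
  have z: "norm z > 0" using assms(1) norm_ge_zero[of q] by linarith
  have c: "0 \<le> c" "c < 1"
    using assms z by (auto simp: c_def le_max_iff_disj)
  have "(\<lambda>k::int. 1 / (1 - norm q) * c ^ nat \<bar>k\<bar>) summable_on UNIV"
    by (intro summable_on_cmult_right summable_on_int_geometric c)
  then have "(\<lambda>k. norm (kronecker_coeff q k * z powi k)) summable_on UNIV"
  proof (rule Infinite_Sum.abs_summable_on_comparison_test')
    fix k :: int
    show "norm (kronecker_coeff q k * z powi k) \<le> 1 / (1 - norm q) * c ^ nat \<bar>k\<bar>"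
    proof (cases "k \<ge> 0")
      case True
      have "norm (kronecker_coeff q k) * norm (z powi k) \<le> 1 / (1 - norm q) * norm z ^ nat k"
        using norm_kronecker_coeff[of k] True q1
        by (intro mult_mono) (auto simp: norm_power power_int_def)
      also have "\<dots> \<le> 1 / (1 - norm q) * c ^ nat k"
        using q1 by (intro mult_left_mono power_mono) (auto simp: c_def)
      finally show ?thesis using True by (simp add: norm_mult)
    next
      case False
      have "norm (kronecker_coeff q k) * norm (z powi k)
          \<le> norm q ^ nat (- k) / (1 - norm q) * (1 / norm z ^ nat (- k))"
        using norm_kronecker_coeff[of k] False q1
        by (intro mult_mono) (auto simp: norm_power norm_inverse power_int_def divide_inverse power_inverse)
      also have "\<dots> = 1 / (1 - norm q) * (norm q / norm z) ^ nat (- k)"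
        by (simp add: power_divide)
      also have "\<dots> \<le> 1 / (1 - norm q) * c ^ nat (- k)"
        using q1 by (intro mult_left_mono power_mono) (auto simp: c_def)
      finally show ?thesis using False by (simp add: norm_mult)
    qed
  qed
  then show ?thesis by (rule abs_summable_summable)
qed

text \<open>Multiplying the sum \<open>\<Sum>\<^sub>k z\<^sup>k / (1
    + q\<^sup>k)\<close> by \<open>j(z; q)\<close> gives a Laurent series whose coefficients satisfy
  the first-order recurrence of those of \<open>j(- z; q)\<close>, since the extra term is \<open>j(1; q)
      = 0\<close>.\<close>

lemma kronecker_has_laurent:
  assumes z: "norm q < norm z" "norm z < 1"
  shows "has_laurent (kronecker_coeff q) z
    ((qpoch_inf q q / qpoch_inf (- q) q)\<^sup>2 / 2 * theta_j (- z) q / theta_j z q)"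
proof -
  have z0: "z \<noteq> 0" using z(1) norm_ge_zero[of q] by auto
  obtain s where s: "has_laurent (kronecker_coeff q) z s"
    using kronecker_summable[OF z] by (auto simp: has_laurent_def summable_on_def)
  define M where "M = conv (kronecker_coeff q) (theta_coeff q)"
  have M_sum: "((\<lambda>k. kronecker_coeff q k * theta_coeff q (n - k)) has_sum M n) UNIV" for n
    unfolding M_def by (rule conv_has_sum[OF s jacobi_triple_product[OF q0 q1 z0] z0])
  have theta0: "((\<lambda>k. theta_coeff q (n - k)) has_sum 0) UNIV" for n
  proof -
    have "(theta_coeff q has_sum 0) UNIV"
      using jacobi_triple_product[OF q0 q1, of 1] theta_j_1_eq_0[OF q1] by (simp add: has_laurent_def)
    then show ?thesis
      by (rule iffD1[OF has_sum_reindex_bij_witness[of _ "\<lambda>k. n - k" "\<lambda>k. n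
          - k"], rotated -1]) auto
  qed
  have M_rec: "M (n + 1) = q powi n * M n" for n
  proof -
    have "q powi n * (kronecker_coeff q k * theta_coeff q (n - k))
        = kronecker_coeff q k * theta_coeff q (n + 1 - k) - theta_coeff q (n + 1 - k)" for k
    proof -
      have 1: "theta_coeff q (n + 1 - k) = - (q powi (n - k)) * theta_coeff q (n - k)"
        using theta_coeff_Suc[OF q0 q1, of "n - k"] by (simp add: algebra_simps)
      have 2: "q powi n = q powi k * q powi (n - k)"
        using q0 by (simp add: power_int_add[symmetric])
      have 3: "q powi k * kronecker_coeff q k = 1 - kronecker_coeff q k"
        using one_plus_powi_nonzero[OF q0 q1, of k] by (simp add: kronecker_coeff_def field_simps)
      have "q powi n * (kronecker_coeff q k * theta_coeff q (n - k))
          = (q powi k * kronecker_coeff q k) * (q powi (n - k) * theta_coeff q (n - k))"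
        unfolding 2 by (simp add: mult_ac)
      then show ?thesis unfolding 1 3 by (simp add: algebra_simps)
    qed
    then have "((\<lambda>k. kronecker_coeff q k * theta_coeff q (n + 1 - k) - theta_coeff q (n
        + 1 - k)) has_sum q powi n * M n) UNIV"
      using has_sum_cmult_right[OF M_sum[of n], of "q powi n"] by simp
    from has_sum_unique[OF this has_sum_diff[OF M_sum theta0]] show ?thesis by simp
  qed
  have M_eq: "M n = M 0 * q powi tri n" for n
  proof (induction n rule: int_induct[of _ 0])
    case (step1 i)
    then show ?case
      unfolding M_rec tri_add using q0 by (simp add: power_int_add)
  next
    case (step2 i)
    have "q powi (i - 1) * M (i - 1) = M i"
      using M_rec[of "i - 1"] by simp
    also have "\<dots> = M 0 * (q powi tri (i - 1) * q powi (i - 1))"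
      using step2 tri_add[of "i - 1" 1] q0 by (simp add: power_int_add)
    finally show ?case using q0 by simp
  qed simp
  \<comment> \<open>Reflecting \<open>theta_coeff q (- k)\<close> supplies the factor
    \<open>q powi k\<close> that turns the summand into half a Watson coefficient.\<close>
  have "M 0 = (qpoch_inf q q / qpoch_inf (- q) q)\<^sup>2 / 2"
  proof -
    have eq: "kronecker_coeff q k * theta_coeff q (0 - k) = 1 / 2 * watson_coeff q k" for k
      by (simp add: kronecker_coeff_def watson_coeff_def theta_coeff_uminus[OF q0 q1])
    show ?thesis
      using has_sum_unique[OF M_sum[of 0, unfolded eq] has_sum_cmult_right[OF watson_coeff_has_sum[OF q0 q1],
          of "1 / 2"]]
      by simp
  qed
  moreover have "s * theta_j z q = M 0 * theta_j (- z) q"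
  proof (rule has_laurent_unique)
    show "has_laurent M z (s * theta_j z q)"
      unfolding M_def by (rule has_laurent_mult[OF s jacobi_triple_product[OF q0 q1 z0] z0])
    have "has_laurent (\<lambda>n. q powi tri n) z (theta_j (- z) q)"
      using theta_j_minus_has_sum[OF z0] by (simp add: has_laurent_def)
    from has_laurent_cmult[OF this, of "M 0"]
    show "has_laurent M z (M 0 * theta_j (- z) q)"
      using M_eq by (metis (no_types, lifting) ext)
  qed
  ultimately have "s = (qpoch_inf q q / qpoch_inf (- q) q)\<^sup>2 / 2 * theta_j (- z) q / theta_j z q"
    using theta_j_nonzero[OF z] by (metis nonzero_mult_div_cancel_right)
  with s show ?thesis by simp
qed

end

section \<open>Series dissection and products of two theta functions\<close>

lemma norm_power_lt_1:
  fixes q :: complex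
  shows "norm q < 1 \<Longrightarrow> n > 0 \<Longrightarrow> norm (q ^ n) < 1"
  by (simp add: norm_power power_less_one_iff)

context
  fixes q :: complex
  assumes q0: "q \<noteq> 0" and q1: "norm q < 1"
begin

text \<open>The theta series is split by the parity of its index, with
  \<open>tri (2 n) = 4 tri n + n\<close> and \<open>tri (2 n + 1) = 4 tri n + 3 n\<close>.\<close>

lemma theta_j_dissect_series:
  assumes "x \<noteq> 0"
  shows "theta_j x q = theta_j (- (q * x\<^sup>2)) (q ^ 4) - x * theta_j (- (q ^ 3 * x\<^sup>2)) (q ^ 4)"
proof -
  let ?f = "\<lambda>n. (-1) powi n * q powi tri n * x powi n"
  have q4: "q ^ 4 \<noteq> 0" "norm (q ^ 4) < 1" using q0 q1 by (auto intro: norm_power_lt_1)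
  have pw: "(q ^ m) powi k = q powi (int m * k)" for m k
    by (simp add: power_int_mult)
  have E: "(?f has_sum theta_j (- (q * x\<^sup>2)) (q ^ 4)) {n. even n}"
  proof -
    have "((\<lambda>n. (q ^ 4) powi tri n * (q * x\<^sup>2) powi n)
        has_sum theta_j (- (q * x\<^sup>2)) (q ^ 4)) UNIV"
      using theta_j_minus_has_sum[OF q4] q0 assms by simp
    also have "?this \<longleftrightarrow> (?f has_sum theta_j (- (q * x\<^sup>2)) (q ^ 4)) {n. even n}"
    proof (rule has_sum_reindex_bij_witness[of _ "\<lambda>n. n div 2" "\<lambda>n. 2 * n"])
      fix n :: int
      have e: "tri (2 * n) = 4 * tri n + n"
        using double_tri[of "2 * n"] double_tri[of n] by (simp add: algebra_simps)
      have "q powi tri (2 * n) = (q ^ 4) powi tri n * q powi n"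
        unfolding e pw using q0 by (simp add: power_int_add)
      moreover have "(-1 :: complex) powi (2 * n) = 1"
        by (simp add: power_int_mult)
      moreover have "x powi (2 * n) = (x\<^sup>2) powi n"
        by (simp add: power_int_mult)
      ultimately show "?f (2 * n) = (q ^ 4) powi tri n * (q * x\<^sup>2) powi n"
        by (simp add: power_int_mult_distrib)
    qed auto
    finally show ?thesis .
  qed
  have O: "(?f has_sum - x * theta_j (- (q ^ 3 * x\<^sup>2)) (q ^ 4)) {n. odd n}"
  proof -
    have "((\<lambda>n. - x * ((q ^ 4) powi tri n * (q ^ 3 * x\<^sup>2) powi n))
        has_sum - x * theta_j (- (q ^ 3 * x\<^sup>2)) (q ^ 4)) UNIV"
      using theta_j_minus_has_sum[OF q4, of "q ^ 3 * x\<^sup>2"] q0 assms by (intro has_sum_cmult_right) auto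
    also have "?this \<longleftrightarrow> (?f has_sum
        - x * theta_j (- (q ^ 3 * x\<^sup>2)) (q ^ 4)) {n. odd n}"
    proof (rule has_sum_reindex_bij_witness[of _ "\<lambda>n. n div 2" "\<lambda>n. 2 * n + 1"])
      fix n :: int
      have e: "tri (2 * n + 1) = 4 * tri n + 3 * n"
        using double_tri[of "2 * n + 1"] double_tri[of n] by (simp add: algebra_simps)
      have "q powi tri (2 * n + 1) = (q ^ 4) powi tri n * (q ^ 3) powi n"
        unfolding e pw using q0 by (simp add: power_int_add)
      moreover have "(-1 :: complex) powi (2 * n + 1) = -1"
        by (simp add: power_int_add power_int_mult)
      moreover have "x powi (2 * n + 1) = (x\<^sup>2) powi n * x"
        using assms by (simp add: power_int_add power_int_mult)
      ultimately show "?f (2 * n + 1) = - x * ((q ^ 4) powi tri n * (q ^ 3 * x\<^sup>2) powi n)"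
        by (simp add: power_int_mult_distrib)
    qed auto
    finally show ?thesis .
  qed
  have "(?f has_sum theta_j (- (q * x\<^sup>2)) (q ^ 4)
      + - x * theta_j (- (q ^ 3 * x\<^sup>2)) (q ^ 4)) ({n. even n} \<union> {n. odd n})"
    by (rule has_sum_Un_disjoint[OF E O]) auto
  moreover have "{n::int. even n} \<union> {n. odd n} = UNIV" by auto
  ultimately show ?thesis
    using has_sum_unique[OF theta_j_has_sum[OF q0 q1 assms]] by fastforce
qed

text \<open>The double series is split by the parity of \<open>m + n\<close>. The coordinates
  \<open>(t + u, t - u)\<close> and \<open>(t + u + 1, t - u)\<close> on the two halves keep the
  quadratic form diagonal, so each half is again a product of two theta series.\<close>

lemma theta_j_mult_theta_j:
  assumes "a \<noteq> 0" "b \<noteq> 0"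
  shows "theta_j a q * theta_j b q = theta_j (- (a * b)) (q\<^sup>2) * theta_j (- (q * a / b)) (q\<^sup>2)
    - a * (theta_j (- (q * a * b)) (q\<^sup>2) * theta_j (- (q\<^sup>2 * a / b)) (q\<^sup>2))"
proof -
  let ?f = "\<lambda>x n. (-1) powi n * q powi tri n * x powi n"
  let ?F = "\<lambda>(m, n). ?f a m * ?f b n"
  let ?g = "\<lambda>x n. (q\<^sup>2) powi tri n * x powi n"
  have q2: "q\<^sup>2 \<noteq> 0" "norm (q\<^sup>2) < 1" using q0 q1 by (auto intro: norm_power_lt_1)
  have F: "(?F has_sum theta_j a q * theta_j b q) (UNIV \<times> UNIV)"
    by (intro has_sum_product theta_j_has_sum assms q0 q1)
  have pw: "(q\<^sup>2) powi tri n = q powi (n * (n - 1))" for n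
    unfolding double_tri[symmetric] by (simp add: power_int_mult)
  have sgn: "(-1 :: complex) powi m * (-1) powi n = (-1) powi (m + n)" for m n
    by (simp add: power_int_add)
  have half_even: "(m + n) div 2 + (m - n) div 2 = m" "(m + n) div 2 - (m - n) div 2 = n"
    if "even (m + n)" for m n :: int
    using that by presburger+
  have half_odd: "(m + n) div 2 + (m - n) div 2 + 1 = m" "(m + n) div 2 - (m - n) div 2 = n"
    if "odd (m + n)" for m n :: int
    using that by presburger+
  have E: "(?F has_sum theta_j (- (a * b)) (q\<^sup>2) * theta_j (- (q
      * a / b)) (q\<^sup>2)) {(m, n). even (m + n)}"
  proof -
    have "((\<lambda>(t, u). ?g (a * b) t * ?g (q * a / b) u)
        has_sum theta_j (- (a * b)) (q\<^sup>2) * theta_j (- (q * a / b)) (q\<^sup>2)) (UNIV \<times> UNIV)"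
      using assms q0 by (intro has_sum_product theta_j_minus_has_sum[OF q2]) auto
    also have "?this \<longleftrightarrow> (?F has_sum theta_j (- (a * b)) (q\<^sup>2) * theta_j (- (q
        * a / b)) (q\<^sup>2)) {(m, n). even (m + n)}"
    proof (rule has_sum_reindex_bij_witness[of _ "\<lambda>(m, n). ((m
        + n) div 2, (m - n) div 2)" "\<lambda>(t, u). (t + u, t - u)"])
      fix p :: "int \<times> int"
      obtain t u where p: "p = (t, u)" by force
      have e: "tri (t + u) + tri (t - u) = t * (t - 1) + (u * (u - 1) + u)"
        using double_tri[of "t + u"] double_tri[of "t - u"] by (simp add: algebra_simps)
      have "q powi tri (t + u) * q powi tri (t - u)
          = (q\<^sup>2) powi tri t * ((q\<^sup>2) powi tri u * q powi u)"
        unfolding pw power_int_add[symmetric, OF disjI1, OF q0] e ..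
      moreover have "(-1 :: complex) powi (t + u) * (-1) powi (t - u) = 1"
        unfolding sgn by (simp add: power_int_mult)
      moreover have "a powi (t + u) * b powi (t - u) = (a * b) powi t * (a / b) powi u"
        using assms by (simp add: power_int_add power_int_diff power_int_mult_distrib power_int_divide_distrib)
      moreover have "(q * a / b) powi u = q powi u * (a / b) powi u"
        by (simp add: power_int_mult_distrib power_int_divide_distrib)
      moreover have "x1 * x2 * x3 * (y1 * y2 * y3) = (x2 * y2) * (x1 * y1) * (x3
          * y3)" for x1 x2 x3 y1 y2 y3 :: complex
        by simp
      ultimately show "?F (case p of (t, u) \<Rightarrow> (t + u, t - u))
          = (case p of (t, u) \<Rightarrow> ?g (a * b) t * ?g (q * a / b) u)"
        unfolding p prod.case by (simp add: mult_ac)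
    qed (use half_even in auto)
    finally show ?thesis .
  qed
  have O: "(?F has_sum - a * (theta_j (- (q * a * b)) (q\<^sup>2) * theta_j (- (q\<^sup>2
      * a / b)) (q\<^sup>2))) {(m, n). odd (m + n)}"
  proof -
    have "((\<lambda>(t, u). ?g (q * a * b) t * ?g (q\<^sup>2 * a / b) u)
        has_sum theta_j (- (q * a * b)) (q\<^sup>2) * theta_j (- (q\<^sup>2
        * a / b)) (q\<^sup>2)) (UNIV \<times> UNIV)"
      using assms q0 by (intro has_sum_product theta_j_minus_has_sum[OF q2]) auto
    from has_sum_cmult_right[OF this, of "- a"]
    have "((\<lambda>p. - a * (case p of (t, u) \<Rightarrow> ?g (q * a * b) t * ?g (q\<^sup>2
        * a / b) u)) has_sum
        - a * (theta_j (- (q * a * b)) (q\<^sup>2) * theta_j (- (q\<^sup>2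
            * a / b)) (q\<^sup>2))) (UNIV \<times> UNIV)" .
    also have "?this \<longleftrightarrow> (?F has_sum
        - a * (theta_j (- (q * a * b)) (q\<^sup>2) * theta_j (- (q\<^sup>2
        * a / b)) (q\<^sup>2))) {(m, n). odd (m + n)}"
    proof (rule has_sum_reindex_bij_witness[of _ "\<lambda>(m, n). ((m
        + n) div 2, (m - n) div 2)" "\<lambda>(t, u). (t + u + 1, t - u)"])
      fix p :: "int \<times> int"
      obtain t u where p: "p = (t, u)" by force
      have e: "tri (t + u + 1) + tri (t - u) = t * (t - 1) + t + (u * (u - 1) + 2 * u)"
        using double_tri[of "t + u + 1"] double_tri[of "t - u"] by (simp add: algebra_simps)
      have q2u: "(q\<^sup>2) powi u = q powi (2 * u)"
        by (simp add: power_int_mult)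
      have "q powi tri (t + u + 1) * q powi tri (t - u)
          = (q\<^sup>2) powi tri t * q powi t * ((q\<^sup>2) powi tri u * (q\<^sup>2) powi u)"
        unfolding pw q2u power_int_add[symmetric, OF disjI1, OF q0] e ..
      moreover have "(-1 :: complex) powi (t + u + 1) * (-1) powi (t - u) = -1"
        unfolding sgn by (simp add: power_int_add power_int_mult)
      moreover have "a powi (t + u + 1) * b powi (t - u) = a * ((a * b) powi t * (a / b) powi u)"
        using assms by (simp add: power_int_add power_int_diff power_int_mult_distrib power_int_divide_distrib)
      moreover have "(q\<^sup>2 * a / b) powi u = (q\<^sup>2) powi u * (a / b) powi u"
        "(q * a * b) powi t = q powi t * (a * b) powi t"
        by (simp_all add: power_int_mult_distrib power_int_divide_distrib)
      moreover have "x1 * x2 * x3 * (y1 * y2 * y3) = (x2 * y2) * (x1 * y1) * (x3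
          * y3)" for x1 x2 x3 y1 y2 y3 :: complex
        by simp
      ultimately show "?F (case p of (t, u) \<Rightarrow> (t + u + 1, t - u))
          = - a * (case p of (t, u) \<Rightarrow> ?g (q * a * b) t * ?g (q\<^sup>2 * a / b) u)"
        unfolding p prod.case by (simp add: mult_ac)
    qed (use half_odd in auto)
    finally show ?thesis .
  qed
  have "(?F has_sum theta_j (- (a * b)) (q\<^sup>2) * theta_j (- (q * a / b)) (q\<^sup>2)
      + - a * (theta_j (- (q * a * b)) (q\<^sup>2) * theta_j (- (q\<^sup>2
          * a / b)) (q\<^sup>2))) ({(m, n). even (m + n)} \<union> {(m, n). odd (m + n)})"
    by (rule has_sum_Un_disjoint[OF E O]) auto
  moreover have "{(m, n). even (m + n)} \<union> {(m, n). odd (m + n)}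
      = (UNIV \<times> UNIV :: (int \<times> int) set)" by auto
  ultimately show ?thesis
    using has_sum_unique[OF F] by fastforce
qed

end

subsection \<open>String functions as Laurent coefficients\<close>

lemma nome_pow_add: "nome_pow \<tau> (a + b) = nome_pow \<tau> a * nome_pow \<tau> b"
  unfolding nome_pow_def by (simp add: distrib_left exp_add)

lemma nome_pow_0 [simp]: "nome_pow \<tau> 0 = 1"
  by (simp add: nome_pow_def)

lemma nome_pow_nonzero [simp]: "nome_pow \<tau> a \<noteq> 0"
  by (simp add: nome_pow_def)

lemma norm_nome_less_1: "Im \<tau> > 0 \<Longrightarrow> norm (nome \<tau>) < 1"
  by (simp add: norm_exp_eq_Re)

text \<open>This is \<open>p (l + 1)^2 / (4 p') - 1/8\<close> for \<open>(p, p') = (3, 8)\<close>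
  and \<open>l = 2 r + 1\<close>.\<close>

definition char_exponent :: "nat \<Rightarrow> real" where
  "char_exponent r = 3 * (2 * real r + 2)\<^sup>2 / 32 - 1 / 8"

text \<open>The bracket of the character for \<open>(3, 8)\<close>: the exponents
  \<open>6 r + 30\<close> and \<open>18 - 6 r\<close> are \<open>p p' + p (l + 1)\<close> and
  \<open>p p' - p (l + 1)\<close>, and \<open>48 = 2 p p'\<close>.\<close>

definition adm_numerator :: "nat \<Rightarrow> complex \<Rightarrow> complex \<Rightarrow> complex" where
  "adm_numerator r q z =
     theta_j (- (q powi (6 * int r + 30) * z powi (- 8))) (q ^ 48)
     - z ^ (2 * r + 2) * theta_j (- (q powi (18 - 6 * int r) * z powi (- 8))) (q ^ 48)"

context
  fixes \<tau> :: complex and r :: nat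
  assumes tau: "Im \<tau> > 0"
begin

lemma adm_char_eq:
  assumes "z \<noteq> 0"
  shows "adm_char 3 8 (2 * r + 1) z \<tau>
    = nome_pow \<tau> (char_exponent r) * z powr (- (of_nat r
        + 1 / 2)) * (adm_numerator r (nome \<tau>) z / theta_j z (nome \<tau>))"
proof -
  have 1: "nome_pow \<tau> (3 * (2 * real r + 2)\<^sup>2 / 32)
      = nome_pow \<tau> (char_exponent r) * nome_pow \<tau> (1 / 8)"
    unfolding nome_pow_add[symmetric] char_exponent_def by simp
  have 2: "z powr (- (of_nat r + 1)) = z powr (- (of_nat r + 1 / 2)) * z powr (- (1 / 2))"
    unfolding powr_add[symmetric] by (rule arg_cong[where f = "\<lambda>c. z powr c"]) simp
  have 3: "(2 * of_nat r + 1 + 1) / 2 = (of_nat r + 1 :: complex)" by simp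
  have 4: "int 3 * (int (2 * r + 1) + 1) + int 3 * int 8 = 6 * int r + 30"
    "- (int 3 * (int (2 * r + 1) + 1)) + int 3 * int 8 = 18 - 6 * int r" by simp_all
  have 5: "real 3 * (real (2 * r + 1) + 1)\<^sup>2 / (4 * real 8) = 3 * (2 * real r + 2)\<^sup>2 / 32"
    by (simp add: add.commute)
  have 6: "2 * 3 * 8 = (48::nat)" "2 * r + 1 + 1 = 2 * r + 2" "- int 8 = - 8" by simp_all
  have 7: "(of_nat (2 * r + 1) + 1) / 2 = (of_nat r + 1 :: complex)" by simp
  have alg: "(w * h) * (a * b) * N / (h * b * t) = a * w
      * (N / t)" if "h \<noteq> 0" "b \<noteq> 0" for w h a b N t :: complex
    using that by simp
  have "z powr (- (1 / 2)) \<noteq> 0" using assms by simp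
  then show ?thesis
    unfolding adm_char_def Let_def 4 5 6 7 1 2 adm_numerator_def by (rule alg) simp
qed

text \<open>Substituting \<open>m = 2 r + 1 - 2 k\<close> splits off one common half-integral power
  of \<open>z\<close> and leaves integral powers, to which no choice of branch applies. The index
  \<open>m = 1\<close> becomes \<open>k = r\<close>.\<close>

lemma has_sum_string_iff:
  assumes "z \<noteq> 0"
  shows "((\<lambda>m. E m * z powr (- (of_int m / 2)))
      has_sum (z powr (- (of_nat r + 1 / 2)) * s)) {m. even (m - int (2 * r + 1))}
    \<longleftrightarrow> has_laurent (\<lambda>k. E (2 * int r + 1 - 2 * k)) z s"
proof -
  let ?w = "z powr (- (of_nat r + 1 / 2))"
  have w: "?w \<noteq> 0" using assms by simp
  have pw: "z powr (- (of_int (2 * int r + 1 - 2 * k) / 2)) = ?w * z powi k" for k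
  proof -
    have "z powr (- (of_int (2 * int r + 1 - 2 * k) / 2)) = z powr (- (of_nat r + 1 / 2) + of_int k)"
      by (rule arg_cong[where f = "\<lambda>c. z powr c"]) (simp add: field_simps)
    also have "\<dots> = ?w * z powr of_int k"
      by (rule powr_add)
    finally show ?thesis using assms by (simp add: powr_of_int power_int_def power_inverse)
  qed
  have "has_laurent (\<lambda>k. E (2 * int r + 1 - 2 * k)) z s
      \<longleftrightarrow> ((\<lambda>k. ?w * (E (2 * int r + 1 - 2 * k) * z powi k)) has_sum ?w * s) UNIV"
    unfolding has_laurent_def using w by (simp add: has_sum_cmult_right_iff)
  also have "\<dots> \<longleftrightarrow> ((\<lambda>m. E m * z powr (- (of_int m / 2)))
      has_sum ?w * s) {m. even (m - int (2 * r + 1))}"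
  proof (rule has_sum_reindex_bij_witness[of _ "\<lambda>m. (2 * int r
      + 1 - m) div 2" "\<lambda>k. 2 * int r + 1 - 2 * k"])
    show "E (2 * int r + 1 - 2 * k) * z powr (- (of_int (2 * int r + 1 - 2 * k) / 2))
        = ?w * (E (2 * int r + 1 - 2 * k) * z powi k)" for k
      unfolding pw by (simp only: mult_ac)
  qed auto
  finally show ?thesis ..
qed

text \<open>The expansion \<open>\<phi>\<close> yields a string family, and Laurent coefficients are
  unique, so the definite description denotes this family. The normalising power of \<open>q\<close>
  cancels what remains at \<open>m = 1\<close>.\<close>

theorem string_fun_norm_eq_coeff:
  assumes phi: "\<And>z. norm (nome \<tau>) < norm z \<Longrightarrow> norm z < 1 \<Longrightarrow>
    has_laurent \<phi> z (adm_numerator r (nome \<tau>) z / theta_j z (nome \<tau>))"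
  shows "string_fun_norm 3 8 1 (2 * r + 1) \<tau> = \<phi> (int r)"
proof -
  let ?q = "nome \<tau>"
  have level: "x / (4 * adm_level 3 8) = 3 * x / 8" for x
    by (simp add: adm_level_def)
  let ?p = "\<lambda>m. nome_pow \<tau> (3 * (real_of_int m)\<^sup>2 / 8)"
  \<comment> \<open>The substitution \<open>m = 2 r + 1 - 2 k\<close> inverted. The level is
    \<open>2/3\<close>, so \<open>m^2 / (4 N) = 3 m^2 / 8\<close>.\<close>
  define C where "C m = (if odd m then \<phi> ((2 * int r
      + 1 - m) div 2) * nome_pow \<tau> (char_exponent r - 3 * (real_of_int m)\<^sup>2 / 8) else 0)" for m
  have family_iff: "is_string_family 3 8 (2 * r + 1) \<tau> D \<longleftrightarrow>
      (\<forall>m. odd (m - int (2 * r + 1)) \<longrightarrow> D m = 0) \<and>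
      (\<forall>z. norm ?q < norm z \<and> norm z < 1 \<longrightarrow> has_laurent (\<lambda>k. D (2
          * int r + 1 - 2 * k) * ?p (2 * int r + 1 - 2 * k)) z
        (nome_pow \<tau> (char_exponent r) * (adm_numerator r ?q z / theta_j z ?q)))" for D
  proof -
    have "((\<lambda>m. D m * ?p m * z powr (- (of_int m / 2)))
        has_sum adm_char 3 8 (2 * r + 1) z \<tau>) {m. even (m - int (2 * r + 1))}
      \<longleftrightarrow> has_laurent (\<lambda>k. D (2 * int r + 1 - 2 * k) * ?p (2 * int r + 1 - 2 * k)) z
        (nome_pow \<tau> (char_exponent r) * (adm_numerator r ?q z / theta_j z ?q))" if "norm ?q < norm z" for z
    proof -
      have z: "z \<noteq> 0" using that norm_ge_zero[of ?q] by auto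
      have "adm_char 3 8 (2 * r + 1) z \<tau> = z powr (- (of_nat r
          + 1 / 2)) * (nome_pow \<tau> (char_exponent r) * (adm_numerator r ?q z / theta_j z ?q))"
        unfolding adm_char_eq[OF z] by (simp only: mult_ac)
      then show ?thesis
        by (simp only: has_sum_string_iff[OF z, of "\<lambda>m. D m * ?p m"])
    qed
    then show ?thesis
      unfolding is_string_family_def level by blast
  qed
  have C: "is_string_family 3 8 (2 * r + 1) \<tau> C"
    unfolding family_iff
  proof (intro conjI allI impI)
    show "C m = 0" if "odd (m - int (2 * r + 1))" for m
      using that by (simp add: C_def)
    fix z :: complex assume z: "norm ?q < norm z \<and> norm z < 1"
    have "(\<lambda>k. C (2 * int r + 1 - 2 * k) * ?p (2 * int r + 1 - 2 * k))
        = (\<lambda>k. nome_pow \<tau> (char_exponent r) * \<phi> k)"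
    proof
      fix k :: int
      have "nome_pow \<tau> (char_exponent r - 3 * (real_of_int m)\<^sup>2 / 8) * ?p m
          = nome_pow \<tau> (char_exponent r)" for m
        unfolding nome_pow_add[symmetric] by simp
      moreover have "C (2 * int r + 1 - 2 * k)
          = \<phi> k * nome_pow \<tau> (char_exponent r - 3 * (real_of_int (2 * int r
              + 1 - 2 * k))\<^sup>2 / 8)"
        by (simp add: C_def)
      ultimately show "C (2 * int r + 1 - 2 * k) * ?p (2 * int r + 1 - 2 * k)
          = nome_pow \<tau> (char_exponent r) * \<phi> k"
        by (simp only: mult.assoc) (simp only: mult.commute)
    qed
    then show "has_laurent (\<lambda>k. C (2 * int r + 1 - 2 * k) * ?p (2 * int r + 1 - 2 * k)) z
        (nome_pow \<tau> (char_exponent r) * (adm_numerator r ?q z / theta_j z ?q))"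
      using has_laurent_cmult[OF phi, of z "nome_pow \<tau> (char_exponent r)"] z by (simp only: simp_thms)
  qed
  have unique: "D = C" if D: "is_string_family 3 8 (2 * r + 1) \<tau> D" for D
  proof
    fix m
    show "D m = C m"
    proof (cases "even m")
      case True
      then have "odd (m - int (2 * r + 1))" by simp
      then show ?thesis using C D unfolding family_iff by metis
    next
      case False
      define k where "k = (2 * int r + 1 - m) div 2"
      have m: "2 * int r + 1 - 2 * k = m"
        using False unfolding k_def by simp
      \<comment> \<open>The uniqueness lemma needs one circle inside the annulus.\<close>
      define \<rho> where "\<rho> = (norm ?q + 1) / 2"
      have rho: "norm ?q < \<rho>" "\<rho> < 1" "\<rho> > 0"
      proof -
        have "n < (n + 1) / 2 \<and> (n + 1) / 2 < 1 \<and> (n + 1) / 2 > 0" if "0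
            \<le> n" "n < 1" for n :: real
          using that by auto
        from this[OF norm_ge_zero norm_nome_less_1[OF tau]]
        show "norm ?q < \<rho>" "\<rho> < 1" "\<rho> > 0"
          unfolding \<rho>_def by blast+
      qed
      let ?a = "\<lambda>D k. D (2 * int r + 1 - 2 * k) * ?p (2 * int r + 1 - 2 * k)"
      have "?a D k - ?a C k = 0"
      proof (rule has_laurent_zero_imp_coeff_zero[OF rho(3), where a = "\<lambda>k. ?a D k - ?a C k" and k = k])
        fix z :: complex assume "norm z = \<rho>"
        then have z: "norm ?q < norm z \<and> norm z < 1" using rho by simp
        have "has_laurent (\<lambda>k. ?a D k - ?a C k) z
            (nome_pow \<tau> (char_exponent r) * (adm_numerator r ?q z / theta_j z ?q)
                - nome_pow \<tau> (char_exponent r) * (adm_numerator r ?q z / theta_j z ?q))"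
          using C D z unfolding family_iff by (intro has_laurent_diff) blast+
        then show "has_laurent (\<lambda>k. ?a D k - ?a C k) z 0" by simp
      qed
      then show ?thesis unfolding m by simp
    qed
  qed
  have "(THE C. is_string_family 3 8 (2 * r + 1) \<tau> C) = C"
    using C unique by (rule the_equality)
  moreover have "string_exponent 3 8 1 (2 * r + 1) = char_exponent r - 3 / 8"
    unfolding string_exponent_def level char_exponent_def by (simp add: add.commute)
  moreover have "nome_pow \<tau> (- (char_exponent r - 3 / 8)) * nome_pow \<tau> (char_exponent r - 3 / 8) = 1"
    unfolding nome_pow_add[symmetric] by simp
  ultimately show ?thesis
    unfolding string_fun_norm_def string_fun_def by (simp add: C_def mult_ac)
qed

end

subsection \<open>Theta constants\<close>

text \<open>The exponents in \<open>(q)_inf\<close> are sorted by their residues mod 3, one for each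
  factor of the theta function.\<close>

lemma theta_j_cube:
  assumes "q \<noteq> 0" "norm q < 1"
  shows "theta_j q (q ^ 3) = J 1 q"
proof -
  have "qpoch_inf q q = qpoch_inf q (q ^ 3) * qpoch_inf (q * q) (q ^ 3) * qpoch_inf (q\<^sup>2 * q) (q ^ 3)"
    using qpoch_inf_dissect[OF assms(2), of 3 q] by (simp add: numeral_3_eq_3 numeral_2_eq_2)
  moreover have "q ^ 3 / q = q * q" "q\<^sup>2 * q = q ^ 3"
    using assms(1) by (simp_all add: power2_eq_square power3_eq_cube)
  ultimately show ?thesis
    unfolding theta_j_def J_eq by simp
qed

text \<open>Divide the known value at \<open>q^2\<close> by the one at \<open>q\<close>, using
  \<open>j(x) j(-x)\<close>. The constants for the nomes \<open>q^4\<close> and \<open>q^6\<close>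
  with negative argument arise in the same way.\<close>

lemma theta_j_minus_cube:
  assumes "q \<noteq> 0" "norm q < 1"
  shows "theta_j (- q) (q ^ 3) = J 2 q * (J 3 q)\<^sup>2 / (J 1 q * J 6 q)"
proof -
  have "theta_j (q\<^sup>2) ((q\<^sup>2) ^ 3) = J 1 (q\<^sup>2)"
    by (rule theta_j_cube) (use assms norm_power_lt_1 in auto)
  then have "theta_j (q\<^sup>2) ((q ^ 3)\<^sup>2) = J 2 q"
    by (simp add: J_power power_mult[symmetric])
  moreover have "norm (q ^ 3) < 1"
    using assms by (auto intro: norm_power_lt_1)
  ultimately have "J 1 q * theta_j (- q) (q ^ 3) * J 6 q = J 2 q * (J 3 q)\<^sup>2"
    using theta_j_mult_minus[of "q ^ 3" q] assms by (simp add: theta_j_cube J_power)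
  then show ?thesis
    using J_nonzero[OF assms(2)] by (simp add: field_simps)
qed

lemma theta_j_fourth:
  assumes "q \<noteq> 0" "norm q < 1"
  shows "theta_j q (q ^ 4) = J 1 q * J 4 q / J 2 q"
proof -
  have q2: "norm (q\<^sup>2) < 1"
    using assms by (auto intro: norm_power_lt_1)
  have "qpoch_inf q q = qpoch_inf q (q\<^sup>2) * qpoch_inf (q * q) (q\<^sup>2)"
    using qpoch_inf_dissect[OF assms(2), of 2 q] by (simp add: numeral_2_eq_2)
  moreover have "qpoch_inf q (q\<^sup>2) = qpoch_inf q ((q\<^sup>2)\<^sup>2) * qpoch_inf (q\<^sup>2
      * q) ((q\<^sup>2)\<^sup>2)"
    using qpoch_inf_dissect[OF q2, of 2 q] by (simp add: numeral_2_eq_2)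
  moreover have "(q\<^sup>2)\<^sup>2 = q ^ 4" "q\<^sup>2 * q = q ^ 4 / q" "q * q = q\<^sup>2"
    using assms(1) by (simp_all add: eval_nat_numeral)
  ultimately have "J 1 q * J 4 q = theta_j q (q ^ 4) * J 2 q"
    unfolding theta_j_def J_eq by simp
  then show ?thesis
    using J_nonzero[OF assms(2), of 2] by (simp add: field_simps)
qed

lemma theta_j_minus_fourth:
  assumes "q \<noteq> 0" "norm q < 1"
  shows "theta_j (- q) (q ^ 4) = (J 2 q)\<^sup>2 / J 1 q"
proof -
  have "theta_j (q\<^sup>2) ((q\<^sup>2) ^ 4) = J 1 (q\<^sup>2) * J 4 (q\<^sup>2) / J 2 (q\<^sup>2)"
    by (rule theta_j_fourth) (use assms norm_power_lt_1 in auto)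
  then have t: "theta_j (q\<^sup>2) ((q ^ 4)\<^sup>2) = J 2 q * J 8 q / J 4 q"
    by (simp add: J_power power_mult[symmetric])
  have q4: "norm (q ^ 4) < 1"
    using assms by (auto intro: norm_power_lt_1)
  have "theta_j q (q ^ 4) * theta_j (- q) (q ^ 4) * J 2 (q ^ 4)
      = theta_j (q\<^sup>2) ((q ^ 4)\<^sup>2) * (J 1 (q ^ 4))\<^sup>2"
    by (rule theta_j_mult_minus[OF q4])
  then have "J 1 q * J 4 q / J 2 q * theta_j (- q) (q ^ 4) * J 8 q = J 2 q * J 8 q / J 4 q * (J 4 q)\<^sup>2"
    unfolding t theta_j_fourth[OF assms] J_power by simp
  then show ?thesis
    using J_nonzero[OF assms(2), of 1] J_nonzero[OF assms(2), of 2] J_nonzero[OF assms(2), of 4] J_nonzero[OF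
        assms(2), of 8]
    by (simp add: field_simps power2_eq_square)
qed

text \<open>\<open>j(q; q^3)\<close> factors into \<open>j(q; q^6)\<close> and
  \<open>j(q^4; q^6)\<close>; by inversion the latter is \<open>j(q^2; q^6)\<close>, known from
  \<open>theta_j_cube\<close> at \<open>q^2\<close>.\<close>

lemma theta_j_sixth:
  assumes "q \<noteq> 0" "norm q < 1"
  shows "theta_j q (q ^ 6) = J 1 q * (J 6 q)\<^sup>2 / (J 2 q * J 3 q)"
proof -
  have "theta_j (q\<^sup>2) ((q\<^sup>2) ^ 3) = J 1 (q\<^sup>2)"
    by (rule theta_j_cube) (use assms norm_power_lt_1 in auto)
  moreover have "theta_j (q ^ 6 / q\<^sup>2) (q ^ 6) = theta_j (q\<^sup>2) (q ^ 6)"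
    by (rule theta_j_inverse) (use assms in auto)
  moreover have "q ^ 6 / q\<^sup>2 = q ^ 3 * q" "(q\<^sup>2) ^ 3 = q ^ 6"
    using assms(1) by (simp_all add: eval_nat_numeral)
  ultimately have t: "theta_j (q ^ 3 * q) (q ^ 6) = J 2 q"
    by (simp add: J_power)
  have q3: "norm (q ^ 3) < 1" "q ^ 3 \<noteq> 0"
    using assms by (auto intro: norm_power_lt_1)
  have "theta_j q (q ^ 3) * (J 2 (q ^ 3))\<^sup>2 = theta_j q ((q ^ 3)\<^sup>2) * theta_j (q ^ 3
      * q) ((q ^ 3)\<^sup>2) * J 1 (q ^ 3)"
    by (rule theta_j_dissect_product_2[OF q3])
  moreover have "(q ^ 3)\<^sup>2 = q ^ 6"
    by (simp add: power_mult[symmetric])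
  ultimately have "J 1 q * (J 6 q)\<^sup>2 = theta_j q (q ^ 6) * J 2 q * J 3 q"
    by (simp only: theta_j_cube[OF assms] t J_power) simp
  then show ?thesis
    using J_nonzero[OF assms(2)] by (simp add: field_simps)
qed

lemma theta_j_minus_sixth:
  assumes "q \<noteq> 0" "norm q < 1"
  shows "theta_j (- q) (q ^ 6) = (J 2 q)\<^sup>2 * J 3 q * J 12 q / (J 1 q * J 4 q * J 6 q)"
proof -
  have "theta_j (q\<^sup>2) ((q\<^sup>2) ^ 6) = J 1 (q\<^sup>2)
      * (J 6 (q\<^sup>2))\<^sup>2 / (J 2 (q\<^sup>2) * J 3 (q\<^sup>2))"
    by (rule theta_j_sixth) (use assms norm_power_lt_1 in auto)
  then have t: "theta_j (q\<^sup>2) ((q ^ 6)\<^sup>2) = J 2 q * (J 12 q)\<^sup>2 / (J 4 q * J 6 q)"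
    by (simp add: J_power power_mult[symmetric])
  have q6: "norm (q ^ 6) < 1"
    using assms by (auto intro: norm_power_lt_1)
  have "theta_j q (q ^ 6) * theta_j (- q) (q ^ 6) * J 2 (q ^ 6)
      = theta_j (q\<^sup>2) ((q ^ 6)\<^sup>2) * (J 1 (q ^ 6))\<^sup>2"
    by (rule theta_j_mult_minus[OF q6])
  then have "J 1 q * (J 6 q)\<^sup>2 / (J 2 q * J 3 q) * theta_j (- q) (q ^ 6) * J 12 q
      = J 2 q * (J 12 q)\<^sup>2 / (J 4 q * J 6 q) * (J 6 q)\<^sup>2"
    unfolding t theta_j_sixth[OF assms] J_power by simp
  then show ?thesis
    using J_nonzero[OF assms(2), of 1] J_nonzero[OF assms(2), of 2] J_nonzero[OF assms(2), of 3]
      J_nonzero[OF assms(2), of 4] J_nonzero[OF assms(2), of 6] J_nonzero[OF assms(2), of 12]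
    by (simp add: field_simps power2_eq_square)
qed

lemma qpoch_inf_quotient:
  assumes "q \<noteq> 0" "norm q < 1"
  shows "(qpoch_inf q q / qpoch_inf (- q) q)\<^sup>2 / 2 = (J 1 q) ^ 4 / (2 * (J 2 q)\<^sup>2)"
proof -
  have 1: "qpoch_inf q q = J 1 q"
    by (simp add: J_eq)
  have "J 1 q * qpoch_inf (- q) q = J 2 q"
    using qpoch_inf_mult_minus[OF assms(2), of q] by (simp add: J_eq)
  then have 2: "qpoch_inf (- q) q = J 2 q / J 1 q"
    using J_nonzero[OF assms(2), of 1] by (simp add: field_simps)
  have "(a / (b / a))\<^sup>2 / 2 = a ^ 4 / (2 * b\<^sup>2)" for a b :: complex
    by (simp add: power_divide power2_eq_square) (simp add: eval_nat_numeral mult_ac)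
  then show ?thesis
    unfolding 1 2 .
qed

text \<open>The residues 1, 7 and 3, 5 mod 8 from the two theta functions make up all odd exponents,
  that is \<open>(u; u^2)_inf = J_1/J_2\<close> at \<open>u\<close>.\<close>

lemma theta_j_eighth_mult:
  assumes "u \<noteq> 0" "norm u < 1"
  shows "theta_j u (u ^ 8) * theta_j (u ^ 3) (u ^ 8) * J 2 u = J 1 u * (J 8 u)\<^sup>2"
proof -
  have halve: "qpoch_inf x p = qpoch_inf x (p\<^sup>2) * qpoch_inf (p * x) (p\<^sup>2)" if "norm p < 1" for x p
    using qpoch_inf_dissect[OF that, of 2 x] by (simp add: numeral_2_eq_2)
  have n: "norm (u\<^sup>2) < 1" "norm (u ^ 4) < 1"
    using assms by (auto intro: norm_power_lt_1)
  have p: "(u\<^sup>2)\<^sup>2 = u ^ 4" "(u ^ 4)\<^sup>2 = u ^ 8" "u\<^sup>2 * u = u ^ 3" "u ^ 4 * u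
      = u ^ 5" "u ^ 4 * u ^ 3 = u ^ 7"
    by (simp_all add: power_mult[symmetric] power_add[symmetric] power_Suc2[symmetric])
  note 1 = halve[OF assms(2), of u]
  have 2: "qpoch_inf u (u\<^sup>2) = qpoch_inf u (u ^ 8) * qpoch_inf (u ^ 3) (u ^ 8)
      * qpoch_inf (u ^ 5) (u ^ 8) * qpoch_inf (u ^ 7) (u ^ 8)"
    using halve[OF n(1), of u] halve[OF n(2), of u] halve[OF n(2), of "u ^ 3"] unfolding p by simp
  have 3: "u ^ 8 / u = u ^ 7" "u ^ 8 / u ^ 3 = u ^ 5" "u * u = u\<^sup>2"
    using assms(1) by (simp_all add: eval_nat_numeral)
  show ?thesis
    unfolding theta_j_def 3 J_eq power_one_right 1 2 by (simp add: power2_eq_square)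
qed

text \<open>Each product collapses to one theta function: \<open>Y\<close> to
  \<open>j(-q^6; q^16)\<close> and \<open>X\<close> to \<open>q j(-q^14; q^16)\<close>, both times
  \<open>J_2/J_4\<close>. These are the two halves of \<open>j(q; q^4)\<close>, and of
  \<open>j(-q; q^4)\<close> with the sign of \<open>X\<close> reversed.\<close>

lemma euler_dissection:
  assumes q0: "q \<noteq> 0" and q1: "norm q < 1"
  defines "X \<equiv> q * (theta_j (q ^ 6) (q ^ 16) * theta_j (q ^ 28) (q ^ 32) / J 32 q)"
    and "Y \<equiv> theta_j (q\<^sup>2) (q ^ 16) * theta_j (q ^ 20) (q ^ 32) / J 32 q"
  shows "Y - X = J 1 q" and "Y + X = (J 2 q) ^ 3 / (J 1 q * J 4 q)"
proof -
  define u where "u = q\<^sup>2"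
  have u: "u \<noteq> 0" "norm u < 1"
    using q0 q1 by (auto simp: u_def intro: norm_power_lt_1)
  have uq: "q ^ 6 = u ^ 3" "q ^ 16 = u ^ 8" "q ^ 28 = u ^ 14" "q ^ 32 = u ^ 16" "q ^ 20 = u ^ 10"
    "q ^ 14 = u ^ 7" "J 32 q = J 16 u"
    by (simp_all add: u_def power_mult[symmetric] J_power)
  have J: "J 1 u = J 2 q" "J 2 u = J 4 q"
    by (simp_all add: u_def J_power)
  have u8: "norm (u ^ 8) < 1" "u ^ 8 \<noteq> 0" "u ^ 16 \<noteq> 0"
    using u by (auto intro: norm_power_lt_1)
  have n1: "theta_j u (u ^ 8) \<noteq> 0" "theta_j (u ^ 3) (u ^ 8) \<noteq> 0"
  proof -
    have c: "norm (u ^ 8) < norm (u ^ 1)" "norm (u ^ 8) < norm (u ^ 3)"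
      unfolding norm_power using u by (intro power_strict_decreasing; simp)+
    show "theta_j u (u ^ 8) \<noteq> 0"
      using c(1) u(2) by (intro theta_j_nonzero) simp_all
    show "theta_j (u ^ 3) (u ^ 8) \<noteq> 0"
      by (rule theta_j_nonzero[OF c(2) norm_power_lt_1[OF u(2)]]) simp
  qed
  have inv: "theta_j (u ^ 14) (u ^ 16) = theta_j (u\<^sup>2) (u ^ 16)" "theta_j (u ^ 10) (u ^ 16)
      = theta_j (u ^ 6) (u ^ 16)"
    "theta_j (- (u ^ 7)) (u ^ 8) = theta_j (- u) (u ^ 8)"
  proof -
    have "u ^ 16 / u\<^sup>2 = u ^ 14" "u ^ 16 / u ^ 6 = u ^ 10" "u ^ 8 / (- u) = - (u ^ 7)"
      using u(1) by (simp_all add: eval_nat_numeral)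
    then show "theta_j (u ^ 14) (u ^ 16) = theta_j (u\<^sup>2) (u ^ 16)" "theta_j (u ^ 10) (u ^ 16)
        = theta_j (u ^ 6) (u ^ 16)"
      "theta_j (- (u ^ 7)) (u ^ 8) = theta_j (- u) (u ^ 8)"
      using theta_j_inverse[of "u ^ 16" "u\<^sup>2"] theta_j_inverse[of "u ^ 16" "u ^ 6"] theta_j_inverse[of "u
          ^ 8" "- u"] u
      by auto
  qed
  have Jn: "J 2 u \<noteq> 0" "J 8 u \<noteq> 0" "J 16 u \<noteq> 0"
    using J_nonzero[OF u(2)] by auto
  have m: "theta_j (u ^ 3) (u ^ 8) * theta_j (- (u ^ 3)) (u ^ 8) * J 16 u
      = theta_j (u ^ 6) (u ^ 16) * (J 8 u)\<^sup>2"
    "theta_j u (u ^ 8) * theta_j (- u) (u ^ 8) * J 16 u = theta_j (u\<^sup>2) (u ^ 16) * (J 8 u)\<^sup>2"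
    using theta_j_mult_minus[OF u8(1), of "u ^ 3"] theta_j_mult_minus[OF u8(1), of u]
    by (simp_all add: power_mult[symmetric] J_power)
  note e8 = theta_j_eighth_mult[OF u]
  \<comment> \<open>Eliminates the auxiliary theta value \<open>a\<close> between a duplication
    formula and \<open>theta_j_eighth_mult\<close>.\<close>
  have alg: "b * t / j16 = j1 / j2 * c"
    if "a * c * j16 = t * j8\<^sup>2" "b * a * j2 = j1
        * j8\<^sup>2" "a \<noteq> 0" "j2 \<noteq> 0" "j8 \<noteq> 0" "j16 \<noteq> 0"
    for a b c t j1 j2 j8 j16 :: complex
  proof -
    have eq: "(b * t * j2) * (a * j8\<^sup>2) = (j1 * c * j16) * (a * j8\<^sup>2)"
    proof -
      have "(b * t * j2) * (a * j8\<^sup>2) = (b * a * j2) * (t * j8\<^sup>2)" by simp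
      also have "\<dots> = (j1 * j8\<^sup>2) * (a * c * j16)" using that by simp
      finally show ?thesis by (simp only: mult_ac)
    qed
    have "b * t * j2 = j1 * c * j16"
      by (rule iffD1[OF mult_right_cancel eq]) (use that(3,5) in simp)
    then show ?thesis
      using that by (simp add: field_simps)
  qed
  have Y: "Y = J 2 q / J 4 q * theta_j (- (q ^ 6)) (q ^ 16)"
    unfolding Y_def uq inv J[symmetric] u_def[symmetric] by (rule alg[OF m(1) e8 n1(2) Jn])
  have X: "X = q * (J 2 q / J 4 q * theta_j (- (q ^ 14)) (q ^ 16))"
    unfolding X_def uq inv J[symmetric]
    by (rule arg_cong[where f = "(*) q"], rule alg[OF m(2) _ n1(1) Jn]) (use e8 in \<open>simp add:
        mult_ac\<close>)
  have q4: "q ^ 4 \<noteq> 0" "norm (q ^ 4) < 1"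
    using q0 q1 by (auto intro: norm_power_lt_1)
  have Jq: "J 1 q \<noteq> 0" "J 2 q \<noteq> 0" "J 4 q \<noteq> 0"
    using J_nonzero[OF q1] by auto
  have e: "q ^ 4 * q\<^sup>2 = q ^ 6" "(q ^ 4) ^ 3 * q\<^sup>2 = q ^ 14" "(q ^ 4) ^ 4 = q ^ 16"
    by (simp_all add: power_mult[symmetric] power_add[symmetric])
  have "J 1 q * J 4 q / J 2 q = theta_j (- (q ^ 6)) (q ^ 16) - q * theta_j (- (q ^ 14)) (q ^ 16)"
    using theta_j_dissect_series[OF q4 q0] unfolding theta_j_fourth[OF q0 q1] e .
  then have "J 2 q / J 4 q * (J 1 q * J 4 q / J 2 q)
      = J 2 q / J 4 q * (theta_j (- (q ^ 6)) (q ^ 16) - q * theta_j (- (q ^ 14)) (q ^ 16))"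
    by (rule arg_cong)
  also have "\<dots> = Y - X"
    unfolding X Y by (simp only: right_diff_distrib mult_ac)
  finally have "J 2 q / J 4 q * (J 1 q * J 4 q / J 2 q) = Y - X" .
  then show "Y - X = J 1 q"
    using Jq by simp
  have "(J 2 q)\<^sup>2 / J 1 q = theta_j (- (q ^ 6)) (q ^ 16) + q * theta_j (- (q ^ 14)) (q ^ 16)"
    using theta_j_dissect_series[OF q4, of "- q"] q0
        unfolding theta_j_minus_fourth[OF q0 q1] power2_minus e by simp
  then have "J 2 q / J 4 q * ((J 2 q)\<^sup>2 / J 1 q)
      = J 2 q / J 4 q * (theta_j (- (q ^ 6)) (q ^ 16) + q * theta_j (- (q ^ 14)) (q ^ 16))"
    by (rule arg_cong)
  also have "\<dots> = Y + X"
    unfolding X Y by (simp only: distrib_left mult_ac)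
  finally have "J 2 q / J 4 q * ((J 2 q)\<^sup>2 / J 1 q) = Y + X" .
  then show "Y + X = (J 2 q) ^ 3 / (J 1 q * J 4 q)"
    by (simp add: power3_eq_cube power2_eq_square mult_ac)
qed

text \<open>At \<open>r = 1\<close> the two theta products of the claim coincide, since
  \<open>6 - 2 r = 2 + 2 r\<close> and \<open>28 - 4 r = 20 + 4 r\<close>.\<close>

lemma theta_j_product_r1:
  assumes q0: "q \<noteq> 0" and q1: "norm q < 1"
  shows "theta_j (q ^ 4) (q ^ 16) * theta_j (q ^ 24) (q ^ 32) / J 32 q = J 4 q"
proof -
  have a: "theta_j (q ^ 4) ((q ^ 4) ^ 4) = J 4 q * J 16 q / J 8 q"
    using theta_j_fourth[of "q ^ 4"] q0 q1 norm_power_lt_1[OF q1, of 4] by (simp add: J_power)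
  have b: "theta_j (q ^ 8) ((q ^ 8) ^ 4) = J 8 q * J 32 q / J 16 q"
    using theta_j_fourth[of "q ^ 8"] q0 q1 norm_power_lt_1[OF q1, of 8] by (simp add: J_power)
  have c: "theta_j (q ^ 24) (q ^ 32) = theta_j (q ^ 8) (q ^ 32)"
    using theta_j_inverse[of "q ^ 32" "q ^ 8"] q0 by (simp add: power_diff[symmetric])
  have d: "(q ^ 4) ^ 4 = q ^ 16" "(q ^ 8) ^ 4 = q ^ 32"
    by (simp_all add: power_mult[symmetric])
  show ?thesis
    unfolding c a[unfolded d] b[unfolded d]
    using J_nonzero[OF q1, of 8] J_nonzero[OF q1, of 16] J_nonzero[OF q1, of 32] by simp
qed

subsection \<open>The numerators of the characters\<close>

lemma theta_j_inverse':
  assumes "q \<noteq> 0" "x * y = q ^ n" "n > 0"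
  shows "theta_j x (q ^ n) = theta_j y (q ^ n)"
proof -
  have y: "y \<noteq> 0"
    using assms by auto
  then have "q ^ n / y = x"
    unfolding assms(2)[symmetric] by simp
  with y show ?thesis
    using theta_j_inverse[of "q ^ n" y] assms(1) by simp
qed

context
  fixes q z :: complex
  assumes q0: "q \<noteq> 0" and q1: "norm q < 1" and z0: "z \<noteq> 0"
begin

text \<open>Inversion in the nome \<open>q^48\<close> trades \<open>z^-8\<close> for
  \<open>z^8\<close> and exchanges the exponents \<open>6 r + 30\<close> and
  \<open>18 - 6 r\<close>; likewise for \<open>r = 1\<close> and \<open>r = 2\<close>.\<close>

lemma adm_numerator_0:
  "adm_numerator 0 q z = theta_j (- (q ^ 18 * z ^ 8)) (q ^ 48)
      - z\<^sup>2 * theta_j (- (q ^ 30 * z ^ 8)) (q ^ 48)"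
proof -
  have "theta_j (- (q ^ 30 * z powi (- 8))) (q ^ 48) = theta_j (- (q ^ 18 * z ^ 8)) (q ^ 48)"
    "theta_j (- (q ^ 18 * z powi (- 8))) (q ^ 48) = theta_j (- (q ^ 30 * z ^ 8)) (q ^ 48)"
    using q0 z0 by (auto intro!: theta_j_inverse' simp: power_int_minus field_simps power_add[symmetric])
  then show ?thesis
    unfolding adm_numerator_def by (simp add: power2_eq_square)
qed

lemma adm_numerator_1:
  "adm_numerator 1 q z = theta_j (- (q ^ 12 * z ^ 8)) (q ^ 48) - z ^ 4 * theta_j (- (q ^ 36 * z ^ 8)) (q ^ 48)"
proof -
  have "theta_j (- (q ^ 36 * z powi (- 8))) (q ^ 48) = theta_j (- (q ^ 12 * z ^ 8)) (q ^ 48)"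
    "theta_j (- (q ^ 12 * z powi (- 8))) (q ^ 48) = theta_j (- (q ^ 36 * z ^ 8)) (q ^ 48)"
    using q0 z0 by (auto intro!: theta_j_inverse' simp: power_int_minus field_simps power_add[symmetric])
  then show ?thesis
    unfolding adm_numerator_def by simp
qed

lemma adm_numerator_2:
  "adm_numerator 2 q z = theta_j (- (q ^ 6 * z ^ 8)) (q ^ 48) - z ^ 6 * theta_j (- (q ^ 42 * z ^ 8)) (q ^ 48)"
proof -
  have "theta_j (- (q ^ 42 * z powi (- 8))) (q ^ 48) = theta_j (- (q ^ 6 * z ^ 8)) (q ^ 48)"
    "theta_j (- (q ^ 6 * z powi (- 8))) (q ^ 48) = theta_j (- (q ^ 42 * z ^ 8)) (q ^ 48)"
    using q0 z0 by (auto intro!: theta_j_inverse' simp: power_int_minus field_simps power_add[symmetric])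
  then show ?thesis
    unfolding adm_numerator_def by simp
qed

lemma q_powers: "q ^ n \<noteq> 0" "n > 0 \<Longrightarrow> norm (q ^ n) < 1"
  using q0 q1 by (auto intro: norm_power_lt_1)

lemma theta_j_48: "theta_j (- (q ^ 54 * z ^ 8)) (q ^ 48)
    = theta_j (- (q ^ 6 * z ^ 8)) (q ^ 48) / (q ^ 6 * z ^ 8)"
proof -
  have "q ^ 48 * - (q ^ 6 * z ^ 8) = - (q ^ 54 * z ^ 8)"
    by (simp add: power_add[symmetric] mult.assoc[symmetric])
  then show ?thesis
    using theta_j_shift[of "q ^ 48" "- (q ^ 6 * z ^ 8)"] q_powers z0 q0 by simp
qed

text \<open>Parity dissections in the nome \<open>q^12\<close>. The argument \<open>q^9 z^4\<close>
  leads to the exponent 54, which the quasi-period \<open>q^48\<close> reduces to 6.\<close>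

lemma theta_j_12:
  "theta_j (q ^ 3 * z ^ 4) (q ^ 12) = theta_j (- (q ^ 18 * z ^ 8)) (q ^ 48)
      - q ^ 3 * z ^ 4 * theta_j (- (q ^ 42 * z ^ 8)) (q ^ 48)"
  "theta_j (q ^ 9 * z ^ 4) (q ^ 12) = theta_j (- (q ^ 30 * z ^ 8)) (q ^ 48)
      - q ^ 3 / z ^ 4 * theta_j (- (q ^ 6 * z ^ 8)) (q ^ 48)"
  "theta_j (- (q ^ 3 * z ^ 4)) (q ^ 12) = theta_j (- (q ^ 18 * z ^ 8)) (q ^ 48)
      + q ^ 3 * z ^ 4 * theta_j (- (q ^ 42 * z ^ 8)) (q ^ 48)"
  "theta_j (- (q ^ 9 * z ^ 4)) (q ^ 12) = theta_j (- (q ^ 30 * z ^ 8)) (q ^ 48)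
      + q ^ 3 / z ^ 4 * theta_j (- (q ^ 6 * z ^ 8)) (q ^ 48)"
  "theta_j (z ^ 4) (q ^ 12) = theta_j (- (q ^ 12 * z ^ 8)) (q ^ 48)
      - z ^ 4 * theta_j (- (q ^ 36 * z ^ 8)) (q ^ 48)"
proof -
  have e: "(q ^ 12) ^ 4 = q ^ 48" "(q ^ 12) ^ 3 = q ^ 36" "(z ^ 4)\<^sup>2
      = z ^ 8" "(q ^ 3 * z ^ 4)\<^sup>2 = q ^ 6 * z ^ 8"
    "(q ^ 9 * z ^ 4)\<^sup>2 = q ^ 18 * z ^ 8" "q ^ 12 * (q ^ 6 * z ^ 8)
        = q ^ 18 * z ^ 8" "q ^ 36 * (q ^ 6 * z ^ 8) = q ^ 42 * z ^ 8"
    "q ^ 12 * (q ^ 18 * z ^ 8) = q ^ 30 * z ^ 8" "q ^ 36 * (q ^ 18 * z ^ 8) = q ^ 54 * z ^ 8"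
    by (simp_all add: power_mult[symmetric] power_mult_distrib power_add[symmetric] mult.assoc[symmetric])
  have f: "q ^ 9 * z ^ 4 * (t / (q ^ 6 * z ^ 8)) = q ^ 3 / z ^ 4 * t" for t
  proof -
    have h: "q ^ 9 = q ^ 6 * q ^ 3" "z ^ 8 = z ^ 4 * z ^ 4" by (simp_all add: power_add[symmetric])
    have "a * b * c * (t / (a * (c * c))) = b / c * t" if "a \<noteq> 0" "c \<noteq> 0" for a b c :: complex
      using that by (simp add: field_simps)
    from this[of "q ^ 6" "z ^ 4" "q ^ 3"] show ?thesis
      unfolding h using q0 z0 by (simp only: power_not_zero simp_thms)
  qed
  note d = theta_j_dissect_series[of "q ^ 12", unfolded e, OF q_powers(1) q_powers(2)]
  show "theta_j (q ^ 3 * z ^ 4) (q ^ 12) = theta_j (- (q ^ 18 * z ^ 8)) (q ^ 48)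
      - q ^ 3 * z ^ 4 * theta_j (- (q ^ 42 * z ^ 8)) (q ^ 48)"
    using d[of "q ^ 3 * z ^ 4"] q0 z0 unfolding e by simp
  show "theta_j (q ^ 9 * z ^ 4) (q ^ 12) = theta_j (- (q ^ 30 * z ^ 8)) (q ^ 48)
      - q ^ 3 / z ^ 4 * theta_j (- (q ^ 6 * z ^ 8)) (q ^ 48)"
    using d[of "q ^ 9 * z ^ 4"] q0 z0 unfolding e theta_j_48 f by simp
  show "theta_j (- (q ^ 3 * z ^ 4)) (q ^ 12) = theta_j (- (q ^ 18 * z ^ 8)) (q ^ 48)
      + q ^ 3 * z ^ 4 * theta_j (- (q ^ 42 * z ^ 8)) (q ^ 48)"
    using d[of "- (q ^ 3 * z ^ 4)"] q0 z0 unfolding power2_minus e by simp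
  show "theta_j (- (q ^ 9 * z ^ 4)) (q ^ 12) = theta_j (- (q ^ 30 * z ^ 8)) (q ^ 48)
      + q ^ 3 / z ^ 4 * theta_j (- (q ^ 6 * z ^ 8)) (q ^ 48)"
    using d[of "- (q ^ 9 * z ^ 4)"] q0 z0 unfolding power2_minus e theta_j_48 mult_minus_left f by simp
  show "theta_j (z ^ 4) (q ^ 12) = theta_j (- (q ^ 12 * z ^ 8)) (q ^ 48)
      - z ^ 4 * theta_j (- (q ^ 36 * z ^ 8)) (q ^ 48)"
    using d[of "z ^ 4"] z0 unfolding e by simp
qed

lemma adm_numerator_1_eq: "adm_numerator 1 q z = theta_j (z ^ 4) (q ^ 12)"
  unfolding adm_numerator_1 theta_j_12(5) ..

text \<open>The weight \<open>q^3 / z^2\<close> is the one for which the four pieces of nome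
  \<open>q^48\<close> pair up as two parity dissections of nome \<open>q^12\<close>.\<close>

lemma adm_numerator_plus:
  "adm_numerator 0 q z + q ^ 3 / z\<^sup>2 * adm_numerator 2 q z
    = theta_j (q ^ 3 * z ^ 4) (q ^ 12) - z\<^sup>2 * theta_j (q ^ 9 * z ^ 4) (q ^ 12)"
proof -
  have "a - z\<^sup>2 * b + q ^ 3 / z\<^sup>2 * (c - z ^ 6 * d)
      = (a - q ^ 3 * z ^ 4 * d) - z\<^sup>2 * (b - q ^ 3 / z ^ 4 * c)" for a b c d
    using z0 by (simp add: field_simps eval_nat_numeral)
  then show ?thesis
    unfolding adm_numerator_0 adm_numerator_2 theta_j_12 .
qed

text \<open>The opposite sign negates the arguments of nome \<open>q^12\<close>. The two resulting
  functions are themselves the halves of a dissection, so a second regrouping leaves a single theta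
  function.\<close>

lemma adm_numerator_minus:
  "adm_numerator 0 q z - q ^ 3 / z\<^sup>2 * adm_numerator 2 q z = theta_j (z\<^sup>2) (q ^ 3)"
proof -
  have "a - z\<^sup>2 * b - q ^ 3 / z\<^sup>2 * (c - z ^ 6 * d)
      = (a + q ^ 3 * z ^ 4 * d) - z\<^sup>2 * (b + q ^ 3 / z ^ 4 * c)" for a b c d
    using z0 by (simp add: field_simps eval_nat_numeral)
  then have "adm_numerator 0 q z - q ^ 3 / z\<^sup>2 * adm_numerator 2 q z
      = theta_j (- (q ^ 3 * z ^ 4)) (q ^ 12) - z\<^sup>2 * theta_j (- (q ^ 9 * z ^ 4)) (q ^ 12)"
    unfolding adm_numerator_0 adm_numerator_2 theta_j_12 .
  also have "\<dots> = theta_j (z\<^sup>2) (q ^ 3)"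
  proof -
    have e: "q ^ 3 * (z\<^sup>2)\<^sup>2 = q ^ 3 * z ^ 4" "(q ^ 3) ^ 3 * (z\<^sup>2)\<^sup>2
        = q ^ 9 * z ^ 4" "(q ^ 3) ^ 4 = q ^ 12"
      by (simp_all add: power_mult[symmetric])
    show ?thesis
      using theta_j_dissect_series[OF q_powers(1) q_powers(2), of 3 "z\<^sup>2"] z0 unfolding e by simp
  qed
  finally show ?thesis .
qed

text \<open>Instances of the product formula for the arguments \<open>q z\<close> and
  \<open>q^2 z\<close>. Negating both flips the odd half; negating one of them, in either way, and
  adding cancels the odd half.\<close>

lemma theta_j_bilinear:
  "theta_j (q * z) (q ^ 3) * theta_j (q\<^sup>2 * z) (q ^ 3)
      = theta_j (- q\<^sup>2) (q ^ 6) * theta_j (- (q ^ 3 * z\<^sup>2)) (q ^ 6)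
      - q * z * theta_j (- q) (q ^ 6) * theta_j (- (q ^ 6 * z\<^sup>2)) (q ^ 6)" (is ?A)
  "theta_j (- (q * z)) (q ^ 3) * theta_j (- (q\<^sup>2 * z)) (q ^ 3)
      = theta_j (- q\<^sup>2) (q ^ 6) * theta_j (- (q ^ 3 * z\<^sup>2)) (q ^ 6)
      + q * z * theta_j (- q) (q ^ 6) * theta_j (- (q ^ 6 * z\<^sup>2)) (q ^ 6)" (is ?B)
  "theta_j (- (q * z)) (q ^ 3) * theta_j (q\<^sup>2 * z) (q ^ 3)
      + theta_j (- (q\<^sup>2 * z)) (q ^ 3) * theta_j (q * z) (q ^ 3)
    = 2 * J 2 q * theta_j (q ^ 3 * z\<^sup>2) (q ^ 6)" (is ?C)
proof -
  have e: "(q ^ 3)\<^sup>2 = q ^ 6" by (simp add: power_mult[symmetric])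
  have ab: "q * z * (q\<^sup>2 * z) = q ^ 3 * z\<^sup>2" "q ^ 3 * (q * z) / (q\<^sup>2 * z)
      = q\<^sup>2" "q ^ 3 * (q * z) * (q\<^sup>2 * z) = q ^ 6 * z\<^sup>2"
    "q ^ 6 * (q * z) / (q\<^sup>2 * z) = q ^ 5"
    using q0 z0 by (simp_all add: eval_nat_numeral)
  have a5: "theta_j (- (q ^ 5)) (q ^ 6) = theta_j (- q) (q ^ 6)"
    by (rule theta_j_inverse'[OF q0]) (simp_all add: eval_nat_numeral)
  have g: "theta_j (q\<^sup>2) (q ^ 6) = J 2 q"
    using theta_j_cube[OF q_powers(1) q_powers(2), of 2] by (simp add: power_mult[symmetric] J_power)
  note B = theta_j_mult_theta_j[OF q_powers(1) q_powers(2), of 3, unfolded e]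
  show ?A
    using B[of "q * z" "q\<^sup>2 * z"] q0 z0 unfolding ab a5 by (simp add: mult_ac)
  show ?B
    using B[of "- (q * z)" "- (q\<^sup>2 * z)"] q0 z0
    unfolding minus_mult_minus minus_divide_divide mult_minus_left mult_minus_right minus_minus ab a5
        by (simp add: mult_ac)
  show ?C
    using B[of "- (q * z)" "q\<^sup>2 * z"] B[of "q * z" "- (q\<^sup>2 * z)"] q0 z0
    unfolding minus_mult_minus mult_minus_left mult_minus_right minus_divide_left[symmetric]
        minus_divide_right[symmetric] minus_minus ab g
    by (simp add: mult_ac)
qed

lemma theta_j_plus_minus:
  "theta_j z (q ^ 3) * theta_j (- z) (q ^ 3) * J 6 q = theta_j (z\<^sup>2) (q ^ 6) * (J 3 q)\<^sup>2"
  using theta_j_mult_minus[OF q_powers(2), of 3 z] by (simp add: power_mult[symmetric] J_power)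

text \<open>The constants \<open>j(q^3; q^12)\<close> and \<open>j(q^9; q^12)\<close> of the product
  formula agree by inversion and factor out. What remains is the numerator of
  \<open>adm_numerator_plus\<close>.\<close>

lemma theta_j_mult_T:
  "theta_j (z\<^sup>2) (q ^ 6) * theta_j (- (q ^ 3 * z\<^sup>2)) (q ^ 6)
      = J 3 q * J 12 q / J 6 q * (theta_j (q ^ 3 * z ^ 4) (q ^ 12)
      - z\<^sup>2 * theta_j (q ^ 9 * z ^ 4) (q ^ 12))"
proof -
  have e: "(q ^ 6)\<^sup>2 = q ^ 12" by (simp add: power_mult[symmetric])
  have ab: "z\<^sup>2 * (q ^ 3 * z\<^sup>2) = q ^ 3 * z ^ 4" "q ^ 6 * z\<^sup>2 / (q ^ 3 * z\<^sup>2)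
      = q ^ 3" "q ^ 6 * z\<^sup>2 * (q ^ 3 * z\<^sup>2) = q ^ 9 * z ^ 4"
    "q ^ 12 * z\<^sup>2 / (q ^ 3 * z\<^sup>2) = q ^ 9"
    using q0 z0 by (simp_all add: eval_nat_numeral)
  have k: "theta_j (q ^ 9) (q ^ 12) = theta_j (q ^ 3) (q ^ 12)"
    by (rule theta_j_inverse'[OF q0]) (simp_all add: power_add[symmetric])
  have k': "theta_j (q ^ 3) (q ^ 12) = J 3 q * J 12 q / J 6 q"
    using theta_j_fourth[OF q_powers(1) q_powers(2), of 3] by (simp add: power_mult[symmetric] J_power)
  show ?thesis
    using theta_j_mult_theta_j[OF q_powers(1) q_powers(2), of 6 "z\<^sup>2" "- (q ^ 3
        * z\<^sup>2)", unfolded e] q0 z0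
    unfolding mult_minus_left mult_minus_right minus_divide_right[symmetric] minus_minus ab k k'
    by (simp add: algebra_simps)
qed

text \<open>A quasi-period takes \<open>- (q^6 z^2)\<close> to \<open>- z^2\<close> at the cost of
  \<open>z^2\<close>; then \<open>j(x) j(-x)\<close> applies and produces the numerator for
  \<open>r = 1\<close>.\<close>

lemma theta_j_mult_U:
  "z\<^sup>2 * (theta_j (z\<^sup>2) (q ^ 6) * theta_j (- (q ^ 6 * z\<^sup>2)) (q ^ 6)) * J 12 q
      = theta_j (z ^ 4) (q ^ 12) * (J 6 q)\<^sup>2"
proof -
  have "theta_j (- (q ^ 6 * z\<^sup>2)) (q ^ 6) = theta_j (- z\<^sup>2) (q ^ 6) / z\<^sup>2"
    using theta_j_shift[of "q ^ 6" "- z\<^sup>2"] q_powers(2)[of 6] q_powers(1)[of 6] z0 by simp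
  moreover have "theta_j (z\<^sup>2) (q ^ 6) * theta_j (- z\<^sup>2) (q ^ 6) * J 12 q
      = theta_j (z ^ 4) (q ^ 12) * (J 6 q)\<^sup>2"
    using theta_j_mult_minus[OF q_powers(2), of 6 "z\<^sup>2"] by (simp add: power_mult[symmetric] J_power)
  ultimately show ?thesis
    using z0 by simp
qed

end

section \<open>Quotients of the numerators by \<open>j(z; q)\<close>\<close>

context
  fixes q z :: complex
  assumes q0: "q \<noteq> 0" and z: "norm q < norm z" "norm z < 1"
begin

lemma annulus_norm_lt_1: "norm q < 1"
  using z by simp

lemma annulus_nonzero: "z \<noteq> 0" "theta_j z q \<noteq> 0"
  using z norm_ge_zero[of q] theta_j_nonzero[OF z] by auto

lemma beta_eq: "theta_j (- q\<^sup>2) (q ^ 6) = J 4 q * (J 6 q)\<^sup>2 / (J 2 q * J 12 q)"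
proof -
  have "q\<^sup>2 \<noteq> 0" "norm (q\<^sup>2) < 1"
    using q0 annulus_norm_lt_1 by (auto intro: norm_power_lt_1)
  from theta_j_minus_cube[OF this] show ?thesis
    by (simp add: power_mult[symmetric] J_power)
qed

text \<open>The factors of nome \<open>q^3\<close> at \<open>q z\<close> and \<open>q^2 z\<close>
  have the same even and odd halves for \<open>z\<close> and for \<open>-z\<close>, with opposite
  sign on the odd one. Sums and differences therefore isolate one half.\<close>

lemma theta_j_pm_cube:
  "theta_j z q * (J 3 q) ^ 3 = J 1 q * theta_j z (q ^ 3) * (theta_j (- q\<^sup>2) (q ^ 6)
      * theta_j (- (q ^ 3 * z\<^sup>2)) (q ^ 6) - q * z * theta_j (- q) (q ^ 6) * theta_j (- (q ^ 6
      * z\<^sup>2)) (q ^ 6))"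
  "theta_j (- z) q * (J 3 q) ^ 3 = J 1 q * theta_j (- z) (q ^ 3) * (theta_j (- q\<^sup>2) (q ^ 6)
      * theta_j (- (q ^ 3 * z\<^sup>2)) (q ^ 6) + q * z * theta_j (- q) (q ^ 6) * theta_j (- (q ^ 6
      * z\<^sup>2)) (q ^ 6))"
  using theta_j_dissect_product_3[OF annulus_norm_lt_1 q0, of z] theta_j_dissect_product_3[OF annulus_norm_lt_1
      q0, of "- z"]
  unfolding theta_j_bilinear[OF q0 annulus_norm_lt_1 annulus_nonzero(1), symmetric] by (simp_all add: mult_ac)

text \<open>In \<open>j(-z; q^3) j(z; q) + j(z; q^3) j(-z; q)\<close> only the even halves survive,
  which leads to \<open>theta_j_mult_T\<close>. The factor \<open>J_1^4 / (2 J_2^2)\<close> is kept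
  next to \<open>j(-z; q) / j(z; q)\<close> because together they are the sum of the Kronecker
  series.\<close>

lemma numerator_plus:
  "(J 1 q) ^ 3 * ((adm_numerator 0 q z + q ^ 3 / z\<^sup>2 * adm_numerator 2 q z) / theta_j z q)
    = (J 1 q)\<^sup>2 * J 2 q / (2 * J 4 q) * (theta_j (- z) (q ^ 3)
        + 2 * (J 2 q)\<^sup>2 / (J 1 q) ^ 4 * (theta_j z (q ^ 3) * ((J 1 q) ^ 4 / (2 * (J 2 q)\<^sup>2)
        * theta_j (- z) q / theta_j z q)))"
proof -
  let ?N = "adm_numerator 0 q z + q ^ 3 / z\<^sup>2 * adm_numerator 2 q z"
  let ?th = "theta_j z q" let ?tm = "theta_j (- z) q"
  have J: "J 1 q \<noteq> 0" "J 2 q \<noteq> 0" "J 3 q \<noteq> 0" "J 4 q \<noteq> 0" "J 6 q \<noteq> 0" "J 12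
      q \<noteq> 0"
    by (simp_all add: J_nonzero[OF annulus_norm_lt_1])
  have "(theta_j (- z) (q ^ 3) * ?th + theta_j z (q ^ 3) * ?tm) * (J 3 q) ^ 3 * J 6 q
      = (theta_j (- z) (q ^ 3) * (?th * (J 3 q) ^ 3) + theta_j z (q ^ 3) * (?tm * (J 3 q) ^ 3)) * J 6 q"
    by (simp add: algebra_simps)
  also have "\<dots> = 2 * J 1 q * theta_j (- q\<^sup>2) (q ^ 6) * theta_j (- (q ^ 3 * z\<^sup>2)) (q ^ 6)
      * (theta_j z (q ^ 3) * theta_j (- z) (q ^ 3) * J 6 q)"
    unfolding theta_j_pm_cube by (simp add: algebra_simps)
  also have "\<dots> = 2 * J 1 q * theta_j (- q\<^sup>2) (q ^ 6) * (J 3 q)\<^sup>2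
      * (theta_j (z\<^sup>2) (q ^ 6) * theta_j (- (q ^ 3 * z\<^sup>2)) (q ^ 6))"
    unfolding theta_j_plus_minus[OF q0 annulus_norm_lt_1 annulus_nonzero(1)] by (simp only: mult_ac)
  also have "\<dots> = 2 * J 1 q * theta_j (- q\<^sup>2) (q ^ 6) * (J 3 q)\<^sup>2 * (J 3 q
      * J 12 q / J 6 q * ?N)"
    unfolding theta_j_mult_T[OF q0 annulus_norm_lt_1 annulus_nonzero(1)] adm_numerator_plus[OF q0
        annulus_norm_lt_1 annulus_nonzero(1)] ..
  finally have "(theta_j (- z) (q ^ 3) * ?th + theta_j z (q ^ 3) * ?tm) * (J 3 q) ^ 3 * J 6 q
      = 2 * J 1 q * theta_j (- q\<^sup>2) (q ^ 6) * (J 3 q)\<^sup>2 * (J 3 q * J 12 q / J 6 q * ?N)" .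
  moreover have "N = j2 / (2 * j1 * j4) * S"
    if "S * j3 ^ 3 * j6 = 2 * j1 * (j4 * j6\<^sup>2 / (j2 * j12)) * j3\<^sup>2 * (j3 * j12 / j6 * N)"
      "j1 \<noteq> 0" "j2 \<noteq> 0" "j3 \<noteq> 0" "j4 \<noteq> 0" "j6 \<noteq> 0" "j12 \<noteq> 0" for S N
          j1 j2 j3 j4 j6 j12 :: complex
  proof -
    have "S * (j3 ^ 3 * j6) = (2 * j1 * j4 / j2 * N) * (j3 ^ 3 * j6)"
      using that by (simp add: power2_eq_square power3_eq_cube mult_ac)
    then have "S = 2 * j1 * j4 / j2 * N"
      using that by (metis mult_eq_0_iff mult_right_cancel power_not_zero)
    then show ?thesis
      using that by simp
  qed
  ultimately have "?N = J 2 q / (2 * J 1 q * J 4 q) * (theta_j (- z) (q ^ 3) * ?th + theta_j z (q ^ 3) * ?tm)"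
    unfolding beta_eq using J by blast
  then have "(J 1 q) ^ 3 * (?N / ?th) = (J 1 q) ^ 3 * (J 2 q / (2 * J 1 q * J 4 q) * (theta_j (- z) (q ^ 3)
      * ?th + theta_j z (q ^ 3) * ?tm) / ?th)"
    by (rule arg_cong)
  also have "\<dots> = (J 1 q)\<^sup>2 * J 2 q / (2 * J 4 q) * (theta_j (- z) (q ^ 3)
      + 2 * (J 2 q)\<^sup>2 / (J 1 q) ^ 4 * (theta_j z (q ^ 3) * ((J 1 q) ^ 4 / (2 * (J 2 q)\<^sup>2)
      * theta_j (- z) q / theta_j z q)))"
  proof -
    have "a ^ 3 * (b / (2 * a * d) * (X * t + Y * s) / t)
        = a\<^sup>2 * b / (2 * d) * (X + 2 * b\<^sup>2 / a ^ 4 * (Y * (a ^ 4 / (2 * b\<^sup>2) * s / t)))"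
      if "a \<noteq> 0" "b \<noteq> 0" "d \<noteq> 0" "t \<noteq> 0" for a b d t s X Y :: complex
      using that by (simp add: divide_simps) (simp add: eval_nat_numeral algebra_simps)
    from this[OF J(1) J(2) J(4) annulus_nonzero(2)] show ?thesis by simp
  qed
  finally show ?thesis .
qed

text \<open>The difference keeps the odd halves. These carry a factor \<open>z\<close>, and one more
  \<open>z\<close> is multiplied in to reach the \<open>z^2\<close> of
  \<open>theta_j_mult_U\<close>.\<close>

lemma numerator_middle:
  "(J 1 q) ^ 3 * (adm_numerator 1 q z / theta_j z q)
    = (J 1 q) ^ 3 * J 4 q / (2 * q * (J 2 q)\<^sup>2) * (z * (2 * (J 2 q)\<^sup>2 / (J 1 q) ^ 4
        * (theta_j z (q ^ 3) * ((J 1 q) ^ 4 / (2 * (J 2 q)\<^sup>2) * theta_j (- z) q / theta_j z q))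
        - theta_j (- z) (q ^ 3)))"
proof -
  let ?N = "adm_numerator 1 q z"
  let ?th = "theta_j z q" let ?tm = "theta_j (- z) q"
  have J: "J 1 q \<noteq> 0" "J 2 q \<noteq> 0" "J 3 q \<noteq> 0" "J 4 q \<noteq> 0" "J 6 q \<noteq> 0" "J 12
      q \<noteq> 0"
    by (simp_all add: J_nonzero[OF annulus_norm_lt_1])
  have "z * (theta_j z (q ^ 3) * ?tm - theta_j (- z) (q ^ 3) * ?th) * (J 3 q) ^ 3 * J 6 q * J 12 q
      = z * (theta_j z (q ^ 3) * (?tm * (J 3 q) ^ 3)
          - theta_j (- z) (q ^ 3) * (?th * (J 3 q) ^ 3)) * J 6 q * J 12 q"
    by (simp add: algebra_simps)
  also have "\<dots> = 2 * J 1 q * q * theta_j (- q) (q ^ 6) * z\<^sup>2 * theta_j (- (q ^ 6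
      * z\<^sup>2)) (q ^ 6) * J 12 q * (theta_j z (q ^ 3) * theta_j (- z) (q ^ 3) * J 6 q)"
    unfolding theta_j_pm_cube by (simp add: algebra_simps power2_eq_square)
  also have "\<dots> = 2 * J 1 q * q * theta_j (- q) (q ^ 6) * (J 3 q)\<^sup>2 * (z\<^sup>2
      * (theta_j (z\<^sup>2) (q ^ 6) * theta_j (- (q ^ 6 * z\<^sup>2)) (q ^ 6)) * J 12 q)"
    unfolding theta_j_plus_minus[OF q0 annulus_norm_lt_1 annulus_nonzero(1)] by (simp only: mult_ac)
  also have "\<dots> = 2 * J 1 q * q * theta_j (- q) (q ^ 6) * (J 3 q)\<^sup>2 * (?N * (J 6 q)\<^sup>2)"
    unfolding theta_j_mult_U[OF q0 annulus_norm_lt_1 annulus_nonzero(1)] adm_numerator_1_eq[OF q0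
        annulus_norm_lt_1 annulus_nonzero(1)] ..
  finally have "z * (theta_j z (q ^ 3) * ?tm - theta_j (- z) (q ^ 3) * ?th) * (J 3 q) ^ 3 * J 6 q * J 12 q
      = 2 * J 1 q * q * theta_j (- q) (q ^ 6) * (J 3 q)\<^sup>2 * (?N * (J 6 q)\<^sup>2)" .
  moreover have "N = j4 / (2 * p * j2\<^sup>2) * S"
    if "S * j3 ^ 3 * j6 * j12 = 2 * j1 * p * (j2\<^sup>2 * j3 * j12 / (j1 * j4 * j6)) * j3\<^sup>2 * (N
        * j6\<^sup>2)"
      "p \<noteq> 0" "j1 \<noteq> 0" "j2 \<noteq> 0" "j3 \<noteq> 0" "j4 \<noteq> 0" "j6 \<noteq> 0" "j12
          \<noteq> 0" for S N p j1 j2 j3 j4 j6 j12 :: complex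
  proof -
    have "S * (j3 ^ 3 * j6 * j12) = (2 * p * j2\<^sup>2 / j4 * N) * (j3 ^ 3 * j6 * j12)"
      using that by (simp add: power2_eq_square power3_eq_cube mult_ac)
    then have "S = 2 * p * j2\<^sup>2 / j4 * N"
      using that by (metis mult_eq_0_iff mult_right_cancel power_not_zero)
    then show ?thesis
      using that by simp
  qed
  ultimately have "?N = J 4 q / (2 * q * (J 2 q)\<^sup>2) * (z * (theta_j z (q ^ 3) * ?tm
      - theta_j (- z) (q ^ 3) * ?th))"
    unfolding theta_j_minus_sixth[OF q0 annulus_norm_lt_1] using J q0 by blast
  then have "(J 1 q) ^ 3 * (?N / ?th) = (J 1 q) ^ 3 * (J 4 q / (2 * q * (J 2 q)\<^sup>2) * (z
      * (theta_j z (q ^ 3) * ?tm - theta_j (- z) (q ^ 3) * ?th)) / ?th)"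
    by (rule arg_cong)
  also have "\<dots> = (J 1 q) ^ 3 * J 4 q / (2 * q * (J 2 q)\<^sup>2) * (z * (2
      * (J 2 q)\<^sup>2 / (J 1 q) ^ 4 * (theta_j z (q ^ 3) * ((J 1 q) ^ 4 / (2 * (J 2 q)\<^sup>2)
      * theta_j (- z) q / theta_j z q)) - theta_j (- z) (q ^ 3)))"
  proof -
    have "a ^ 3 * (d / (2 * p * b\<^sup>2) * (w * (Y * s - X * t)) / t)
        = a ^ 3 * d / (2 * p * b\<^sup>2) * (w * (2 * b\<^sup>2 / a ^ 4 * (Y * (a ^ 4 / (2 * b\<^sup>2)
            * s / t)) - X))"
      if "a \<noteq> 0" "b \<noteq> 0" "p \<noteq> 0" "t \<noteq> 0" for a b d p t s w X Y :: complex
      using that by (simp add: divide_simps)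
    from this[OF J(1) J(2) q0 annulus_nonzero(2)] show ?thesis by simp
  qed
  finally show ?thesis .
qed

text \<open>In the nome \<open>q^3\<close>, the factor \<open>j(z)\<close> of \<open>j(z^2)\<close>
  cancels against that of \<open>j(z; q)\<close>. What is left is \<open>j(-z)\<close> times a
  quotient with denominator \<open>j(q z) j(q^2 z)\<close>, which the third bilinear identity splits
  into two Kronecker quotients, at \<open>q z\<close> and at \<open>q^2 z\<close>.\<close>

lemma numerator_minus:
  "(J 1 q) ^ 3 * ((adm_numerator 0 q z - q ^ 3 / z\<^sup>2 * adm_numerator 2 q z) / theta_j z q)
    = (J 1 q)\<^sup>2 * J 6 q / (J 2 q * (J 3 q)\<^sup>2) * (theta_j (- z) (q ^ 3) *
       ((J 3 q) ^ 4 / (2 * (J 6 q)\<^sup>2) * theta_j (- (q * z)) (q ^ 3) / theta_j (q * z) (q ^ 3)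
        + (J 3 q) ^ 4 / (2 * (J 6 q)\<^sup>2) * theta_j (- (q\<^sup>2 * z)) (q ^ 3) / theta_j (q\<^sup>2
            * z) (q ^ 3)))"
proof -
  let ?N = "(adm_numerator 0 q z - q ^ 3 / z\<^sup>2 * adm_numerator 2 q z)"
  let ?V = "theta_j (q ^ 3 * z\<^sup>2) (q ^ 6)"
  let ?a = "theta_j (q * z) (q ^ 3)" let ?b = "theta_j (q\<^sup>2 * z) (q ^ 3)"
  let ?a' = "theta_j (- (q * z)) (q ^ 3)" let ?b' = "theta_j (- (q\<^sup>2 * z)) (q ^ 3)"
  have J: "J 1 q \<noteq> 0" "J 2 q \<noteq> 0" "J 3 q \<noteq> 0" "J 6 q \<noteq> 0"
    by (simp_all add: J_nonzero[OF annulus_norm_lt_1])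
  have th: "theta_j z q * (J 3 q) ^ 3 = theta_j z (q ^ 3) * ?a * ?b * J 1 q"
    by (rule theta_j_dissect_product_3[OF annulus_norm_lt_1 q0])
  \<comment> \<open>All three factors inherit nonvanishing from their product with
    \<open>J 1 q\<close>, as \<open>theta_j z q\<close> is nonzero on the annulus.\<close>
  then have ne: "theta_j z (q ^ 3) \<noteq> 0" "?a \<noteq> 0" "?b \<noteq> 0"
    using annulus_nonzero(2) J by auto
  have "?N * (J 6 q)\<^sup>2 = theta_j (z\<^sup>2) (q ^ 6) * ?V * J 3 q"
    using theta_j_dissect_product_2[of "q ^ 3" "z\<^sup>2"] q0 norm_power_lt_1[OF annulus_norm_lt_1, of 3]
    unfolding adm_numerator_minus[OF q0 annulus_norm_lt_1 annulus_nonzero(1)]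
        by (simp add: power_mult[symmetric] J_power)
  then have "?N * (J 6 q)\<^sup>2 * (J 3 q)\<^sup>2
      = theta_j (z\<^sup>2) (q ^ 6) * (J 3 q)\<^sup>2 * ?V * J 3 q"
    by simp
  also have "\<dots> = theta_j z (q ^ 3) * theta_j (- z) (q ^ 3) * J 6 q * ?V * J 3 q"
    unfolding theta_j_plus_minus[OF q0 annulus_norm_lt_1 annulus_nonzero(1), symmetric] ..
  finally have "(?N * (J 6 q * J 3 q)) * (J 6 q * J 3 q)
      = (theta_j z (q ^ 3) * theta_j (- z) (q ^ 3) * ?V) * (J 6 q * J 3 q)"
    by (simp only: power2_eq_square mult_ac)
  then have "?N * (J 6 q * J 3 q) = theta_j z (q ^ 3) * theta_j (- z) (q ^ 3) * ?V"
    by (rule iffD1[OF mult_right_cancel, rotated]) (use J in simp)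
  then have N: "?N = theta_j z (q ^ 3) * theta_j (- z) (q ^ 3) * ?V / (J 6 q * J 3 q)"
    by (rule eq_divide_imp[rotated]) (use J in simp)
  have th': "theta_j z q = theta_j z (q ^ 3) * ?a * ?b * J 1 q / (J 3 q) ^ 3"
    using th J by (simp add: field_simps)
  have V: "?a' * ?b + ?b' * ?a = 2 * J 2 q * ?V"
    by (rule theta_j_bilinear(3)[OF q0 annulus_norm_lt_1 annulus_nonzero(1)])
  have "j1 ^ 3 * (Y * X * V / (j6 * j3) / (Y * a * b * j1 / j3 ^ 3))
      = j1\<^sup>2 * j6 / (j2 * j3\<^sup>2) * (X * (j3 ^ 4 / (2 * j6\<^sup>2) * a' / a
          + j3 ^ 4 / (2 * j6\<^sup>2) * b' / b))"
    if "a' * b + b' * a = 2 * j2 * V" "Y \<noteq> 0" "a \<noteq> 0" "b \<noteq> 0" "j1 \<noteq> 0" "j2 \<noteq>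
        0" "j3 \<noteq> 0" "j6 \<noteq> 0"
    for X Y V a b a' b' j1 j2 j3 j6 :: complex
  proof -
    have "c * a' / a + c * b' / b = c * ((a' * b + b' * a) / (a * b))" for c
      using that(3,4) by (simp add: field_simps)
    then have "j3 ^ 4 / (2 * j6\<^sup>2) * a' / a + j3 ^ 4 / (2 * j6\<^sup>2) * b' / b
        = j3 ^ 4 / (2 * j6\<^sup>2) * ((a' * b + b' * a) / (a * b))" .
    also have "\<dots> = j3 ^ 4 / j6\<^sup>2 * (j2 * V / (a * b))"
      unfolding that(1) by simp
    finally have e: "j3 ^ 4 / (2 * j6\<^sup>2) * a' / a + j3 ^ 4 / (2 * j6\<^sup>2) * b' / b
        = j3 ^ 4 / j6\<^sup>2 * (j2 * V / (a * b))" .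
    show ?thesis
      unfolding e using that(2-) by (simp add: divide_simps eval_nat_numeral)
  qed
  from this[OF V ne J] show ?thesis
    unfolding N th' .
qed

end

subsection \<open>The coefficients of the characters\<close>

definition coeff_f3 :: "complex \<Rightarrow> int \<Rightarrow> complex" where
  "coeff_f3 q = conv (theta_coeff (q ^ 3)) (kronecker_coeff q)"

text \<open>The powers of \<open>q\<close> and \<open>q^2\<close> come from evaluating the Kronecker
  series of nome \<open>q^3\<close> at \<open>q z\<close> and \<open>q^2 z\<close>.\<close>

definition coeff_euler :: "complex \<Rightarrow> int \<Rightarrow> complex" where
  "coeff_euler q = conv (\<lambda>n. (q ^ 3) powi tri n)
     (\<lambda>k. kronecker_coeff (q ^ 3) k * q powi k + kronecker_coeff (q ^ 3) k * (q\<^sup>2) powi k)"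

definition coeff_plus :: "complex \<Rightarrow> int \<Rightarrow> complex" where
  "coeff_plus q k = J 2 q / (2 * J 1 q * J 4 q) * ((q ^ 3) powi tri k
      + 2 * (J 2 q)\<^sup>2 / (J 1 q) ^ 4 * coeff_f3 q k)"

definition coeff_minus :: "complex \<Rightarrow> int \<Rightarrow> complex" where
  "coeff_minus q k = J 6 q / (J 1 q * J 2 q * (J 3 q)\<^sup>2) * coeff_euler q k"

definition coeff_middle :: "complex \<Rightarrow> int \<Rightarrow> complex" where
  "coeff_middle q k = J 4 q / (2 * q * (J 2 q)\<^sup>2) * (2 * (J 2 q)\<^sup>2 / (J 1 q) ^ 4 * coeff_f3 q k
      - (q ^ 3) powi tri k)"

context
  fixes q :: complex
  assumes q0: "q \<noteq> 0" and q1: "norm q < 1"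
begin

lemma cube_in_disc: "q ^ 3 \<noteq> 0" "norm (q ^ 3) < 1"
  using q0 q1 by (auto intro: norm_power_lt_1)

text \<open>Write \<open>1/(1 + q^-k) = q^k - q^(2k)/(1 + q^k)\<close>. The first part sums to
  \<open>j(q; q^3) = (q)_inf\<close>; the second is half of Watson's sum, because
  \<open>3 tri k + 2 k = tri k + k + k^2\<close>.\<close>

lemma coeff_f3_0: "coeff_f3 q 0 = J 1 q * (1 - mock_f3 q / 2)"
proof -
  have "((\<lambda>k. theta_coeff (q ^ 3) k * q powi k) has_sum J 1 q) UNIV"
    using jacobi_triple_product[OF cube_in_disc q0] by (simp add: has_laurent_def theta_j_cube[OF q0 q1])
  from has_sum_diff[OF this has_sum_cmult_right[OF watson_has_sum[OF q0 q1], of "1 / 2"]]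
  have "((\<lambda>k. theta_coeff (q ^ 3) k * q powi k
      - 1 / 2 * (watson_coeff q k * q powi k\<^sup>2)) has_sum J 1 q * (1 - mock_f3 q / 2)) UNIV"
    by (simp add: J_eq algebra_simps)
  moreover have "theta_coeff (q ^ 3) k * q powi k - 1 / 2 * (watson_coeff q k * q powi k\<^sup>2)
      = theta_coeff (q ^ 3) k * kronecker_coeff q (0 - k)" for k
  proof -
    have e: "tri k + k + k\<^sup>2 = 3 * tri k + 2 * k"
      using double_tri[of k] by (simp add: power2_eq_square algebra_simps)
    have q3k: "(q ^ 3) powi tri k = q powi (3 * tri k)"
      by (simp add: power_int_mult)
    have "q powi tri k * q powi k * q powi k\<^sup>2 = q powi (3 * tri k) * q powi k * q powi k"
      unfolding power_int_add[symmetric, OF disjI1, OF q0] e by (simp add: add.assoc)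
    then have w: "1 / 2 * (watson_coeff q k * q powi k\<^sup>2)
        = theta_coeff (q ^ 3) k * q powi k * (q powi k / (1 + q powi k))"
      unfolding watson_coeff_def theta_coeff_def q3k by (simp add: mult_ac)
    have ne: "1 + q powi k \<noteq> 0" "1 + q powi (- k) \<noteq> 0" "q powi k \<noteq> 0"
      using one_plus_powi_nonzero[OF q0 q1] q0 by auto
    have "q powi k - q powi k * (q powi k / (1 + q powi k)) = 1 / (1 + q powi (- k))"
      using ne by (simp add: power_int_minus field_simps)
    then have "theta_coeff (q ^ 3) k * (q powi k - q powi k * (q powi k / (1 + q powi k)))
        = theta_coeff (q ^ 3) k * (1 / (1 + q powi (- k)))"
      by simp
    then show ?thesis
      unfolding w kronecker_coeff_def by (simp add: right_diff_distrib mult.assoc)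
  qed
  ultimately have "((\<lambda>k. theta_coeff (q ^ 3) k * kronecker_coeff q (0 - k))
      has_sum J 1 q * (1 - mock_f3 q / 2)) UNIV"
    by simp
  then show ?thesis
    unfolding coeff_f3_def conv_def by (rule infsumI)
qed

context
  fixes z :: complex
  assumes z: "norm q < norm z" "norm z < 1"
begin

lemma has_laurent_theta:
  "has_laurent (theta_coeff (q ^ 3)) z (theta_j z (q ^ 3))"
  "has_laurent (\<lambda>n. (q ^ 3) powi tri n) z (theta_j (- z) (q ^ 3))"
  using jacobi_triple_product[OF cube_in_disc annulus_nonzero(1)[OF q0 z]] theta_j_minus_has_sum[OF
      cube_in_disc annulus_nonzero(1)[OF q0 z]] by (simp_all add: has_laurent_def)

lemma has_laurent_coeff_f3:
  "has_laurent (coeff_f3 q) z (theta_j z (q ^ 3) * ((J 1 q) ^ 4 / (2 * (J 2 q)\<^sup>2)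
      * theta_j (- z) q / theta_j z q))"
  unfolding coeff_f3_def
  by (rule has_laurent_mult[OF has_laurent_theta(1) kronecker_has_laurent[OF q0 q1 z, unfolded
      qpoch_inf_quotient[OF q0 q1]] annulus_nonzero(1)[OF q0 z]])

text \<open>If \<open>z\<close> lies in the annulus of \<open>q\<close>, then \<open>q z\<close> and
  \<open>q^2 z\<close> lie in that of \<open>q^3\<close>, so both Kronecker expansions are valid at
  the same \<open>z\<close>.\<close>

lemma has_laurent_kronecker_sum:
  "has_laurent (\<lambda>k. kronecker_coeff (q ^ 3) k * q powi k
      + kronecker_coeff (q ^ 3) k * (q\<^sup>2) powi k) z
    ((J 3 q) ^ 4 / (2 * (J 6 q)\<^sup>2) * theta_j (- (q * z)) (q ^ 3) / theta_j (q * z) (q ^ 3)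
      + (J 3 q) ^ 4 / (2 * (J 6 q)\<^sup>2) * theta_j (- (q\<^sup>2 * z)) (q ^ 3) / theta_j (q\<^sup>2
          * z) (q ^ 3))"
proof -
  have c: "(qpoch_inf (q ^ 3) (q ^ 3) / qpoch_inf (- (q ^ 3)) (q ^ 3))\<^sup>2 / 2
      = (J 3 q) ^ 4 / (2 * (J 6 q)\<^sup>2)"
    unfolding qpoch_inf_quotient[OF cube_in_disc] J_power by simp
  have nq: "norm q > 0" using q0 by simp
  have sq: "norm q * norm q < norm z" "norm q * norm q < 1"
    using mult_strict_right_mono[OF q1 nq] z q1 by auto
  have lt: "norm q * (norm q * norm q) < norm q * norm z" "norm q * (norm q * norm q) < norm q * norm q
      * norm z"
    using mult_strict_left_mono[OF sq(1) nq] mult_strict_left_mono[OF z(1), of "norm q * norm q"] nq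
        by (simp_all add: mult.assoc)
  have le: "norm q * norm z < 1" "norm q * norm q * norm z < 1"
    using mult_strict_mono[OF q1 z(2)] mult_strict_mono[OF sq(2) z(2)] nq by auto
  have a: "norm (q ^ 3) < norm (q * z)" "norm (q * z) < 1"
    "norm (q ^ 3) < norm (q\<^sup>2 * z)" "norm (q\<^sup>2 * z) < 1"
    using lt le by (simp_all add: norm_mult norm_power power3_eq_cube power2_eq_square mult.assoc)
  show ?thesis
    by (intro has_laurent_add has_laurent_scale kronecker_has_laurent[OF cube_in_disc a(1,2), unfolded c]
        kronecker_has_laurent[OF cube_in_disc a(3,4), unfolded c])
qed

lemma coeff_euler_laurent:
  "has_laurent (coeff_euler q) z (theta_j (- z) (q ^ 3) *
    ((J 3 q) ^ 4 / (2 * (J 6 q)\<^sup>2) * theta_j (- (q * z)) (q ^ 3) / theta_j (q * z) (q ^ 3)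
      + (J 3 q) ^ 4 / (2 * (J 6 q)\<^sup>2) * theta_j (- (q\<^sup>2 * z)) (q ^ 3) / theta_j (q\<^sup>2
          * z) (q ^ 3)))"
  "((\<lambda>k. (q ^ 3) powi tri k * (kronecker_coeff (q ^ 3) (n - k) * q powi (n - k)
      + kronecker_coeff (q ^ 3) (n - k) * (q\<^sup>2) powi (n - k)))
    has_sum coeff_euler q n) UNIV"
  unfolding coeff_euler_def
  by (rule has_laurent_mult[OF has_laurent_theta(2) has_laurent_kronecker_sum annulus_nonzero(1)[OF q0 z]],
      rule conv_has_sum[OF has_laurent_theta(2) has_laurent_kronecker_sum annulus_nonzero(1)[OF q0 z]])

lemma coeff_plus_laurent:
  "has_laurent (coeff_plus q) z ((adm_numerator 0 q z + q ^ 3 / z\<^sup>2 * adm_numerator 2 q z) / theta_j z q)"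
proof -
  have J: "J 1 q \<noteq> 0" by (simp add: J_nonzero[OF q1])
  have c: "J 2 q / (2 * J 1 q * J 4 q) = 1 / (J 1 q) ^ 3 * ((J 1 q)\<^sup>2 * J 2 q / (2 * J 4 q))"
    using J by (simp add: power2_eq_square power3_eq_cube)
  have "(adm_numerator 0 q z + q ^ 3 / z\<^sup>2 * adm_numerator 2 q z) / theta_j z q
      = 1 / (J 1 q) ^ 3 * ((J 1 q) ^ 3 * ((adm_numerator 0 q z
          + q ^ 3 / z\<^sup>2 * adm_numerator 2 q z) / theta_j z q))"
    using J by simp
  then have "(adm_numerator 0 q z + q ^ 3 / z\<^sup>2 * adm_numerator 2 q z) / theta_j z q
      = J 2 q / (2 * J 1 q * J 4 q) * (theta_j (- z) (q ^ 3) + 2 * (J 2 q)\<^sup>2 / (J 1 q) ^ 4 *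
        (theta_j z (q ^ 3) * ((J 1 q) ^ 4 / (2 * (J 2 q)\<^sup>2) * theta_j (- z) q / theta_j z q)))"
    unfolding numerator_plus[OF q0 z] c unfolding mult.assoc .
  then show ?thesis
    unfolding coeff_plus_def
    by (simp only:) (intro has_laurent_cmult has_laurent_add has_laurent_theta has_laurent_coeff_f3)
qed

lemma coeff_minus_laurent:
  "has_laurent (coeff_minus q) z ((adm_numerator 0 q z
      - q ^ 3 / z\<^sup>2 * adm_numerator 2 q z) / theta_j z q)"
proof -
  let ?S = "(J 3 q) ^ 4 / (2 * (J 6 q)\<^sup>2) * theta_j (- (q * z)) (q ^ 3) / theta_j (q * z) (q ^ 3)
      + (J 3 q) ^ 4 / (2 * (J 6 q)\<^sup>2) * theta_j (- (q\<^sup>2 * z)) (q ^ 3) / theta_j (q\<^sup>2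
          * z) (q ^ 3)"
  have J: "J 1 q \<noteq> 0" by (simp add: J_nonzero[OF q1])
  have c: "J 6 q / (J 1 q * J 2 q * (J 3 q)\<^sup>2)
      = 1 / (J 1 q) ^ 3 * ((J 1 q)\<^sup>2 * J 6 q / (J 2 q * (J 3 q)\<^sup>2))"
    using J by (simp add: power2_eq_square power3_eq_cube mult_ac)
  have "(adm_numerator 0 q z - q ^ 3 / z\<^sup>2 * adm_numerator 2 q z) / theta_j z q
      = 1 / (J 1 q) ^ 3 * ((J 1 q) ^ 3 * ((adm_numerator 0 q z
          - q ^ 3 / z\<^sup>2 * adm_numerator 2 q z) / theta_j z q))"
    using J by simp
  then have "(adm_numerator 0 q z - q ^ 3 / z\<^sup>2 * adm_numerator 2 q z) / theta_j z q
      = J 6 q / (J 1 q * J 2 q * (J 3 q)\<^sup>2) * (theta_j (- z) (q ^ 3) * ?S)"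
    unfolding numerator_minus[OF q0 z] c unfolding mult.assoc .
  then show ?thesis
    unfolding coeff_minus_def by (simp only:) (intro has_laurent_cmult coeff_euler_laurent(1))
qed

text \<open>The factor \<open>z\<close> in \<open>numerator_middle\<close> shifts the index by 1, so
  the coefficient wanted for \<open>r = 1\<close> is \<open>coeff_middle q 0\<close>.\<close>

lemma coeff_middle_laurent:
  "has_laurent (\<lambda>k. coeff_middle q (k - 1)) z (adm_numerator 1 q z / theta_j z q)"
proof -
  have J: "J 1 q \<noteq> 0" by (simp add: J_nonzero[OF q1])
  have c: "J 4 q / (2 * q * (J 2 q)\<^sup>2) = 1 / (J 1 q) ^ 3 * ((J 1 q) ^ 3 * J 4 q / (2 * q
      * (J 2 q)\<^sup>2))"
    using J by simp
  have "adm_numerator 1 q z / theta_j z q = 1 / (J 1 q) ^ 3 * ((J 1 q) ^ 3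
      * (adm_numerator 1 q z / theta_j z q))"
    using J by simp
  also have "\<dots> = z powi 1 * (J 4 q / (2 * q * (J 2 q)\<^sup>2) * (2 * (J 2 q)\<^sup>2 / (J 1 q) ^ 4 *
        (theta_j z (q ^ 3) * ((J 1 q) ^ 4 / (2 * (J 2 q)\<^sup>2) * theta_j (- z) q / theta_j z q))
            - theta_j (- z) (q ^ 3)))"
    unfolding numerator_middle[OF q0 z] c power_int_1_right by (simp only: mult_ac)
  finally show ?thesis
    unfolding coeff_middle_def
    by (simp only:) (intro has_laurent_shift has_laurent_cmult has_laurent_diff has_laurent_theta
        has_laurent_coeff_f3 annulus_nonzero(1)[OF q0 z])
qed

lemma numerator_0_laurent:
  "has_laurent (\<lambda>k. 1 / 2 * (coeff_plus q k + coeff_minus q k)) z (adm_numerator 0 q z / theta_j z q)"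
proof -
  have "adm_numerator 0 q z / theta_j z q
      = 1 / 2 * ((adm_numerator 0 q z + q ^ 3 / z\<^sup>2 * adm_numerator 2 q z) / theta_j z q
          + (adm_numerator 0 q z - q ^ 3 / z\<^sup>2 * adm_numerator 2 q z) / theta_j z q)"
    by (simp add: add_divide_distrib diff_divide_distrib)
  then show ?thesis
    by (simp only:) (intro has_laurent_cmult has_laurent_add coeff_plus_laurent coeff_minus_laurent)
qed

text \<open>Undoing the weight \<open>q^3 / z^2\<close> shifts the index by 2, so the coefficients
  wanted for \<open>r = 2\<close> are again those at 0.\<close>

lemma numerator_2_laurent:
  "has_laurent (\<lambda>k. 1 / (2 * q ^ 3) * (coeff_plus q (k - 2) - coeff_minus q (k
      - 2))) z (adm_numerator 2 q z / theta_j z q)"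
proof -
  have "n / t = z powi 2 * (1 / (2 * q ^ 3) * ((m + q ^ 3 / z\<^sup>2 * n) / t - (m
      - q ^ 3 / z\<^sup>2 * n) / t))" for m n t
    using q0 annulus_nonzero(1)[OF q0 z] by (simp add: diff_divide_distrib[symmetric])
  from this[of "adm_numerator 2 q z" "theta_j z q" "adm_numerator 0 q z"] show ?thesis
    by (simp only:) (intro has_laurent_shift[where a
        = "\<lambda>k. 1 / (2 * q ^ 3) * (coeff_plus q k - coeff_minus q k)"]
        has_laurent_cmult has_laurent_diff coeff_plus_laurent coeff_minus_laurent annulus_nonzero(1)[OF q0 z])
qed

end

text \<open>The Kronecker-type factor \<open>b\<close> is even, so averaging over \<open>k\<close> and
    \<open>-k\<close> cancels its denominator \<open>1 + q\<^sup>3\<^sup>k\<close>.\<close>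

lemma coeff_euler_0: "coeff_euler q 0 = J 2 q * (J 3 q)\<^sup>2 / (J 1 q * J 6 q)"
proof -
  define b where "b k = kronecker_coeff (q ^ 3) k * q powi k
      + kronecker_coeff (q ^ 3) k * (q\<^sup>2) powi k" for k
  let ?t = "\<lambda>k. (q ^ 3) powi tri k * b (0 - k)"
  have b_minus: "b (- k) = b k" for k
  proof -
    have pw: "(q ^ 3) powi k = q powi k * q powi k * q powi k" "(q\<^sup>2) powi k = q powi k * q powi k"
      "q powi (- k) = inverse (q powi k)" for k
      by (simp_all add: power_int_minus power_int_mult_distrib power2_eq_square power3_eq_cube)
    have alg: "1 / (1 + inverse x * inverse x * inverse x) * inverse x + 1 / (1
        + inverse x * inverse x * inverse x) * (inverse x * inverse x)
        = 1 / (1 + x * x * x) * x + 1 / (1 + x * x * x) * (x * x)"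
      if "x \<noteq> 0" "1 + x * x * x \<noteq> 0" for x :: complex
    proof -
      have "1 + inverse x * inverse x * inverse x = (1 + x * x * x) / (x * x * x)"
        using that(1) by (simp add: field_simps)
      then show ?thesis using that by (simp add: field_simps)
    qed
    show ?thesis
      unfolding b_def kronecker_coeff_def pw
      by (rule alg) (use q0 one_plus_powi_nonzero[OF cube_in_disc, of k] in \<open>simp_all add: pw\<close>)
  qed
  \<comment> \<open>A sample point of the annulus, used to obtain convergence of the convolution;
    the coefficients do not depend on it.\<close>
  define z where "z = complex_of_real ((norm q + 1) / 2)"
  have "norm q < norm z" "norm z < 1"
    using q1 norm_ge_zero[of q] unfolding z_def norm_of_real by auto
  from coeff_euler_laurent(2)[OF this, of 0]
  have s: "(?t has_sum coeff_euler q 0) UNIV"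
    unfolding b_def .
  then have "((\<lambda>k. ?t (- k)) has_sum coeff_euler q 0) UNIV"
    by (rule iffD1[OF has_sum_reindex_bij_witness[of _ uminus uminus], rotated -1]) auto
  from has_sum_add[OF s this]
  have "((\<lambda>k. ?t k + ?t (- k)) has_sum coeff_euler q 0 + coeff_euler q 0) UNIV" .
  moreover have "?t k + ?t (- k) = (q ^ 3) powi tri k * q powi k
      + (q ^ 3) powi tri k * (q\<^sup>2) powi k" for k
  proof -
    have "?t k + ?t (- k) = (q ^ 3) powi tri k * (b k * (1 + (q ^ 3) powi k))"
      using q0 by (simp add: b_minus tri_uminus power_int_add algebra_simps)
    also have "b k * (1 + (q ^ 3) powi k) = q powi k + (q\<^sup>2) powi k"
      using one_plus_powi_nonzero[OF cube_in_disc, of k]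
          unfolding b_def kronecker_coeff_def by (simp add: add_divide_distrib[symmetric])
    finally show ?thesis by (simp add: distrib_left)
  qed
  ultimately have "((\<lambda>k. (q ^ 3) powi tri k * q powi k
      + (q ^ 3) powi tri k * (q\<^sup>2) powi k) has_sum coeff_euler q 0 + coeff_euler q 0) UNIV"
    by simp
  moreover have "((\<lambda>k. (q ^ 3) powi tri k * q powi k + (q ^ 3) powi tri k * (q\<^sup>2) powi k)
      has_sum theta_j (- q) (q ^ 3) + theta_j (- q\<^sup>2) (q ^ 3)) UNIV"
    using q0 by (intro has_sum_add theta_j_minus_has_sum cube_in_disc) auto
  ultimately have "coeff_euler q 0 + coeff_euler q 0 = theta_j (- q) (q ^ 3) + theta_j (- q\<^sup>2) (q ^ 3)"
    by (rule has_sum_unique)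
  also have "theta_j (- q\<^sup>2) (q ^ 3) = theta_j (- q) (q ^ 3)"
    by (rule theta_j_inverse'[OF q0]) (simp_all add: eval_nat_numeral)
  finally have "2 * coeff_euler q 0 = 2 * theta_j (- q) (q ^ 3)"
    by (simp only: mult_2)
  then have "coeff_euler q 0 = theta_j (- q) (q ^ 3)"
    by (rule iffD1[OF mult_left_cancel, rotated]) simp
  then show ?thesis
    unfolding theta_j_minus_cube[OF q0 q1] .
qed

lemma coeff_values:
  "(J 1 q) ^ 3 * coeff_plus q 0 = (J 1 q)\<^sup>2 * J 2 q / (2 * J 4 q)
      + (J 2 q) ^ 3 / (J 1 q * J 4 q) * (1 - mock_f3 q / 2)"
  "(J 1 q) ^ 3 * coeff_minus q 0 = J 1 q"
  "(J 1 q) ^ 3 * coeff_middle q 0 = J 4 q / q * (1 - mock_f3 q / 2)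
      - (J 1 q) ^ 3 * J 4 q / (2 * q * (J 2 q)\<^sup>2)"
proof -
  have J: "J 1 q \<noteq> 0" "J 2 q \<noteq> 0" "J 3 q \<noteq> 0" "J 4 q \<noteq> 0" "J 6 q \<noteq> 0"
    by (simp_all add: J_nonzero[OF q1])
  have "a ^ 3 * (b / (2 * a * d) * (1 + 2 * b\<^sup>2 / a ^ 4 * (a * h)))
      = a\<^sup>2 * b / (2 * d) + b ^ 3 / (a * d) * h"
    if "a \<noteq> 0" "d \<noteq> 0" for a b d h :: complex
    using that by (simp add: divide_simps) (simp add: eval_nat_numeral algebra_simps)
  from this[OF J(1) J(4)]
  show "(J 1 q) ^ 3 * coeff_plus q 0 = (J 1 q)\<^sup>2 * J 2 q / (2 * J 4 q)
      + (J 2 q) ^ 3 / (J 1 q * J 4 q) * (1 - mock_f3 q / 2)"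
    unfolding coeff_plus_def coeff_f3_0 by simp
  have "a ^ 3 * (e / (a * b * c\<^sup>2) * (b * c\<^sup>2 / (a * e))) = a"
    if "a \<noteq> 0" "b \<noteq> 0" "c \<noteq> 0" "e \<noteq> 0" for a b c e :: complex
    using that by (simp add: eval_nat_numeral)
  from this[OF J(1) J(2) J(3) J(5)]
  show "(J 1 q) ^ 3 * coeff_minus q 0 = J 1 q"
    unfolding coeff_minus_def coeff_euler_0 by simp
  have "a ^ 3 * (d / (2 * p * b\<^sup>2) * (2 * b\<^sup>2 / a ^ 4 * (a * h) - 1))
      = d / p * h - a ^ 3 * d / (2 * p * b\<^sup>2)"
    if "a \<noteq> 0" "b \<noteq> 0" "p \<noteq> 0" for a b d p h :: complex
    using that by (simp add: divide_simps) (simp add: eval_nat_numeral algebra_simps)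
  from this[OF J(1) J(2) q0]
  show "(J 1 q) ^ 3 * coeff_middle q 0 = J 4 q / q * (1 - mock_f3 q / 2)
      - (J 1 q) ^ 3 * J 4 q / (2 * q * (J 2 q)\<^sup>2)"
    unfolding coeff_middle_def coeff_f3_0 by simp
qed

end

section \<open>Evaluation of the three cases\<close>

theorem theorem2p9:
  fixes \<tau> q :: complex and r :: nat
  assumes "Im \<tau> > 0"
    and "q = nome \<tau>"
    and "r \<in> {0, 1, 2}"
  shows "(qpoch_inf q q) ^ 3 * string_fun_norm 3 8 1 (2 * r + 1) \<tau> =
      Psi38 (2 * r + 1) q
      - q powi (1 - 2 * int r)
          * (theta_j (q powi (6 - 2 * int r)) (q ^ 16) * theta_j (q powi (28 - 4 * int r)) (q ^ 32) / J 32 q)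
          * (1 / 4 * mock_f3 q)
      + q powi (- int r)
          * (theta_j (q powi (2 + 2 * int r)) (q ^ 16) * theta_j (q powi (20 + 4 * int r)) (q ^ 32) / J 32 q)
          * (1 - 1 / 4 * mock_f3 q)"
proof -
  have q0: "q \<noteq> 0" and q1: "norm q < 1"
    using norm_nome_less_1[OF assms(1)] by (simp_all add: assms(2))
  have J1: "qpoch_inf q q = J 1 q"
    by (simp add: J_eq)
  \<comment> \<open>\<open>X\<close> and \<open>Y\<close> are the two theta products at
    \<open>r = 0\<close>, with the power of \<open>q\<close> included; at \<open>r = 2\<close> they
    return with their places exchanged.\<close>
  define X where "X = q * (theta_j (q ^ 6) (q ^ 16) * theta_j (q ^ 28) (q ^ 32) / J 32 q)"
  define Y where "Y = theta_j (q\<^sup>2) (q ^ 16) * theta_j (q ^ 20) (q ^ 32) / J 32 q"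
  note XY = euler_dissection[OF q0 q1, folded X_def Y_def]
  let ?P = "(J 1 q)\<^sup>2 * J 2 q / J 4 q" and ?f = "mock_f3 q"
  have plus: "(J 1 q) ^ 3 * coeff_plus q 0 = 1 / 2 * ?P + (Y + X) * (1 - ?f / 2)"
    unfolding coeff_values(1)[OF q0 q1] XY(2) by simp
  have minus: "(J 1 q) ^ 3 * coeff_minus q 0 = Y - X"
    unfolding coeff_values(2)[OF q0 q1] XY(1) ..
  have str: "string_fun_norm 3 8 1 (2 * r + 1) \<tau> = \<phi> (int r)"
    if "\<And>z. norm q < norm z \<Longrightarrow> norm z < 1
        \<Longrightarrow> has_laurent \<phi> z (adm_numerator r q z / theta_j z q)" for r \<phi>
    by (rule string_fun_norm_eq_coeff[OF assms(1)]) (use that in \<open>simp add: assms(2)\<close>)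
  consider "r = 0" | "r = 1" | "r = 2"
    using assms(3) by auto
  then show ?thesis
  proof cases
    case 1
    have "(J 1 q) ^ 3 * string_fun_norm 3 8 1 (2 * 0 + 1) \<tau>
        = 1 / 2 * ((J 1 q) ^ 3 * coeff_plus q 0 + (J 1 q) ^ 3 * coeff_minus q 0)"
      by (subst str[OF numerator_0_laurent[OF q0 q1]]) (simp_all add: algebra_simps)
    also have "\<dots> = 1 / 4 * ?P - X * (1 / 4 * ?f) + Y * (1 - 1 / 4 * ?f)"
      unfolding plus minus by (simp add: field_simps)
    also have "\<dots> = Psi38 (2 * 0 + 1) q - X * (1 / 4 * ?f) + Y * (1 - 1 / 4 * ?f)"
      by (simp add: Psi38_def)
    finally have "(J 1 q) ^ 3 * string_fun_norm 3 8 1 (2 * 0 + 1) \<tau>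
        = Psi38 (2 * 0 + 1) q - X * (1 / 4 * ?f) + Y * (1 - 1 / 4 * ?f)" .
    then show ?thesis
      unfolding J1 1 X_def Y_def by simp
  next
    case 2
    have "(J 1 q) ^ 3 * string_fun_norm 3 8 1 (2 * 1 + 1) \<tau> = (J 1 q) ^ 3 * coeff_middle q 0"
      by (subst str[OF coeff_middle_laurent[OF q0 q1]]) simp_all
    \<comment> \<open>Both theta products equal \<open>J 4 q\<close> here, so
      \<open>1 - f_3/2\<close> is split into \<open>- f_3/4\<close> and \<open>1 - f_3/4\<close> to
      match the claim.\<close>
    also have "\<dots> = - (1 / (2 * q)) * ((J 1 q) ^ 3 * J 4 q / (J 2 q)\<^sup>2)
        - 1 / q * J 4 q * (1 / 4 * ?f) + 1 / q * J 4 q * (1 - 1 / 4 * ?f)"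
    proof -
      have "d / p * (1 - f / 2) - a / (2 * p * b) = - (1 / (2 * p)) * (a / b) - 1 / p * d * (1 / 4 * f)
          + 1 / p * d * (1 - 1 / 4 * f)"
        if "b \<noteq> 0" for a b d f p :: complex
        using that q0 by (cases "p = 0") (simp_all add: divide_simps, simp_all add: algebra_simps)
      from this[of "(J 2 q)\<^sup>2"] show ?thesis
        unfolding coeff_values(3)[OF q0 q1] using J_nonzero[OF q1, of 2] by simp
    qed
    also have "\<dots> = Psi38 (2 * 1 + 1) q - 1 / q * J 4 q * (1 / 4 * ?f) + 1 / q * J 4 q * (1 - 1 / 4 * ?f)"
      by (simp add: Psi38_def)
    finally have "(J 1 q) ^ 3 * string_fun_norm 3 8 1 (2 * 1 + 1) \<tau>
        = Psi38 (2 * 1 + 1) q - 1 / q * J 4 q * (1 / 4 * ?f) + 1 / q * J 4 q * (1 - 1 / 4 * ?f)" .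
    moreover have "1 - 2 * int 1 = - 1" "6 - 2 * int 1 = 4" "28 - 4 * int 1 = 24" "- int 1
        = - 1" "2 + 2 * int 1 = 4" "20 + 4 * int 1 = 24"
      by simp_all
    moreover have "q powi (- 1) = 1 / q" "q powi 4 = q ^ 4" "q powi 24 = q ^ 24"
      by (simp_all add: power_int_minus divide_inverse)
    ultimately show ?thesis
      unfolding J1 2 by (simp only: theta_j_product_r1[OF q0 q1])
  next
    case 3
    have "string_fun_norm 3 8 1 (2 * 2 + 1) \<tau> = 1 / (2 * q ^ 3) * (coeff_plus q 0 - coeff_minus q 0)"
      by (subst str[OF numerator_2_laurent[OF q0 q1]]) simp_all
    then have "(J 1 q) ^ 3 * string_fun_norm 3 8 1 (2 * 2 + 1) \<tau>
        = 1 / (2 * q ^ 3) * ((J 1 q) ^ 3 * coeff_plus q 0 - (J 1 q) ^ 3 * coeff_minus q 0)"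
      unfolding right_diff_distrib[symmetric] by (simp only: mult.left_commute)
    \<comment> \<open>Subtracting \<open>Y - X\<close> instead of adding it cancels the constant
      part of \<open>Y\<close> and keeps that of \<open>X\<close>.\<close>
    also have "\<dots> = 1 / (4 * q ^ 3) * ?P - 1 / q ^ 3 * Y * (1 / 4 * ?f) + 1 / q ^ 3 * X * (1 - 1 / 4 * ?f)"
      unfolding plus minus using q0 by (simp add: field_simps)
    also have "1 / q ^ 3 * X = q powi (- 2) * (theta_j (q ^ 6) (q ^ 16) * theta_j (q ^ 28) (q ^ 32) / J 32 q)"
      unfolding X_def using q0 by (simp add: power_int_minus field_simps eval_nat_numeral)
    also have "1 / q ^ 3 * Y = q powi (- 3) * (theta_j (q\<^sup>2) (q ^ 16)
        * theta_j (q ^ 20) (q ^ 32) / J 32 q)"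
      unfolding Y_def by (simp add: power_int_minus divide_inverse)
    also have "1 / (4 * q ^ 3) * ?P = Psi38 (2 * 2 + 1) q"
      by (simp add: Psi38_def)
    finally show ?thesis
      unfolding J1 3 by simp
  qed
qed

end
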